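(* Let $d\ge 2$ be an integer and let $(G_n)_{n\ge1}$ be a sequence of graphings of maximum degree at most $d$. Then the following are equivalent: (a) $(G_n)$ is local-global convergent; (b) for every $k\ge1$, the sets $\mathcal S_k(G_n)$ of $k$-colored star statistics converge in Hausdorff distance; (c) for every $k\ge1$, the sets $\overline C_k(G_n)$ of $k$-colored cherry statistics converge in Hausdorff distance.
   Context: All graphs and graphings are simple, undirected and loopless; $[k]=\{1,\dots,k\}$, $\mathbb N=\{0,1,2,\dots\}$. Graphing: $G=(X,\nu,E)$ where $X$ is a Polish space, $\nu$ is a Borel probability measure on $X$, and $(X,E)$ is a Borel graph in which every vertex has degree at most $d$, such that $\int_A e(x,B)\,d\nu(x)=\int_B e(x,A)\,d\nu(x)$ for all measurable $A,B\subseteq X$, where $e(x,S)$ is the number of neighbours of $x$ lying in $S$. A $k$-coloring of $G$ is a measurable map $f\colon X\to[k]$. $N_G(x)$ denotes the set of neighbours of $x$ and $\deg_G(x)=|N_G(x)|$. For a finite set $\Omega$, $\mathcal P(\Omega)$ is the simplex of probability measures on $\Omega$ with the total variation metric $d_{\mathrm{TV}}(\mu,\mu')=\frac12\sum_{\alpha\in\Omega}|\mu(\alpha)-\mu'(\alpha)|$. Hausdorff distance of subsets of $\mathcal P(\Omega)$ is taken with respect to $d_{\mathrm{TV}}$. A sequence of nonempty closed subsets converges in Hausdorff distance if it converges to some nonempty closed subset. Local-global convergence: for $k\ge1$, $r\ge0$ let $\mathcal G_{d,k,r}$ be the finite set of isomorphism classes of rooted $k$-colored graphs of maximum degree at most $d$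 in which every vertex is at distance at most $r$ from the root. For a graphing $G$ and a $k$-coloring $f$, $\gamma_{r,G,f}(x)\in\mathcal G_{d,k,r}$ is the isomorphism class of the induced colored radius-$r$ ball around $x$, rooted at $x$; $\tau_r(G,f)\in\mathcal P(\mathcal G_{d,k,r})$ is the distribution of $\gamma_{r,G,f}(x)$ for $x\sim\nu$; $\mathcal Q_{k,r}(G)$ is the closure of $\{\tau_r(G,f): f\colon X\to[k]\text{ measurable}\}$. The sequence $(G_n)$ is local-global convergent if for every $k\ge1$, $r\ge0$ the sets $\mathcal Q_{k,r}(G_n)$ converge in Hausdorff distance. Star statistics: $\mathsf S_{d,k}$ is the finite set of tuples $(i,n_1,\dots,n_k)$ with $i\in[k]$, $n_j\in\mathbb N$, $\sum_j n_j\le d$ (rooted $k$-colored stars). For a measurable $f\colon X\to[k]$, $\operatorname{st}_{G,f}(x)\in\mathsf S_{d,k}$ has $i=f(x)$ and $n_j=|\{y\in N_G(x): f(y)=j\}|$; $\sigma(G,f)$ is the distribution of $\operatorname{st}_{G,f}(x)$ for $x\sim\nu$; $\mathcal S_k(G)$ is the closure of $\{\sigma(G,f): f\colon X\to[k]\text{ measurable}\}$ in $\mathcal P(\mathsf S_{d,k})$. Cherry statistics: $\mathsf{Ch}_k$ is the finite set of isomorphism classes of the following rooted $k$-colored graphs: (i) a single rooted colored vertex; (ii) a colored edge rooted at one endpoint; (iii) a colored path of length two rooted at its central vertex (the two leaves are unordered). For a measurable $f\colon X\to[k]$, $\chi(G,f)\in\mathcal P(\mathsf{Ch}_k)$ is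 the law of the following random outcome: choose $x\sim\nu$; if $\deg_G(x)=0$, output the colored vertex $x$; if $\deg_G(x)=1$ with neighbour $y$, output the colored edge $xy$ rooted at $x$; if $\deg_G(x)\ge2$, choose an unordered pair of distinct neighbours $\{y,z\}$ of $x$ uniformly among all such pairs and output the colored two-star with centre (root) $x$ and leaves $y,z$. $\overline C_k(G)$ is the closure of $\{\chi(G,f): f\colon X\to[k]\text{ measurable}\}$ in $\mathcal P(\mathsf{Ch}_k)$. *)

theory Defs
  imports "HOL-Probability.Probability"
begin

section \<open>Probability measures on a finite set\<close>

text \<open>A probability measure on a finite set \<open>\<Omega>\<close> is given by its point masses, extended by \<open>0\<close> off \<open>\<Omega>\<close>.\<close>

definition prob_simplex :: "'w set \<Rightarrow> ('w \<Rightarrow> real) set" where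
  "prob_simplex \<Omega> = {p. (\<forall>\<alpha>. 0 \<le> p \<alpha>) \<and> (\<forall>\<alpha>. \<alpha> \<notin> \<Omega> \<longrightarrow> p \<alpha> = 0) \<and> (\<Sum>\<alpha>\<in>\<Omega>. p \<alpha>) = 1}"

definition tv_dist :: "'w set \<Rightarrow> ('w \<Rightarrow> real) \<Rightarrow> ('w \<Rightarrow> real) \<Rightarrow> real" where
  "tv_dist \<Omega> p q = (1/2) * (\<Sum>\<alpha>\<in>\<Omega>. \<bar>p \<alpha> - q \<alpha>\<bar>)"

lemma Metric_space_tv_dist:
  assumes "finite \<Omega>"
  shows "Metric_space (prob_simplex \<Omega>) (tv_dist \<Omega>)"
proof
  fix p q s :: "'a \<Rightarrow> real"
  show "0 \<le> tv_dist \<Omega> p q"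
    by (simp add: tv_dist_def sum_nonneg)
  show "tv_dist \<Omega> p q = tv_dist \<Omega> q p"
    by (simp add: tv_dist_def abs_minus_commute)
  have "(\<Sum>\<alpha>\<in>\<Omega>. \<bar>p \<alpha> - s \<alpha>\<bar>) \<le> (\<Sum>\<alpha>\<in>\<Omega>. \<bar>p \<alpha> - q \<alpha>\<bar> + \<bar>q \<alpha> - s \<alpha>\<bar>)"
    by (rule sum_mono) simp
  then show "tv_dist \<Omega> p s \<le> tv_dist \<Omega> p q + tv_dist \<Omega> q s"
    by (simp add: tv_dist_def sum.distrib)
  assume "p \<in> prob_simplex \<Omega>" "q \<in> prob_simplex \<Omega>"
  then show "tv_dist \<Omega> p q = 0 \<longleftrightarrow> p = q"
    using assms by (auto simp: tv_dist_def prob_simplex_def sum_nonneg_eq_0_iff fun_eq_iff)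
qed

definition tv_topology :: "'w set \<Rightarrow> ('w \<Rightarrow> real) topology" where
  "tv_topology \<Omega> = Metric_space.mtopology (prob_simplex \<Omega>) (tv_dist \<Omega>)"

definition hausdorff_dist :: "('p \<Rightarrow> 'p \<Rightarrow> real) \<Rightarrow> 'p set \<Rightarrow> 'p set \<Rightarrow> real" where
  "hausdorff_dist \<delta> A B =
     max (SUP a\<in>A. INF b\<in>B. \<delta> a b) (SUP b\<in>B. INF a\<in>A. \<delta> a b)"

definition hausdorff_convergent :: "'w set \<Rightarrow> (nat \<Rightarrow> ('w \<Rightarrow> real) set) \<Rightarrow> bool" where
  "hausdorff_convergent \<Omega> A \<longleftrightarrow>
     (\<exists>L. L \<noteq> {} \<and> closedin (tv_topology \<Omega>) L \<and>
          (\<lambda>n. hausdorff_dist (tv_dist \<Omega>) (A n) L) \<longlonglongrightarrow> 0)"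

section \<open>Graphings\<close>

text \<open>The vertex space is a topology on an arbitrary type rather than a whole type, so that the
  graphings of a sequence may live on different Polish spaces. Edges are ordered pairs, each
  undirected edge occurring in both orientations.\<close>

record 'a graphing =
  vtop :: "'a topology"
  vmeas :: "'a measure"
  edge :: "('a \<times> 'a) set"

definition polish :: "'a topology \<Rightarrow> bool" where
  "polish T \<longleftrightarrow> completely_metrizable_space T \<and> second_countable T"

definition borel_of :: "'a topology \<Rightarrow> 'a measure" where
  "borel_of T = sigma (topspace T) {U. openin T U}"

definition nbrs :: "'a graphing \<Rightarrow> 'a \<Rightarrow> 'a set" where
  "nbrs G x = {y. (x, y) \<in> edge G}"

definition edge_count :: "'a graphing \<Rightarrow> 'a \<Rightarrow> 'a set \<Rightarrow> real" where
  "edge_count G x S = real (card (nbrs G x \<inter> S))"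

text \<open>The Lebesgue integral of HOL is total (with value \<open>0\<close> for non-integrable functions), so the
  equality of integrals includes the statement that both integrals exist. For a Borel graph of
  bounded degree they always do.\<close>

definition is_graphing :: "nat \<Rightarrow> 'a graphing \<Rightarrow> bool" where
  "is_graphing d G \<longleftrightarrow>
     polish (vtop G) \<and>
     prob_space (vmeas G) \<and> sets (vmeas G) = sets (borel_of (vtop G)) \<and>
     edge G \<in> sets (borel_of (prod_topology (vtop G) (vtop G))) \<and>
     sym (edge G) \<and> irrefl (edge G) \<and>
     (\<forall>x\<in>topspace (vtop G). finite (nbrs G x) \<and> card (nbrs G x) \<le> d) \<and>
     (\<forall>A\<in>sets (vmeas G). \<forall>B\<in>sets (vmeas G).
        set_integrable (vmeas G) A (\<lambda>x. edge_count G x B) \<and>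
        set_integrable (vmeas G) B (\<lambda>x. edge_count G x A) \<and>
        (LINT x:A|vmeas G. edge_count G x B) = (LINT x:B|vmeas G. edge_count G x A))"

definition colorings :: "nat \<Rightarrow> 'a graphing \<Rightarrow> ('a \<Rightarrow> nat) set" where
  "colorings k G = measurable (vmeas G) (count_space {1..k})"

section \<open>Rooted colored graphs up to isomorphism\<close>

record 'v rcgraph =
  rverts :: "'v set"
  redges :: "('v \<times> 'v) set"
  rroot :: 'v
  rcol :: "'v \<Rightarrow> nat"

definition is_rcgraph :: "'v rcgraph \<Rightarrow> bool" where
  "is_rcgraph H \<longleftrightarrow> finite (rverts H) \<and> rroot H \<in> rverts H \<and>
     redges H \<subseteq> rverts H \<times> rverts H \<and> sym (redges H) \<and> irrefl (redges H)"

definition rc_iso :: "'v rcgraph \<Rightarrow> 'w rcgraph \<Rightarrow> bool" where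
  "rc_iso H K \<longleftrightarrow> (\<exists>\<phi>. bij_betw \<phi> (rverts H) (rverts K) \<and>
     (\<forall>u\<in>rverts H. \<forall>v\<in>rverts H. (u, v) \<in> redges H \<longleftrightarrow> (\<phi> u, \<phi> v) \<in> redges K) \<and>
     \<phi> (rroot H) = rroot K \<and>
     (\<forall>v\<in>rverts H. rcol K (\<phi> v) = rcol H v))"

text \<open>The isomorphism class of a finite rooted colored graph, on vertices of any type, is
  represented by the set of its isomorphic copies with vertices in \<open>nat\<close>.\<close>

definition iso_class :: "'v rcgraph \<Rightarrow> nat rcgraph set" where
  "iso_class H = {K. is_rcgraph K \<and> rc_iso H K}"

section \<open>Local-global convergence\<close>

definition ball_types :: "nat \<Rightarrow> nat \<Rightarrow> nat \<Rightarrow> nat rcgraph set set" where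
  "ball_types d k r = iso_class ` {H :: nat rcgraph. is_rcgraph H \<and>
     (\<forall>v\<in>rverts H. rcol H v \<in> {1..k}) \<and>
     (\<forall>v\<in>rverts H. card {w. (v, w) \<in> redges H} \<le> d) \<and>
     (\<forall>v\<in>rverts H. \<exists>i\<le>r. (rroot H, v) \<in> redges H ^^ i)}"

definition graphing_ball :: "nat \<Rightarrow> 'a graphing \<Rightarrow> 'a \<Rightarrow> 'a set" where
  "graphing_ball r G x = {y. \<exists>i\<le>r. (x, y) \<in> edge G ^^ i}"

definition colored_ball :: "nat \<Rightarrow> 'a graphing \<Rightarrow> ('a \<Rightarrow> nat) \<Rightarrow> 'a \<Rightarrow> 'a rcgraph" where
  "colored_ball r G f x =
     \<lparr>rverts = graphing_ball r G x,
      redges = edge G \<inter> graphing_ball r G x \<times> graphing_ball r G x,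
      rroot = x,
      rcol = f\<rparr>"

definition ball_stat :: "nat \<Rightarrow> 'a graphing \<Rightarrow> ('a \<Rightarrow> nat) \<Rightarrow> nat rcgraph set \<Rightarrow> real" where
  "ball_stat r G f \<alpha> =
     measure (vmeas G) {x \<in> space (vmeas G). iso_class (colored_ball r G f x) = \<alpha>}"

definition ball_stats :: "nat \<Rightarrow> nat \<Rightarrow> nat \<Rightarrow> 'a graphing \<Rightarrow> (nat rcgraph set \<Rightarrow> real) set" where
  "ball_stats d k r G = tv_topology (ball_types d k r) closure_of (ball_stat r G ` colorings k G)"

definition local_global_convergent :: "nat \<Rightarrow> (nat \<Rightarrow> 'a graphing) \<Rightarrow> bool" where
  "local_global_convergent d G \<longleftrightarrow>
     (\<forall>k\<ge>1. \<forall>r. hausdorff_convergent (ball_types d k r) (\<lambda>n. ball_stats d k r (G n)))"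

section \<open>Star statistics\<close>

text \<open>The tuple \<open>(i, n\<^sub>1, \<dots>, n\<^sub>k)\<close> is represented by the pair of \<open>i\<close> and the list of the \<open>n\<^sub>j\<close>.\<close>

definition star_types :: "nat \<Rightarrow> nat \<Rightarrow> (nat \<times> nat list) set" where
  "star_types d k = {(i, ns). i \<in> {1..k} \<and> length ns = k \<and> sum_list ns \<le> d}"

definition star_at :: "nat \<Rightarrow> 'a graphing \<Rightarrow> ('a \<Rightarrow> nat) \<Rightarrow> 'a \<Rightarrow> nat \<times> nat list" where
  "star_at k G f x = (f x, map (\<lambda>j. card {y \<in> nbrs G x. f y = j}) [1..<Suc k])"

definition star_stat :: "nat \<Rightarrow> 'a graphing \<Rightarrow> ('a \<Rightarrow> nat) \<Rightarrow> nat \<times> nat list \<Rightarrow> real" where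
  "star_stat k G f \<alpha> = measure (vmeas G) {x \<in> space (vmeas G). star_at k G f x = \<alpha>}"

definition star_stats :: "nat \<Rightarrow> nat \<Rightarrow> 'a graphing \<Rightarrow> (nat \<times> nat list \<Rightarrow> real) set" where
  "star_stats d k G = tv_topology (star_types d k) closure_of (star_stat k G ` colorings k G)"

section \<open>Cherry statistics\<close>

text \<open>The star with center (and root) \<open>x\<close> and set of leaves \<open>L\<close>. Edges between leaves are not
  included, even if they are present in an ambient graph.\<close>

definition star_graph :: "'v \<Rightarrow> 'v set \<Rightarrow> ('v \<Rightarrow> nat) \<Rightarrow> 'v rcgraph" where
  "star_graph x L c =
     \<lparr>rverts = insert x L, redges = {x} \<times> L \<union> L \<times> {x}, rroot = x, rcol = c\<rparr>"

text \<open>A star with at most two leaves is a single vertex, an edge rooted at an endpoint, or a path of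
  length two rooted at its central vertex.\<close>

definition cherry_types :: "nat \<Rightarrow> nat rcgraph set set" where
  "cherry_types k = {iso_class (star_graph x L c) | (x :: nat) L c.
     finite L \<and> card L \<le> 2 \<and> x \<notin> L \<and> (\<forall>v\<in>insert x L. c v \<in> {1..k})}"

definition cherry_at :: "'a graphing \<Rightarrow> ('a \<Rightarrow> nat) \<Rightarrow> 'a \<Rightarrow> nat rcgraph set pmf" where
  "cherry_at G f x =
     (if card (nbrs G x) = 0 then return_pmf (iso_class (star_graph x {} f))
      else if card (nbrs G x) = 1 then return_pmf (iso_class (star_graph x (nbrs G x) f))
      else map_pmf (\<lambda>P. iso_class (star_graph x P f))
             (pmf_of_set {P. P \<subseteq> nbrs G x \<and> card P = 2}))"

definition cherry_stat :: "'a graphing \<Rightarrow> ('a \<Rightarrow> nat) \<Rightarrow> nat rcgraph set \<Rightarrow> real" where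
  "cherry_stat G f \<alpha> = (LINT x|vmeas G. pmf (cherry_at G f x) \<alpha>)"

definition cherry_stats :: "nat \<Rightarrow> 'a graphing \<Rightarrow> (nat rcgraph set \<Rightarrow> real) set" where
  "cherry_stats k G = tv_topology (cherry_types k) closure_of (cherry_stat G ` colorings k G)"

end

theory Submission
  imports Defs
begin

text \<open>Hausdorff convergence of the closed sets of statistics is a Cauchy condition on the statistics
  of colorings. Star statistics are a pushforward of radius-one ball statistics, and cherry statistics
  are the image of star statistics under a Markov kernel, which gives (a) to (b) to (c).

  For the converses, refine a coloring \<open>f\<close> of \<open>G\<close> by a coloring \<open>g\<close> whose color at a vertex records
  its color under \<open>f\<close> and under a coloring \<open>c\<close> that is injective on balls, together with the same data
  about its neighbors, iterated. If the star statistics of a coloring \<open>g'\<close> of \<open>H\<close> are close to those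
  of \<open>g\<close>, then for most vertices \<open>x\<close> of \<open>H\<close> the ball around \<open>x\<close> looks like a covering of the ball
  described by \<open>g' x\<close>. This covering need not be injective (a union of 8-cycles covers a union of
  4-cycles), but it can only increase the size of the ball. Since \<open>G\<close> and \<open>H\<close> play symmetric roles, the
  expected ball sizes almost agree, so the covering is an isomorphism almost everywhere. In the same
  way, cherries only show that the neighbors of \<open>x\<close> form a subset of those described by \<open>g' x\<close>, and
  comparing expected degrees in both directions yields equality almost everywhere.\<close>

section \<open>Convergence in Hausdorff distance as a Cauchy condition\<close>

text \<open>The comparison of expectations closes because the weights in question (ball size,
  degree) depend on the graphing alone and not on the coloring. A simulation from \<open>G\<close>
  to \<open>H\<close> and one from \<open>H\<close> to \<open>G\<close>, run with unrelated
  colorings, therefore bound the same difference of expectations with opposite signs. Both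
  directions are available since the two indices in the Cauchy condition may be exchanged. The
  number of colors \<open>K\<close>, the weight bound \<open>b\<close> and the constant
  \<open>C\<close> must depend only on \<open>d\<close>, \<open>k\<close> and \<open>r\<close>; then
  one tolerance serves all pairs of graphings of the sequence. Stars see only one edge, so a color
  has to carry a tower of levels, and each step along a path consumes one level. A vertex with a
  wrong star spoils every ball that contains it. Mass transport controls this loss: passing to
  points that reach a set in one step multiplies its measure by at most \<open>1 + d\<close>.
  Measurability of such reachable sets is drawn from the integrability of edge counts, which is part
  of being a graphing. For cherries the inequality between true and decoded degrees is reversed, so
  the weight is \<open>d\<close> minus the degree.\<close>

lemma tv_dist_le:
  assumes "finite \<Omega>" and "\<And>\<alpha>. \<alpha> \<in> \<Omega> \<Longrightarrow> \<bar>p \<alpha> - q \<alpha>\<bar> \<le> e"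
  shows "tv_dist \<Omega> p q \<le> real (card \<Omega>) * e"
proof -
  have *: "(\<Sum>\<alpha>\<in>\<Omega>. \<bar>p \<alpha> - q \<alpha>\<bar>) \<le> real (card \<Omega>) * e"
    using assms(2) by (rule sum_bounded_above)
  have "0 \<le> (\<Sum>\<alpha>\<in>\<Omega>. \<bar>p \<alpha> - q \<alpha>\<bar>)"
    by (rule sum_nonneg) simp
  with * show ?thesis
    unfolding tv_dist_def by linarith
qed

lemma sum_diff_le_tv_dist:
  assumes "finite \<Omega>" "A \<subseteq> \<Omega>"
  shows "(\<Sum>\<alpha>\<in>A. \<bar>p \<alpha> - q \<alpha>\<bar>) \<le> 2 * tv_dist \<Omega> p q"
  using sum_mono2[of \<Omega> A "\<lambda>\<alpha>. \<bar>p \<alpha> - q \<alpha>\<bar>"] assms by (simp add: tv_dist_def)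

lemma tv_dist_nonneg: "0 \<le> tv_dist \<Omega> p q"
  by (simp add: tv_dist_def sum_nonneg)

lemma tv_dist_commute: "tv_dist \<Omega> p q = tv_dist \<Omega> q p"
  by (simp add: tv_dist_def abs_minus_commute)

lemma tv_dist_triangle: "tv_dist \<Omega> p s \<le> tv_dist \<Omega> p q + tv_dist \<Omega> q s"
proof -
  have "(\<Sum>\<alpha>\<in>\<Omega>. \<bar>p \<alpha> - s \<alpha>\<bar>) \<le> (\<Sum>\<alpha>\<in>\<Omega>. \<bar>p \<alpha> - q \<alpha>\<bar> + \<bar>q \<alpha> - s \<alpha>\<bar>)"
    by (rule sum_mono) simp
  then show ?thesis
    by (simp add: tv_dist_def sum.distrib)
qed

lemma tv_dist_half:
  assumes "tv_dist \<Omega> p q < e / 2" "tv_dist \<Omega> q s < e / 2"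
  shows "tv_dist \<Omega> p s < e"
  using tv_dist_triangle[of \<Omega> p s q] assms by linarith

lemma prob_simplex_le_1:
  assumes "finite \<Omega>" "p \<in> prob_simplex \<Omega>"
  shows "0 \<le> p \<alpha>" "p \<alpha> \<le> 1"
proof -
  show "0 \<le> p \<alpha>"
    using assms by (simp add: prob_simplex_def)
  show "p \<alpha> \<le> 1"
  proof (cases "\<alpha> \<in> \<Omega>")
    case True
    have "p \<alpha> \<le> (\<Sum>\<alpha>\<in>\<Omega>. p \<alpha>)"
      using assms True by (intro member_le_sum) (auto simp: prob_simplex_def)
    then show ?thesis
      using assms by (simp add: prob_simplex_def)
  qed (use assms in \<open>simp add: prob_simplex_def\<close>)
qed

lemma tv_dist_le_card:
  assumes "finite \<Omega>" "p \<in> prob_simplex \<Omega>" "q \<in> prob_simplex \<Omega>"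
  shows "tv_dist \<Omega> p q \<le> real (card \<Omega>)"
proof -
  have "\<bar>p \<alpha> - q \<alpha>\<bar> \<le> 1" for \<alpha>
    using prob_simplex_le_1[OF assms(1,2), of \<alpha>] prob_simplex_le_1[OF assms(1,3), of \<alpha>] by linarith
  then show ?thesis
    using tv_dist_le[OF assms(1), of p q 1] by simp
qed

lemma tv_closure_of:
  assumes "finite \<Omega>"
  shows "tv_topology \<Omega> closure_of P =
    {p \<in> prob_simplex \<Omega>. \<forall>e>0. \<exists>q\<in>P \<inter> prob_simplex \<Omega>. tv_dist \<Omega> p q < e}"
proof -
  interpret Metric_space "prob_simplex \<Omega>" "tv_dist \<Omega>"
    by (rule Metric_space_tv_dist[OF assms])
  show ?thesis
    unfolding tv_topology_def metric_closure_of by (auto simp: in_mball) 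
qed

text \<open>Both indices range over the same tail, so exchanging them yields the other half of the
  Hausdorff condition. The sets are those of actual statistics, before closure, so that arguments
  can work with colorings.\<close>

definition tv_cauchy :: "'w set \<Rightarrow> (nat \<Rightarrow> ('w \<Rightarrow> real) set) \<Rightarrow> bool" where
  "tv_cauchy \<Omega> P \<longleftrightarrow>
     (\<forall>e>0. \<exists>N. \<forall>m\<ge>N. \<forall>n\<ge>N. \<forall>p\<in>P m. \<exists>q\<in>P n. tv_dist \<Omega> p q < e)"

text \<open>The sequence of graphings starts at index 1 and nothing is known about index 0, so the
  threshold is raised to at least 1.\<close>

lemma tv_cauchyD:
  assumes "tv_cauchy \<Omega> P" "e > 0"
  obtains N where "\<forall>m\<ge>N. \<forall>n\<ge>N. \<forall>p\<in>P m. \<exists>q\<in>P n. tv_dist \<Omega> p q < e" "N \<ge> 1"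
proof -
  obtain N where N: "\<forall>m\<ge>N. \<forall>n\<ge>N. \<forall>p\<in>P m. \<exists>q\<in>P n. tv_dist \<Omega> p q < e"
    using assms unfolding tv_cauchy_def by blast
  show ?thesis
    by (rule that[of "max N 1"]) (use N in auto)
qed

section \<open>Sequential compactness of the simplex\<close>

lemma convergent_subsequence_finite:
  fixes x :: "nat \<Rightarrow> 'w \<Rightarrow> real"
  assumes "finite \<Omega>" "\<And>n \<alpha>. \<alpha> \<in> \<Omega> \<Longrightarrow> x n \<alpha> \<in> {0..1}"
  obtains s :: "nat \<Rightarrow> nat" and l
  where "strict_mono s" "\<And>\<alpha>. \<alpha> \<in> \<Omega> \<Longrightarrow> (\<lambda>n. x (s n) \<alpha>) \<longlonglongrightarrow> l \<alpha>"
proof -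
  have "\<exists>s l. strict_mono (s :: nat \<Rightarrow> nat) \<and> (\<forall>\<alpha>\<in>\<Omega>. (\<lambda>n. x (s n) \<alpha>) \<longlonglongrightarrow> l \<alpha>)"
    using assms
  proof (induction \<Omega> rule: finite_induct)
    case empty
    show ?case
      by (rule exI[of _ id]) (auto simp: strict_mono_def)
  next
    case (insert \<beta> \<Omega>)
    obtain s l where s: "strict_mono s" "\<forall>\<alpha>\<in>\<Omega>. (\<lambda>n. x (s n) \<alpha>) \<longlonglongrightarrow> l \<alpha>"
      using insert by (metis insert_iff)
    have "\<forall>n. x (s n) \<beta> \<in> {0..1}"
      using insert.prems by blast
    then obtain a t where t: "strict_mono t" "((\<lambda>n. x (s n) \<beta>) \<circ> t) \<longlonglongrightarrow> a"
      using compact_Icc[of "0::real" 1] unfolding compact_def by meson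
    have "(\<lambda>n. x ((s \<circ> t) n) \<alpha>) \<longlonglongrightarrow> (l(\<beta> := a)) \<alpha>" if "\<alpha> \<in> insert \<beta> \<Omega>" for \<alpha>
    proof (cases "\<alpha> = \<beta>")
      case True
      then show ?thesis using t(2) by (simp add: o_def)
    next
      case False
      then show ?thesis
        using LIMSEQ_subseq_LIMSEQ[OF _ t(1), of "\<lambda>n. x (s n) \<alpha>" "l \<alpha>"] s(2) that
        by (simp add: o_def)
    qed
    moreover have "strict_mono (s \<circ> t)"
      using s(1) t(1) by (rule strict_mono_o)
    ultimately show ?case by blast
  qed
  then show ?thesis
    using that by blast
qed

lemma tv_convergent_subsequence:
  assumes fin: "finite \<Omega>" and x: "\<And>n. x n \<in> prob_simplex \<Omega>"
  obtains s :: "nat \<Rightarrow> nat" and l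
  where "strict_mono s" "l \<in> prob_simplex \<Omega>" "(\<lambda>n. tv_dist \<Omega> (x (s n)) l) \<longlonglongrightarrow> 0"
proof -
  obtain s :: "nat \<Rightarrow> nat" and l0
    where s: "strict_mono s" and l0: "\<And>\<alpha>. \<alpha> \<in> \<Omega> \<Longrightarrow> (\<lambda>n. x (s n) \<alpha>) \<longlonglongrightarrow> l0 \<alpha>"
    using convergent_subsequence_finite[OF fin, of x] prob_simplex_le_1[OF fin x]
    by (metis atLeastAtMost_iff)
  \<comment> \<open>The extraction says nothing about \<open>l0\<close> off \<open>\<Omega>\<close>,
    whereas \<open>prob_simplex\<close> demands the value 0 there.\<close>
  define l where "l = (\<lambda>\<alpha>. if \<alpha> \<in> \<Omega> then l0 \<alpha> else 0)"
  have l: "(\<lambda>n. x (s n) \<alpha>) \<longlonglongrightarrow> l \<alpha>" if "\<alpha> \<in> \<Omega>" for \<alpha>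
    using l0[OF that] that by (simp add: l_def)
  have "(\<lambda>n. \<Sum>\<alpha>\<in>\<Omega>. x (s n) \<alpha>) \<longlonglongrightarrow> (\<Sum>\<alpha>\<in>\<Omega>. l \<alpha>)"
    using l by (rule tendsto_sum)
  moreover have "(\<Sum>\<alpha>\<in>\<Omega>. x (s n) \<alpha>) = 1" for n
    using x by (simp add: prob_simplex_def)
  ultimately have "(\<Sum>\<alpha>\<in>\<Omega>. l \<alpha>) = 1"
    by (simp add: LIMSEQ_const_iff)
  moreover have "0 \<le> l \<alpha>" for \<alpha>
  proof (cases "\<alpha> \<in> \<Omega>")
    case True
    then show ?thesis
      using LIMSEQ_le_const[OF l[OF True], of 0] prob_simplex_le_1(1)[OF fin x] by blast
  qed (simp add: l_def)
  ultimately have "l \<in> prob_simplex \<Omega>"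
    by (simp add: prob_simplex_def l_def)
  moreover have "(\<lambda>n. tv_dist \<Omega> (x (s n)) l) \<longlonglongrightarrow> (1/2) * (\<Sum>\<alpha>\<in>\<Omega>. \<bar>l \<alpha> - l \<alpha>\<bar>)"
    unfolding tv_dist_def by (intro tendsto_intros l)
  ultimately show ?thesis
    using s that by simp
qed

text \<open>\<open>SUP\<close> and \<open>INF\<close> of reals are informative only for bounded
  families: nonnegativity bounds the distances below, and the crude diameter bound
  \<open>card \<Omega>\<close> bounds the outer suprema.\<close>

lemma INF_less_hausdorff_dist:
  assumes fin: "finite \<Omega>" and A: "A \<subseteq> prob_simplex \<Omega>" "A \<noteq> {}"
    and B: "B \<subseteq> prob_simplex \<Omega>" "B \<noteq> {}"
    and less: "hausdorff_dist (tv_dist \<Omega>) A B < e"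
  shows "a \<in> A \<Longrightarrow> \<exists>b\<in>B. tv_dist \<Omega> a b < e" "b \<in> B \<Longrightarrow> \<exists>a\<in>A. tv_dist \<Omega> a b < e"
proof -
  have bdd1: "bdd_below ((\<lambda>b. tv_dist \<Omega> a b) ` B)" for a
    by (rule bdd_belowI2[of _ 0]) (rule tv_dist_nonneg)
  have bdd2: "bdd_below ((\<lambda>a. tv_dist \<Omega> a b) ` A)" for b
    by (rule bdd_belowI2[of _ 0]) (rule tv_dist_nonneg)
  obtain a0 b0 where a0: "a0 \<in> A" and b0: "b0 \<in> B"
    using A B by blast
  have "(INF b\<in>B. tv_dist \<Omega> a b) \<le> real (card \<Omega>)" if "a \<in> A" for a
    using cINF_lower[OF bdd1 b0, of a] tv_dist_le_card[OF fin, of a b0] that b0 A B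
    by (meson order_trans subsetD)
  then have up1: "bdd_above ((\<lambda>a. INF b\<in>B. tv_dist \<Omega> a b) ` A)"
    by (intro bdd_aboveI2)
  have "(INF a\<in>A. tv_dist \<Omega> a b) \<le> real (card \<Omega>)" if "b \<in> B" for b
    using cINF_lower[OF bdd2 a0, of b] tv_dist_le_card[OF fin, of a0 b] that a0 A B
    by (meson order_trans subsetD)
  then have up2: "bdd_above ((\<lambda>b. INF a\<in>A. tv_dist \<Omega> a b) ` B)"
    by (intro bdd_aboveI2)
  show "\<exists>b\<in>B. tv_dist \<Omega> a b < e" if "a \<in> A"
  proof -
    have "(INF b\<in>B. tv_dist \<Omega> a b) < e"
      using cSUP_upper[OF that up1] less by (simp add: hausdorff_dist_def)
    then show ?thesis
      using cInf_lessD[of "(\<lambda>b. tv_dist \<Omega> a b) ` B"] B by auto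
  qed
  show "\<exists>a\<in>A. tv_dist \<Omega> a b < e" if "b \<in> B"
  proof -
    have "(INF a\<in>A. tv_dist \<Omega> a b) < e"
      using cSUP_upper[OF that up2] less by (simp add: hausdorff_dist_def)
    then show ?thesis
      using cInf_lessD[of "(\<lambda>a. tv_dist \<Omega> a b) ` A"] A by auto
  qed
qed

lemma hausdorff_dist_le:
  assumes A: "A \<noteq> {}" and B: "B \<noteq> {}"
    and 1: "\<And>a. a \<in> A \<Longrightarrow> \<exists>b\<in>B. tv_dist \<Omega> a b \<le> e"
    and 2: "\<And>b. b \<in> B \<Longrightarrow> \<exists>a\<in>A. tv_dist \<Omega> a b \<le> e"
  shows "hausdorff_dist (tv_dist \<Omega>) A B \<le> e"
proof -
  have "(INF b\<in>B. tv_dist \<Omega> a b) \<le> e" if "a \<in> A" for a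
  proof -
    obtain b where b: "b \<in> B" "tv_dist \<Omega> a b \<le> e"
      using 1[OF \<open>a \<in> A\<close>] by blast
    show ?thesis
      by (rule cINF_lower2[where x = b]) (use b in \<open>auto intro!: bdd_belowI2[of _ 0] tv_dist_nonneg\<close>)
  qed
  moreover have "(INF a\<in>A. tv_dist \<Omega> a b) \<le> e" if "b \<in> B" for b
  proof -
    obtain a where a: "a \<in> A" "tv_dist \<Omega> a b \<le> e"
      using 2[OF \<open>b \<in> B\<close>] by blast
    show ?thesis
      by (rule cINF_lower2[where x = a]) (use a in \<open>auto intro!: bdd_belowI2[of _ 0] tv_dist_nonneg\<close>)
  qed
  ultimately show ?thesis
    unfolding hausdorff_dist_def by (intro max.boundedI cSUP_least A B)
qed

lemma hausdorff_dist_nonneg: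
  assumes fin: "finite \<Omega>" and A: "A \<subseteq> prob_simplex \<Omega>" "A \<noteq> {}"
    and B: "B \<subseteq> prob_simplex \<Omega>" "B \<noteq> {}"
  shows "0 \<le> hausdorff_dist (tv_dist \<Omega>) A B"
proof (rule ccontr)
  assume "\<not> ?thesis"
  then obtain a b where "tv_dist \<Omega> a b < 0"
    using INF_less_hausdorff_dist(1)[OF assms, of 0] A(2) by force
  then show False
    using tv_dist_nonneg[of \<Omega> a b] by simp
qed

text \<open>Completeness of the hyperspace of a compact metric space, phrased for dense subsets
  \<open>P n\<close> of the closed sets. Index 0 is exempt, which does not affect limits.\<close>

theorem hausdorff_convergent_iff_tv_cauchy:
  assumes fin: "finite \<Omega>"
    and P: "\<And>n. n \<ge> 1 \<Longrightarrow> P n \<subseteq> prob_simplex \<Omega>" "\<And>n. n \<ge> 1 \<Longrightarrow> P n \<noteq> {}"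
  shows "hausdorff_convergent \<Omega> (\<lambda>n. tv_topology \<Omega> closure_of P n) \<longleftrightarrow> tv_cauchy \<Omega> P"
    (is "hausdorff_convergent \<Omega> ?A \<longleftrightarrow> _")
proof
  have A: "?A n \<subseteq> prob_simplex \<Omega>" for n
    by (auto simp: tv_closure_of[OF fin])
  have PA: "P n \<subseteq> ?A n" if "n \<ge> 1" for n
  proof -
    have "tv_dist \<Omega> p p = 0" for p
      by (simp add: tv_dist_def)
    then show ?thesis
      using P(1)[OF that] unfolding tv_closure_of[OF fin]
      by (auto intro!: bexI simp: subset_iff)
  qed
  have A_ne: "?A n \<noteq> {}" if "n \<ge> 1" for n
    using PA P(2) that by blast
  have AP: "\<exists>q\<in>P n. tv_dist \<Omega> p q < e" if "p \<in> ?A n" "e > 0" for p n e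
    using that by (auto simp: tv_closure_of[OF fin])
  {
    assume "hausdorff_convergent \<Omega> ?A"
    then obtain L where L: "L \<noteq> {}" "closedin (tv_topology \<Omega>) L"
      and lim: "(\<lambda>n. hausdorff_dist (tv_dist \<Omega>) (?A n) L) \<longlonglongrightarrow> 0"
      unfolding hausdorff_convergent_def by blast
    have L': "L \<subseteq> prob_simplex \<Omega>"
      using closedin_subset[OF L(2)] Metric_space.topspace_mtopology[OF Metric_space_tv_dist[OF fin]]
      by (simp add: tv_topology_def)
    show "tv_cauchy \<Omega> P"
      unfolding tv_cauchy_def
    proof (intro allI impI)
      fix e :: real
      assume e: "e > 0"
      then have "eventually (\<lambda>n. hausdorff_dist (tv_dist \<Omega>) (?A n) L < e / 3) sequentially"
        using order_tendstoD(2)[OF lim, of "e / 3"] by simp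
      then obtain N where N: "\<And>n. n \<ge> N \<Longrightarrow> hausdorff_dist (tv_dist \<Omega>) (?A n) L < e / 3"
        unfolding eventually_sequentially by blast
      show "\<exists>N. \<forall>m\<ge>N. \<forall>n\<ge>N. \<forall>p\<in>P m. \<exists>q\<in>P n. tv_dist \<Omega> p q < e"
      proof (intro exI[of _ "max N 1"] allI impI ballI)
        fix m n p
        assume m: "m \<ge> max N 1" and n: "n \<ge> max N 1" and p: "p \<in> P m"
        have "p \<in> ?A m"
          using PA p m by auto
        then obtain l where l: "l \<in> L" "tv_dist \<Omega> p l < e / 3"
          using INF_less_hausdorff_dist(1)[OF fin A A_ne L' L(1) N] m by fastforce
        then obtain a where a: "a \<in> ?A n" "tv_dist \<Omega> a l < e / 3"
          using INF_less_hausdorff_dist(2)[OF fin A A_ne L' L(1) N] n by fastforce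
        obtain q where q: "q \<in> P n" "tv_dist \<Omega> a q < e / 3"
          using AP[OF a(1), of "e / 3"] e by auto
        have "tv_dist \<Omega> p q < e"
          using tv_dist_triangle[of \<Omega> p q l] tv_dist_triangle[of \<Omega> l q a] tv_dist_commute[of \<Omega> l a]
            l(2) a(2) q(2) by linarith
        then show "\<exists>q\<in>P n. tv_dist \<Omega> p q < e"
          using q(1) by blast
      qed
    qed
  next
    assume C: "tv_cauchy \<Omega> P"
    \<comment> \<open>The Kuratowski lower limit of the sets \<open>P n\<close>; for a Cauchy
      sequence it is also the Hausdorff limit.\<close>
    define L where "L = {l \<in> prob_simplex \<Omega>. \<forall>e>0. \<exists>N. \<forall>n\<ge>N. \<exists>q\<in>P n. tv_dist \<Omega> l q < e}"
    \<comment> \<open>Approximants of \<open>p\<close> are chosen in all later sets. Compactness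
      gives them a limit point \<open>l\<close>, and the Cauchy condition, applied to an approximant
      close to \<open>l\<close>, puts \<open>l\<close> into \<open>L\<close>. Passing to the limit
      makes the inequality non-strict.\<close>
    have near_L: "\<exists>l\<in>L. tv_dist \<Omega> p l \<le> e"
      if N: "\<forall>m\<ge>N. \<forall>n\<ge>N. \<forall>p\<in>P m. \<exists>q\<in>P n. tv_dist \<Omega> p q < e" "N \<ge> 1"
        and m: "m \<ge> N" "p \<in> P m" for N e m p
    proof -
      have "\<exists>q\<in>P (N + n). tv_dist \<Omega> p q < e" for n
        using N(1) m by simp
      then obtain q where q: "\<And>n. q n \<in> P (N + n)" "\<And>n. tv_dist \<Omega> p (q n) < e"
        by metis
      have "q n \<in> prob_simplex \<Omega>" for n
        using q(1) P(1)[of "N + n"] N(2) by auto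
      then obtain s l where s: "strict_mono s" and l: "l \<in> prob_simplex \<Omega>"
        and lim: "(\<lambda>n. tv_dist \<Omega> (q (s n)) l) \<longlonglongrightarrow> 0"
        by (rule tv_convergent_subsequence[OF fin])
      have "\<exists>M. \<forall>n\<ge>M. \<exists>q\<in>P n. tv_dist \<Omega> l q < e'" if "e' > 0" for e'
      proof -
        obtain M where M: "\<forall>m\<ge>M. \<forall>n\<ge>M. \<forall>p\<in>P m. \<exists>q\<in>P n. tv_dist \<Omega> p q < e' / 2"
          using half_gt_zero[OF \<open>e' > 0\<close>] by (rule tv_cauchyD[OF C]) blast
        have "eventually (\<lambda>n. tv_dist \<Omega> (q (s n)) l < e' / 2) sequentially"
          using order_tendstoD(2)[OF lim, of "e' / 2"] that by simp
        then obtain i0 where "\<And>n. n \<ge> i0 \<Longrightarrow> tv_dist \<Omega> (q (s n)) l < e' / 2"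
          unfolding eventually_sequentially by blast
        then obtain i where i: "tv_dist \<Omega> (q (s i)) l < e' / 2" "i \<ge> M"
          by (metis max.cobounded1 max.cobounded2)
        have "s i \<ge> M"
          using seq_suble[OF s, of i] i(2) by simp
        have "\<exists>r\<in>P n. tv_dist \<Omega> l r < e'" if "n \<ge> M" for n
        proof -
          obtain r where r: "r \<in> P n" "tv_dist \<Omega> (q (s i)) r < e' / 2"
            using M \<open>n \<ge> M\<close> q(1)[of "s i"] \<open>s i \<ge> M\<close> by (meson trans_le_add2)
          have "tv_dist \<Omega> l r < e'"
            using r(2) i(1) tv_dist_triangle[of \<Omega> l r "q (s i)"] tv_dist_commute[of \<Omega> l "q (s i)"]
            by linarith
          then show ?thesis
            using r(1) by blast
        qed
        then show ?thesis by blast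
      qed
      then have "l \<in> L"
        using l by (simp add: L_def)
      moreover have "tv_dist \<Omega> p l \<le> e + tv_dist \<Omega> (q (s n)) l" for n
        using tv_dist_triangle[of \<Omega> p l "q (s n)"] q(2)[of "s n"] by simp
      then have "tv_dist \<Omega> p l \<le> e + 0"
        by (intro LIMSEQ_le_const[OF tendsto_add[OF tendsto_const lim]]) blast
      ultimately show ?thesis by auto
    qed
    have "L \<noteq> {}"
    proof -
      obtain N where N: "\<forall>m\<ge>N. \<forall>n\<ge>N. \<forall>p\<in>P m. \<exists>q\<in>P n. tv_dist \<Omega> p q < 1" "N \<ge> 1"
        using tv_cauchyD[OF C, of 1] by auto
      then show ?thesis
        using near_L[OF N, of N] P(2)[of N] by blast
    qed
    moreover have "closedin (tv_topology \<Omega>) L"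
    proof -
      have "tv_topology \<Omega> closure_of L \<subseteq> L"
      proof
        fix p
        assume p: "p \<in> tv_topology \<Omega> closure_of L"
        have "\<exists>N. \<forall>n\<ge>N. \<exists>q\<in>P n. tv_dist \<Omega> p q < e" if "e > 0" for e
        proof -
          obtain l where l: "l \<in> L" "tv_dist \<Omega> p l < e / 2"
            using p \<open>e > 0\<close> by (auto simp: tv_closure_of[OF fin] dest!: spec[of _ "e / 2"])
          obtain N where "\<forall>n\<ge>N. \<exists>q\<in>P n. tv_dist \<Omega> l q < e / 2"
            using l(1) \<open>e > 0\<close> unfolding L_def by (auto dest!: spec[of _ "e / 2"])
          then have "\<forall>n\<ge>N. \<exists>q\<in>P n. tv_dist \<Omega> p q < e"
            using tv_dist_half[OF l(2)] by meson
          then show ?thesis by blast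
        qed
        then show "p \<in> L"
          using p by (simp add: L_def tv_closure_of[OF fin])
      qed
      moreover have "L \<subseteq> topspace (tv_topology \<Omega>)"
        using Metric_space.topspace_mtopology[OF Metric_space_tv_dist[OF fin]]
        by (auto simp: tv_topology_def L_def)
      ultimately show ?thesis
        using closure_of_subset_eq by blast
    qed
    moreover have "(\<lambda>n. hausdorff_dist (tv_dist \<Omega>) (?A n) L) \<longlonglongrightarrow> 0"
    proof (rule LIMSEQ_I)
      fix e :: real
      assume e: "e > 0"
      obtain N where N: "\<forall>m\<ge>N. \<forall>n\<ge>N. \<forall>p\<in>P m. \<exists>q\<in>P n. tv_dist \<Omega> p q < e / 3" "N \<ge> 1"
        using tv_cauchyD[OF C, of "e / 3"] e by auto
      have "norm (hausdorff_dist (tv_dist \<Omega>) (?A n) L - 0) < e" if n: "n \<ge> N" for n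
      proof -
        have n1: "n \<ge> 1"
          using n N(2) by simp
        have "hausdorff_dist (tv_dist \<Omega>) (?A n) L \<le> 2 * e / 3"
        proof (rule hausdorff_dist_le)
          show "?A n \<noteq> {}"
            by (rule A_ne[OF n1])
          show "L \<noteq> {}" by fact
        next
          fix a
          assume "a \<in> ?A n"
          then obtain p where p: "p \<in> P n" "tv_dist \<Omega> a p < e / 3"
            using AP[of a n "e / 3"] e by auto
          obtain l where l: "l \<in> L" "tv_dist \<Omega> p l \<le> e / 3"
            using near_L[OF N n p(1)] by blast
          show "\<exists>b\<in>L. tv_dist \<Omega> a b \<le> 2 * e / 3"
            using tv_dist_triangle[of \<Omega> a l p] p(2) l by (intro bexI[of _ l]) auto
        next
          fix l
          assume "l \<in> L"
          then obtain M where M: "\<forall>n\<ge>M. \<exists>q\<in>P n. tv_dist \<Omega> l q < e / 3"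
            using e unfolding L_def by (auto dest!: spec[of _ "e / 3"])
          then obtain q where q: "q \<in> P (max M N)" "tv_dist \<Omega> l q < e / 3"
            by (meson max.cobounded1)
          obtain p where p: "p \<in> P n" "tv_dist \<Omega> q p < e / 3"
            using N(1) n q(1) by (meson max.cobounded2)
          show "\<exists>a\<in>?A n. tv_dist \<Omega> a l \<le> 2 * e / 3"
            using tv_dist_triangle[of \<Omega> l p q] p q tv_dist_commute[of \<Omega> p l] PA[OF n1]
            by (intro bexI[of _ p]) auto
        qed
        moreover have "0 \<le> hausdorff_dist (tv_dist \<Omega>) (?A n) L"
          by (rule hausdorff_dist_nonneg[OF fin A A_ne[OF n1] _ \<open>L \<noteq> {}\<close>]) (auto simp: L_def)
        ultimately show ?thesis
          using e by simp
      qed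
      then show "\<exists>N. \<forall>n\<ge>N. norm (hausdorff_dist (tv_dist \<Omega>) (?A n) L - 0) < e"
        by blast
    qed
    ultimately show "hausdorff_convergent \<Omega> ?A"
      unfolding hausdorff_convergent_def by blast
  }
qed

section \<open>Isomorphism classes of rooted colored graphs\<close>

lemma rc_iso_sym:
  assumes "rc_iso H K" and root: "rroot H \<in> rverts H"
  shows "rc_iso K H"
proof -
  obtain \<phi> where \<phi>: "bij_betw \<phi> (rverts H) (rverts K)"
    "\<And>u v. u \<in> rverts H \<Longrightarrow> v \<in> rverts H \<Longrightarrow> (u, v) \<in> redges H \<longleftrightarrow> (\<phi> u, \<phi> v) \<in> redges K"
    "\<phi> (rroot H) = rroot K" "\<And>v. v \<in> rverts H \<Longrightarrow> rcol K (\<phi> v) = rcol H v"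
    using assms unfolding rc_iso_def by blast
  let ?\<psi> = "inv_into (rverts H) \<phi>"
  have b: "bij_betw ?\<psi> (rverts K) (rverts H)"
    using \<phi>(1) by (rule bij_betw_inv_into)
  have i: "?\<psi> u \<in> rverts H" "\<phi> (?\<psi> u) = u" if "u \<in> rverts K" for u
    using b \<phi>(1) that by (auto simp: bij_betw_def f_inv_into_f)
  show ?thesis
    unfolding rc_iso_def
  proof (intro exI[of _ ?\<psi>] conjI ballI b)
    show "((u, v) \<in> redges K) = ((?\<psi> u, ?\<psi> v) \<in> redges H)" if "u \<in> rverts K" "v \<in> rverts K" for u v
      using \<phi>(2)[of "?\<psi> u" "?\<psi> v"] i that by simp
    show "?\<psi> (rroot K) = rroot H"
      using \<phi>(1,3) root by (metis bij_betw_inv_into_left)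
    show "rcol H (?\<psi> v) = rcol K v" if "v \<in> rverts K" for v
      using \<phi>(4)[of "?\<psi> v"] i that by simp
  qed
qed

lemma rc_iso_trans:
  assumes "rc_iso H K" "rc_iso K L"
  shows "rc_iso H L"
proof -
  obtain \<phi> where \<phi>: "bij_betw \<phi> (rverts H) (rverts K)"
    "\<And>u v. u \<in> rverts H \<Longrightarrow> v \<in> rverts H \<Longrightarrow> (u, v) \<in> redges H \<longleftrightarrow> (\<phi> u, \<phi> v) \<in> redges K"
    "\<phi> (rroot H) = rroot K" "\<And>v. v \<in> rverts H \<Longrightarrow> rcol K (\<phi> v) = rcol H v"
    using assms(1) unfolding rc_iso_def by blast
  obtain \<psi> where \<psi>: "bij_betw \<psi> (rverts K) (rverts L)"
    "\<And>u v. u \<in> rverts K \<Longrightarrow> v \<in> rverts K \<Longrightarrow> (u, v) \<in> redges K \<longleftrightarrow> (\<psi> u, \<psi> v) \<in> redges L"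
    "\<psi> (rroot K) = rroot L" "\<And>v. v \<in> rverts K \<Longrightarrow> rcol L (\<psi> v) = rcol K v"
    using assms(2) unfolding rc_iso_def by blast
  have "\<phi> u \<in> rverts K" if "u \<in> rverts H" for u
    using bij_betwE[OF \<phi>(1)] that by blast
  then show ?thesis
    unfolding rc_iso_def using bij_betw_trans[OF \<phi>(1) \<psi>(1)] \<phi>(2-4) \<psi>(2-4)
    by (intro exI[of _ "\<psi> \<circ> \<phi>"]) auto
qed

text \<open>A normal form: the vertices are an initial segment of \<open>nat\<close>, and the total
  function \<open>rcol\<close> is fixed to 0 off the vertices. With bounded size and colors only
  finitely many normal forms remain, which is what makes the sets of types finite.\<close>

lemma ex_nat_copy:
  assumes "is_rcgraph H"
  obtains K :: "nat rcgraph" where "is_rcgraph K" "rc_iso H K" "rverts K = {0..<card (rverts H)}"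
    "\<And>v. v \<notin> rverts K \<Longrightarrow> rcol K v = 0"
proof -
  have fin: "finite (rverts H)" and H: "rroot H \<in> rverts H" "redges H \<subseteq> rverts H \<times> rverts H"
    "sym (redges H)" "irrefl (redges H)"
    using assms by (auto simp: is_rcgraph_def)
  obtain \<phi> where \<phi>: "bij_betw \<phi> (rverts H) {0..<card (rverts H)}"
    using ex_bij_betw_finite_nat[OF fin] by blast
  let ?\<psi> = "inv_into (rverts H) \<phi>"
  let ?V = "{0..<card (rverts H)}"
  define K :: "nat rcgraph" where "K = \<lparr>rverts = ?V,
    redges = {(i, j). i \<in> ?V \<and> j \<in> ?V \<and> (?\<psi> i, ?\<psi> j) \<in> redges H},
    rroot = \<phi> (rroot H), rcol = (\<lambda>i. if i \<in> ?V then rcol H (?\<psi> i) else 0)\<rparr>"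
  have V: "\<phi> u \<in> ?V" "?\<psi> (\<phi> u) = u" if "u \<in> rverts H" for u
    using \<phi> that by (auto dest: bij_betwE simp: bij_betw_inv_into_left)
  have "is_rcgraph K"
    using V H by (auto simp: is_rcgraph_def K_def sym_def irrefl_def)
  moreover have "rc_iso H K"
    unfolding rc_iso_def by (rule exI[of _ \<phi>]) (use \<phi> V in \<open>auto simp: K_def\<close>)
  ultimately show ?thesis
    by (rule that) (auto simp: K_def)
qed

lemma iso_class_eqI:
  assumes "rc_iso H K" "rroot H \<in> rverts H"
  shows "iso_class H = iso_class K"
  using rc_iso_trans[OF assms(1)] rc_iso_trans[OF rc_iso_sym[OF assms]] unfolding iso_class_def
  by blast

text \<open>A finite graph has a copy on \<open>nat\<close>, so its class is nonempty and a common
  member links the two graphs.\<close>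

lemma iso_class_eq_iff:
  assumes "is_rcgraph H" "is_rcgraph K"
  shows "iso_class H = iso_class K \<longleftrightarrow> rc_iso H K"
proof
  assume eq: "iso_class H = iso_class K"
  obtain L :: "nat rcgraph" where L: "is_rcgraph L" "rc_iso H L"
    using ex_nat_copy[OF assms(1)] by metis
  then have "rc_iso K L"
    using eq by (auto simp: iso_class_def)
  then show "rc_iso H K"
    using L(2) rc_iso_sym[of K L] assms(2) rc_iso_trans[of H L K] by (simp add: is_rcgraph_def)
next
  assume "rc_iso H K"
  then show "iso_class H = iso_class K"
    by (rule iso_class_eqI) (use assms in \<open>simp add: is_rcgraph_def\<close>)
qed

lemma finite_iso_classes:
  "finite (iso_class ` {H :: 'v rcgraph. is_rcgraph H \<and> card (rverts H) \<le> N \<and>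
    (\<forall>v\<in>rverts H. rcol H v \<in> {1..k})})" (is "finite (iso_class ` ?A)")
proof -
  let ?col = "{c :: nat \<Rightarrow> nat. \<forall>i. (i \<in> {0..<N} \<longrightarrow> c i \<in> {0..k}) \<and> (i \<notin> {0..<N} \<longrightarrow> c i = 0)}"
  let ?B = "(\<lambda>(n, E, r, c). iso_class \<lparr>rverts = {0..<n}, redges = E, rroot = r, rcol = c\<rparr>) `
    ({0..N} \<times> Pow ({0..<N} \<times> {0..<N}) \<times> {0..<N} \<times> ?col)"
  have "iso_class H \<in> ?B" if "H \<in> ?A" for H :: "'v rcgraph"
  proof -
    have H: "is_rcgraph H" "card (rverts H) \<le> N" "\<And>v. v \<in> rverts H \<Longrightarrow> rcol H v \<in> {1..k}"
      using that by auto
    obtain K :: "nat rcgraph" where K: "is_rcgraph K" "rc_iso H K" "rverts K = {0..<card (rverts H)}"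
      "\<And>v. v \<notin> rverts K \<Longrightarrow> rcol K v = 0"
      using ex_nat_copy[OF H(1)] by metis
    obtain \<phi> where \<phi>: "bij_betw \<phi> (rverts H) (rverts K)"
      "\<And>v. v \<in> rverts H \<Longrightarrow> rcol K (\<phi> v) = rcol H v"
      using K(2) unfolding rc_iso_def by blast
    have "rcol K v \<in> {1..k}" if "v \<in> rverts K" for v
    proof -
      obtain u where "u \<in> rverts H" "v = \<phi> u"
        using bij_betw_imp_surj_on[OF \<phi>(1)] \<open>v \<in> rverts K\<close> by blast
      then show ?thesis using \<phi>(2) H(3) by metis
    qed
    moreover have "rverts K \<subseteq> {0..<N}"
      using K(3) H(2) by auto
    ultimately have "rcol K i \<in> {0..k}" "i \<notin> {0..<N} \<Longrightarrow> rcol K i = 0" for i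
      using K(4)[of i] by (cases "i \<in> rverts K"; auto)+
    then have "rcol K \<in> ?col"
      by blast
    moreover have "redges K \<subseteq> {0..<N} \<times> {0..<N}" "rroot K \<in> {0..<N}"
      using K(1,3) H(2) by (auto simp: is_rcgraph_def)
    moreover have "K = \<lparr>rverts = {0..<card (rverts H)}, redges = redges K, rroot = rroot K, rcol = rcol K\<rparr>"
      using K(3) by simp
    ultimately have "iso_class K \<in> ?B"
      using H(2)
      by (intro image_eqI[of _ _ "(card (rverts H), redges K, rroot K, rcol K)"]) simp_all
    then show ?thesis
      using iso_class_eqI[OF K(2)] H(1) by (simp add: is_rcgraph_def)
  qed
  moreover have "finite ?B"
    by (intro finite_imageI finite_cartesian_product finite_set_of_finite_funs) auto
  ultimately show ?thesis
    by (meson finite_subset image_subsetI)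
qed

text \<open>The notion behind \<open>graphing_ball\<close>, for a bare relation, so that it also
  applies to the edges of the abstract graphs in \<open>ball_types\<close>.\<close>

definition rel_ball :: "('v \<times> 'v) set \<Rightarrow> nat \<Rightarrow> 'v \<Rightarrow> 'v set" where
  "rel_ball E r x = {y. \<exists>i\<le>r. (x, y) \<in> E ^^ i}"

lemma rel_ball_0 [simp]: "rel_ball E 0 x = {x}"
  by (auto simp: rel_ball_def)

lemma rel_ball_self: "x \<in> rel_ball E r x"
  by (auto simp: rel_ball_def intro!: exI[of _ 0])

lemma rel_ball_mono: "r \<le> s \<Longrightarrow> rel_ball E r x \<subseteq> rel_ball E s x"
  unfolding rel_ball_def by (blast intro: order_trans)

lemma rel_ball_Suc: "rel_ball E (Suc r) x = rel_ball E r x \<union> E `` rel_ball E r x"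
proof (intro set_eqI iffI)
  fix y
  assume "y \<in> rel_ball E (Suc r) x"
  then obtain i where i: "i \<le> Suc r" "(x, y) \<in> E ^^ i"
    by (auto simp: rel_ball_def)
  show "y \<in> rel_ball E r x \<union> E `` rel_ball E r x"
  proof (cases "i \<le> r")
    case False
    then have "(x, y) \<in> E ^^ Suc r"
      using i by (metis le_SucE)
    then obtain z where "(x, z) \<in> E ^^ r" "(z, y) \<in> E"
      by auto
    then show ?thesis
      by (auto simp: rel_ball_def)
  qed (use i in \<open>auto simp: rel_ball_def\<close>)
next
  fix y
  assume "y \<in> rel_ball E r x \<union> E `` rel_ball E r x"
  then show "y \<in> rel_ball E (Suc r) x"
  proof
    assume "y \<in> rel_ball E r x"
    then show ?thesis
      using rel_ball_mono[of r "Suc r" E x] by auto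
  next
    assume "y \<in> E `` rel_ball E r x"
    then obtain z i where "(z, y) \<in> E" "i \<le> r" "(x, z) \<in> E ^^ i"
      by (auto simp: rel_ball_def)
    then have "(x, y) \<in> E ^^ Suc i" "Suc i \<le> Suc r"
      by auto
    then show ?thesis
      unfolding rel_ball_def by blast
  qed
qed

lemma rel_ball_sym:
  assumes "sym E" "y \<in> rel_ball E r x"
  shows "x \<in> rel_ball E r y"
proof -
  have "sym (E ^^ i)" for i
  proof (induction i)
    case (Suc i)
    have "E ^^ Suc i = E O E ^^ i"
      by (simp add: relpow_commute)
    then show ?case
      using Suc assms(1) unfolding relpow.simps sym_def relcomp_unfold by blast
  qed (auto simp: sym_def)
  then show ?thesis
    using assms(2) by (auto simp: rel_ball_def sym_def)
qed

lemma rel_ball_subset: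
  assumes "E `` V \<subseteq> V" "x \<in> V"
  shows "rel_ball E r x \<subseteq> V"
  by (induction r) (use assms in \<open>auto simp: rel_ball_Suc\<close>)

text \<open>Each further step adds to every vertex already reached at most its \<open>d\<close>
  neighbors, hence the factor \<open>1 + d\<close>.\<close>

lemma rel_ball_card_le:
  assumes E: "E `` V \<subseteq> V" "\<And>v. v \<in> V \<Longrightarrow> finite (E `` {v})" "\<And>v. v \<in> V \<Longrightarrow> card (E `` {v}) \<le> d"
    and x: "x \<in> V"
  shows "finite (rel_ball E r x)" "card (rel_ball E r x) \<le> (1 + d) ^ r"
proof -
  have "finite (rel_ball E r x) \<and> card (rel_ball E r x) \<le> (1 + d) ^ r"
  proof (induction r)
    case (Suc r)
    have eq: "rel_ball E (Suc r) x = (\<Union>v\<in>rel_ball E r x. insert v (E `` {v}))"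
      by (auto simp: rel_ball_Suc)
    have V: "rel_ball E r x \<subseteq> V"
      by (rule rel_ball_subset[OF E(1) x])
    have "card (insert v (E `` {v})) \<le> 1 + d" if "v \<in> rel_ball E r x" for v
      using card_insert_le_m1[of "1 + d" "E `` {v}" v] E(3)[of v] V that by auto
    then have "card (rel_ball E (Suc r) x) \<le> card (rel_ball E r x) * (1 + d)"
      unfolding eq using Suc
      by (intro order_trans[OF card_UN_le] sum_bounded_above[where 'a = nat, simplified]) auto
    also have "\<dots> \<le> (1 + d) ^ r * (1 + d)"
      using Suc by (intro mult_right_mono) auto
    finally show ?case
      using Suc V E(2) by (auto simp: eq algebra_simps)
  qed simp
  then show "finite (rel_ball E r x)" "card (rel_ball E r x) \<le> (1 + d) ^ r"
    by auto
qed

lemma graphing_ball_eq: "graphing_ball r G x = rel_ball (edge G) r x"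
  by (simp add: graphing_ball_def rel_ball_def)

lemma finite_ball_types: "finite (ball_types d k r)"
proof -
  have "card (rverts H) \<le> (1 + d) ^ r"
    if H: "is_rcgraph H" "\<forall>v\<in>rverts H. card {w. (v, w) \<in> redges H} \<le> d"
      "\<forall>v\<in>rverts H. \<exists>i\<le>r. (rroot H, v) \<in> redges H ^^ i" for H :: "nat rcgraph"
  proof -
    have "finite (rverts H)" "redges H `` rverts H \<subseteq> rverts H" "rroot H \<in> rverts H"
      using H(1) by (auto simp: is_rcgraph_def)
    moreover have "redges H `` {v} \<subseteq> rverts H" for v
      using H(1) by (auto simp: is_rcgraph_def)
    moreover have "card (redges H `` {v}) \<le> d" if "v \<in> rverts H" for v
      using H(2) that by (auto simp: Image_singleton)
    ultimately have "finite (rel_ball (redges H) r (rroot H))"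
      "card (rel_ball (redges H) r (rroot H)) \<le> (1 + d) ^ r"
      using rel_ball_card_le[of "redges H" "rverts H" d "rroot H" r] by (meson finite_subset)+
    moreover have "rverts H \<subseteq> rel_ball (redges H) r (rroot H)"
      using H(3) by (auto simp: rel_ball_def)
    ultimately show ?thesis
      by (meson card_mono order_trans)
  qed
  then show ?thesis
    unfolding ball_types_def
    by (intro finite_subset[OF _ finite_iso_classes[of "(1 + d) ^ r" k]] image_mono) auto
qed

section \<open>Star graphs and the finiteness of the remaining sets of types\<close>

lemma is_rcgraph_star_graph:
  assumes "finite L" "x \<notin> L"
  shows "is_rcgraph (star_graph x L c)"
  using assms by (auto simp: is_rcgraph_def star_graph_def sym_def irrefl_def)

lemma rc_iso_star_graphE:
  assumes "rc_iso (star_graph x L c) (star_graph y M c')" "x \<notin> L" "y \<notin> M"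
  obtains \<phi> where "bij_betw \<phi> L M" "\<And>v. v \<in> L \<Longrightarrow> c' (\<phi> v) = c v" "c' y = c x"
proof -
  obtain \<phi> where \<phi>: "bij_betw \<phi> (insert x L) (insert y M)" "\<phi> x = y"
    "\<And>v. v \<in> insert x L \<Longrightarrow> c' (\<phi> v) = c v"
  proof -
    assume *: "\<And>\<phi>. bij_betw \<phi> (insert x L) (insert y M) \<Longrightarrow> \<phi> x = y \<Longrightarrow>
      (\<And>v. v \<in> insert x L \<Longrightarrow> c' (\<phi> v) = c v) \<Longrightarrow> thesis"
    show thesis
      using assms(1) unfolding rc_iso_def star_graph_def rcgraph.simps by (elim exE conjE) (rule *, blast+)
  qed
  have "bij_betw \<phi> L M"
    using notIn_Un_bij_betw3[of x L \<phi> M] \<phi>(1,2) assms(2,3) by simp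
  then show ?thesis
    using \<phi> that[of \<phi>] by auto
qed

lemma rc_iso_star_graphI:
  assumes "bij_betw \<phi> L M" "\<And>v. v \<in> L \<Longrightarrow> c' (\<phi> v) = c v" "c' y = c x" "x \<notin> L" "y \<notin> M"
  shows "rc_iso (star_graph x L c) (star_graph y M c')"
proof -
  let ?\<psi> = "\<phi>(x := y)"
  have "bij_betw ?\<psi> L M"
    using assms(1,4) by (subst bij_betw_cong[of L ?\<psi> \<phi> M]) auto
  then have b: "bij_betw ?\<psi> (insert x L) (insert y M)"
    using assms(4,5) notIn_Un_bij_betw[of x L ?\<psi> M] by auto
  have M: "\<phi> v \<in> M" if "v \<in> L" for v
    using assms(1) that by (auto dest: bij_betwE)
  show ?thesis
    unfolding rc_iso_def
    by (rule exI[of _ ?\<psi>]) (use b assms M in \<open>auto simp: star_graph_def\<close>)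
qed

lemma iso_class_star_graph_in_cherry_types:
  fixes x :: 'v
  assumes L: "finite L" "card L \<le> 2" "x \<notin> L" and c: "\<And>v. v \<in> insert x L \<Longrightarrow> c v \<in> {1..k}"
  shows "iso_class (star_graph x L c) \<in> cherry_types k"
proof -
  obtain \<phi> where \<phi>: "bij_betw \<phi> L {0..<card L}"
    using ex_bij_betw_finite_nat[OF L(1)] by blast
  let ?n = "card L"
  let ?c = "\<lambda>i. if i < ?n then c (inv_into L \<phi> i) else c x"
  have inv: "inv_into L \<phi> i \<in> L" if "i < ?n" for i
    using bij_betwE[OF bij_betw_inv_into[OF \<phi>]] that by auto
  have eq: "?c (\<phi> v) = c v" if "v \<in> L" for v
    using \<phi> that bij_betwE[OF \<phi>] by (auto simp: bij_betw_inv_into_left)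
  have "rc_iso (star_graph x L c) (star_graph ?n {0..<?n} ?c)"
    using eq L(3) by (intro rc_iso_star_graphI[where \<phi> = \<phi>, OF \<phi>]) simp_all
  then have "iso_class (star_graph x L c) = iso_class (star_graph ?n {0..<?n} ?c)"
    by (rule iso_class_eqI) (simp add: star_graph_def)
  moreover have "\<forall>v\<in>insert ?n {0..<?n}. ?c v \<in> {1..k}"
    using inv c by auto
  ultimately show ?thesis
    unfolding cherry_types_def using L(2)
    by (intro CollectI exI[of _ ?n] exI[of _ "{0..<?n}"] exI[of _ ?c]) auto
qed

lemma finite_cherry_types: "finite (cherry_types k)"
proof -
  have "cherry_types k \<subseteq> iso_class ` {H :: nat rcgraph. is_rcgraph H \<and> card (rverts H) \<le> 3 \<and>
    (\<forall>v\<in>rverts H. rcol H v \<in> {1..k})}"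
  proof
    fix \<alpha>
    assume "\<alpha> \<in> cherry_types k"
    then obtain x :: nat and L c where *: "\<alpha> = iso_class (star_graph x L c)" "finite L" "card L \<le> 2"
      "x \<notin> L" "\<forall>v\<in>insert x L. c v \<in> {1..k}"
      unfolding cherry_types_def by blast
    then show "\<alpha> \<in> iso_class ` {H :: nat rcgraph. is_rcgraph H \<and> card (rverts H) \<le> 3 \<and>
      (\<forall>v\<in>rverts H. rcol H v \<in> {1..k})}"
      using is_rcgraph_star_graph[of L x c]
      by (intro image_eqI[of _ _ "star_graph x L c"]) (auto simp: star_graph_def)
  qed
  then show ?thesis
    by (rule finite_subset) (rule finite_iso_classes)
qed

lemma finite_star_types: "finite (star_types d k)"
proof -
  have "star_types d k \<subseteq> {1..k} \<times> {ns. set ns \<subseteq> {0..d} \<and> length ns = k}"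
    using member_le_sum_list by (fastforce simp: star_types_def)
  then show ?thesis
    by (rule finite_subset) (intro finite_cartesian_product finite_lists_length_eq; simp)
qed

section \<open>Measurable colorings of graphings\<close>

lemma nbrs_eq: "nbrs G x = edge G `` {x}"
  by (auto simp: nbrs_def)

locale bounded_graphing =
  fixes d :: nat and G :: "'a graphing"
  assumes is_graphing: "is_graphing d G"
begin

abbreviation "M \<equiv> vmeas G"
abbreviation "X \<equiv> space (vmeas G)"
abbreviation "E \<equiv> edge G"

sublocale prob_space M
  using is_graphing by (simp add: is_graphing_def)

lemma X_eq: "X = topspace (vtop G)"
proof -
  have "sets M = sets (borel_of (vtop G))"
    using is_graphing by (simp add: is_graphing_def)
  then show ?thesis
    by (auto dest: sets_eq_imp_space_eq simp: borel_of_def space_measure_of_conv)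
qed

lemma openin_sets: "openin (vtop G) U \<Longrightarrow> U \<in> sets M"
proof -
  have "sets M = sets (borel_of (vtop G))"
    using is_graphing by (simp add: is_graphing_def)
  moreover have "{U. openin (vtop G) U} \<subseteq> Pow (topspace (vtop G))"
    by (auto dest: openin_subset)
  ultimately show "openin (vtop G) U \<Longrightarrow> U \<in> sets M"
    by (auto simp: borel_of_def)
qed

lemma edge_subset: "E \<subseteq> X \<times> X"
proof -
  have "E \<in> sets (borel_of (prod_topology (vtop G) (vtop G)))"
    using is_graphing by (simp add: is_graphing_def)
  from sets.sets_into_space[OF this] show ?thesis
    by (simp add: borel_of_def space_measure_of_conv X_eq)
qed

lemma edge_sym: "sym E" and edge_irrefl: "irrefl E"
  using is_graphing by (auto simp: is_graphing_def)

lemma nbrs_subset: "nbrs G x \<subseteq> X"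
  using edge_subset by (auto simp: nbrs_def)

lemma finite_nbrs: "finite (nbrs G x)" and card_nbrs_le: "card (nbrs G x) \<le> d"
proof -
  have "finite (nbrs G x) \<and> card (nbrs G x) \<le> d"
  proof (cases "x \<in> X")
    case True
    then show ?thesis
      using is_graphing by (simp add: is_graphing_def X_eq)
  next
    case False
    then have "nbrs G x = {}"
      using edge_subset by (auto simp: nbrs_def)
    then show ?thesis by simp
  qed
  then show "finite (nbrs G x)" "card (nbrs G x) \<le> d"
    by auto
qed

lemma not_in_nbrs: "x \<notin> nbrs G x"
  using edge_irrefl by (simp add: nbrs_def irrefl_def)

lemma nbrs_sym: "y \<in> nbrs G x \<longleftrightarrow> x \<in> nbrs G y"
  using edge_sym by (auto simp: nbrs_def sym_def)

lemma ball_subset: "x \<in> X \<Longrightarrow> rel_ball E r x \<subseteq> X"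
  using edge_subset by (intro rel_ball_subset) auto

lemma finite_ball: "x \<in> X \<Longrightarrow> finite (rel_ball E r x)"
  and card_ball_le: "x \<in> X \<Longrightarrow> card (rel_ball E r x) \<le> (1 + d) ^ r"
  using rel_ball_card_le[of E X d x r] edge_subset finite_nbrs card_nbrs_le
  by (auto simp: nbrs_eq)

section \<open>Mass transport and measurability of reachable sets\<close>

lemma mass_transport:
  assumes "A \<in> sets M" "B \<in> sets M"
  shows "set_integrable M A (\<lambda>x. edge_count G x B)"
    and "(LINT x:A|M. edge_count G x B) = (LINT x:B|M. edge_count G x A)"
  using is_graphing assms unfolding is_graphing_def by blast+

text \<open>Integrability of edge counts over the whole space is part of \<open>is_graphing\<close>,
  and it contains measurability. This takes the place of a uniformization argument for Borel sets
  with finite sections.\<close>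

lemma edge_count_measurable:
  assumes "B \<in> sets M"
  shows "(\<lambda>x. edge_count G x B) \<in> borel_measurable M"
proof -
  have "set_integrable M X (\<lambda>x. edge_count G x B)"
    by (rule mass_transport(1)[OF sets.top assms])
  then have "(\<lambda>x. indicator X x *\<^sub>R edge_count G x B) \<in> borel_measurable M"
    unfolding set_integrable_def by (rule borel_measurable_integrable)
  then show ?thesis
    by (rule measurable_cong[THEN iffD1, rotated]) simp
qed

lemma edge_count_pos_iff: "edge_count G x B > 0 \<longleftrightarrow> nbrs G x \<inter> B \<noteq> {}"
  using finite_nbrs[of x] by (auto simp: edge_count_def card_gt_0_iff)

lemma preimage_nbrs_sets:
  assumes "B \<in> sets M"
  shows "{x \<in> X. nbrs G x \<inter> B \<noteq> {}} \<in> sets M"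
proof -
  have "{x \<in> X. edge_count G x B > 0} \<in> sets M"
    using edge_count_measurable[OF assms] by measurable
  then show ?thesis
    by (simp add: edge_count_pos_iff)
qed

text \<open>Count the edges between the whole space and \<open>B\<close>: seen from outside, each
  point of the preimage contributes at least one; seen from \<open>B\<close>, each point contributes
  at most \<open>d\<close>.\<close>

lemma measure_preimage_nbrs_le:
  assumes B: "B \<in> sets M"
  shows "measure M {x \<in> X. nbrs G x \<inter> B \<noteq> {}} \<le> real d * measure M B"
proof -
  let ?A = "{x \<in> X. nbrs G x \<inter> B \<noteq> {}}"
  have A: "?A \<in> sets M"
    by (rule preimage_nbrs_sets[OF B])
  have int: "set_integrable M X (\<lambda>x. edge_count G x B)" "set_integrable M B (\<lambda>x. edge_count G x X)"
    and eq: "(LINT x:X|M. edge_count G x B) = (LINT x:B|M. edge_count G x X)"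
    using mass_transport[OF sets.top B] mass_transport(1)[OF B sets.top] by auto
  have "measure M ?A = (LINT x|M. indicator ?A x)"
    using A by simp
  also have "\<dots> \<le> (LINT x:X|M. edge_count G x B)"
    unfolding set_lebesgue_integral_def
  proof (rule integral_mono)
    show "integrable M (\<lambda>x. indicat_real X x *\<^sub>R edge_count G x B)"
      using int(1) by (simp add: set_integrable_def)
    show "integrable M (indicat_real ?A)"
      using A by (intro integrable_real_indicator) (auto simp: emeasure_eq_measure)
    show "indicat_real ?A x \<le> indicat_real X x *\<^sub>R edge_count G x B" if "x \<in> X" for x
      using finite_nbrs[of x] that
      by (auto simp: indicator_def edge_count_def Suc_le_eq card_gt_0_iff)
  qed
  also have "\<dots> = (LINT x:B|M. edge_count G x X)"
    by (rule eq)
  also have "\<dots> \<le> (LINT x|M. real d * indicator B x)"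
    unfolding set_lebesgue_integral_def
  proof (rule integral_mono)
    show "integrable M (\<lambda>x. indicat_real B x *\<^sub>R edge_count G x X)"
      using int(2) by (simp add: set_integrable_def)
    show "integrable M (\<lambda>x. real d * indicat_real B x)"
      using B by (intro integrable_mult_right integrable_real_indicator) (auto simp: emeasure_eq_measure)
    show "indicat_real B x *\<^sub>R edge_count G x X \<le> real d * indicat_real B x" for x
      using card_nbrs_le[of x] nbrs_subset[of x] by (auto simp: indicator_def edge_count_def Int_absorb2)
  qed
  also have "\<dots> = real d * measure M B"
    using B by simp
  finally show ?thesis .
qed

text \<open>A point reaches \<open>B\<close> within \<open>Suc r\<close> steps iff it reaches
  \<open>B\<close> together with its neighbors within \<open>r\<close> steps, so the induction
  varies \<open>B\<close>. Each enlargement costs a factor \<open>1 + d\<close>. This bounds the set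
  of balls spoiled by a small bad set.\<close>

lemma reach_sets_measure:
  assumes "B \<in> sets M"
  shows "{x \<in> X. rel_ball E r x \<inter> B \<noteq> {}} \<in> sets M \<and>
    measure M {x \<in> X. rel_ball E r x \<inter> B \<noteq> {}} \<le> (1 + real d) ^ r * measure M B"
  using assms
proof (induction r arbitrary: B)
  case 0
  have "{x \<in> X. rel_ball E 0 x \<inter> B \<noteq> {}} = B"
    using sets.sets_into_space[OF 0] by auto
  then show ?case
    using 0 by simp
next
  case (Suc r)
  let ?B = "B \<union> {x \<in> X. nbrs G x \<inter> B \<noteq> {}}"
  have B: "?B \<in> sets M"
    using preimage_nbrs_sets[OF Suc.prems] Suc.prems by blast
  have eq: "{x \<in> X. rel_ball E (Suc r) x \<inter> B \<noteq> {}} = {x \<in> X. rel_ball E r x \<inter> ?B \<noteq> {}}"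
  proof (intro Collect_cong conj_cong refl)
    fix x
    assume "x \<in> X"
    then have "rel_ball E r x \<subseteq> X"
      by (rule ball_subset)
    then show "rel_ball E (Suc r) x \<inter> B \<noteq> {} \<longleftrightarrow> rel_ball E r x \<inter> ?B \<noteq> {}"
      unfolding rel_ball_Suc nbrs_eq by blast
  qed
  have "measure M ?B \<le> measure M B + real d * measure M B"
    using measure_Un_le[OF Suc.prems preimage_nbrs_sets[OF Suc.prems]]
      measure_preimage_nbrs_le[OF Suc.prems] by linarith
  then have "(1 + real d) ^ r * measure M ?B \<le> (1 + real d) ^ r * ((1 + real d) * measure M B)"
    by (intro mult_left_mono) (auto simp: algebra_simps)
  then show ?case
    using Suc.IH[OF B] unfolding eq by (auto simp: algebra_simps)
qed

lemma colorings_iff: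
  "f \<in> colorings k G \<longleftrightarrow> (\<forall>x\<in>X. f x \<in> {1..k}) \<and> f \<in> measurable M (count_space UNIV)"
proof -
  have "f \<in> measurable M (count_space UNIV) \<longleftrightarrow> (\<forall>a. f -` {a} \<inter> X \<in> sets M)" (is "_ \<longleftrightarrow> ?m")
    by (simp add: measurable_count_space_eq_countable)
  moreover have "f \<in> colorings k G \<longleftrightarrow> (\<forall>x\<in>X. f x \<in> {1..k}) \<and> (\<forall>a\<in>{1..k}. f -` {a} \<inter> X \<in> sets M)"
    unfolding colorings_def by (subst measurable_count_space_eq2) auto
  moreover have "f -` {a} \<inter> X \<in> sets M" if "\<forall>x\<in>X. f x \<in> {1..k}" "a \<notin> {1..k}" for a
  proof -
    have "f -` {a} \<inter> X = {}"
      using that by auto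
    then show ?thesis by simp
  qed
  ultimately show ?thesis by blast
qed

lemma coloring_range: "f \<in> colorings k G \<Longrightarrow> x \<in> X \<Longrightarrow> f x \<in> {1..k}"
  and coloring_measurable: "f \<in> colorings k G \<Longrightarrow> f \<in> measurable M (count_space UNIV)"
  by (auto simp: colorings_iff)

lemma const_coloring: "k \<ge> 1 \<Longrightarrow> (\<lambda>_. 1) \<in> colorings k G"
  by (auto simp: colorings_iff)

lemma level_set_sets:
  assumes "h \<in> measurable M (count_space UNIV)"
  shows "{x \<in> X. P (h x)} \<in> sets M"
  using measurable_sets[OF assms, of "{a. P a}"] by (simp add: vimage_def Int_def conj_commute)

lemma measurable_nat_valuedI:
  fixes h :: "'a \<Rightarrow> 'b :: countable"
  assumes "\<And>a. {x \<in> X. h x = a} \<in> sets M"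
  shows "h \<in> measurable M (count_space UNIV)"
  using assms by (simp add: measurable_count_space_eq_countable vimage_def Int_def conj_commute)

lemma star_at_eq_edge_count:
  "star_at k G f x = (f x, map (\<lambda>j. nat \<lfloor>edge_count G x {y \<in> X. f y = j}\<rfloor>) [1..<Suc k])"
proof -
  have "{y \<in> nbrs G x. f y = j} = nbrs G x \<inter> {y \<in> X. f y = j}" for j
    using nbrs_subset[of x] by auto
  then show ?thesis
    by (simp add: star_at_def edge_count_def)
qed

lemma star_at_measurable:
  assumes f: "f \<in> colorings k G"
  shows "star_at k G f \<in> measurable M (count_space UNIV)"
proof (rule measurable_nat_valuedI)
  fix s :: "nat \<times> nat list"
  obtain i ns where s: "s = (i, ns)"
    by (cases s)
  have [measurable]: "(\<lambda>x. edge_count G x {y \<in> X. f y = j}) \<in> borel_measurable M" for j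
    by (intro edge_count_measurable level_set_sets coloring_measurable[OF f])
  have [measurable]: "f \<in> measurable M (count_space UNIV)"
    by (rule coloring_measurable[OF f])
  have "{x \<in> X. star_at k G f x = s} = {x \<in> X. f x = i \<and> length ns = k \<and>
    (\<forall>j\<in>{..<k}. nat \<lfloor>edge_count G x {y \<in> X. f y = Suc j}\<rfloor> = ns ! j)}"
    by (auto simp: star_at_eq_edge_count s list_eq_iff_nth_eq nth_append simp del: upt_Suc)
  also have "\<dots> \<in> sets M"
    by measurable
  finally show "{x \<in> X. star_at k G f x = s} \<in> sets M" .
qed

text \<open>A countable base of the topology: finite sets are closed in a metrizable space, so their
  complements contain a basic neighborhood of \<open>x\<close>.\<close>

lemma ex_separating_family:
  obtains U :: "nat \<Rightarrow> 'a set" where "\<And>i. U i \<in> sets M"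
    "\<And>x S. x \<in> X \<Longrightarrow> finite S \<Longrightarrow> x \<notin> S \<Longrightarrow> \<exists>i. x \<in> U i \<and> U i \<inter> S = {}"
proof -
  have T: "completely_metrizable_space (vtop G)" "second_countable (vtop G)"
    using is_graphing by (auto simp: is_graphing_def polish_def)
  obtain \<B> where \<B>: "countable \<B>" "\<And>V. V \<in> \<B> \<Longrightarrow> openin (vtop G) V"
    "\<And>U x. openin (vtop G) U \<Longrightarrow> x \<in> U \<Longrightarrow> \<exists>V\<in>\<B>. x \<in> V \<and> V \<subseteq> U"
    using T(2) unfolding second_countable_def by metis
  have t1: "t1_space (vtop G)"
    using T(1) by (simp add: completely_metrizable_imp_metrizable_space metrizable_imp_t1_space)
  \<comment> \<open>The empty set is added because an enumeration by \<open>nat\<close> needs a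
    nonempty set, and the base may be empty.\<close>
  define U where "U = from_nat_into (insert {} \<B>)"
  have range_U: "range U = insert {} \<B>"
    unfolding U_def using \<B>(1) by (intro range_from_nat_into) auto
  show ?thesis
  proof (rule that[of U])
    show "U i \<in> sets M" for i
      using range_U \<B>(2) openin_sets by (metis insert_iff rangeI sets.empty_sets)
    fix x S
    assume x: "x \<in> X" "finite S" "x \<notin> S"
    have "closedin (vtop G) (S \<inter> X)"
      using t1 x(2) by (simp add: t1_space_closedin_finite X_eq)
    then have "openin (vtop G) (topspace (vtop G) - (S \<inter> X))"
      by blast
    then obtain V where V: "V \<in> \<B>" "x \<in> V" "V \<subseteq> topspace (vtop G) - (S \<inter> X)"
      using \<B>(3)[of "topspace (vtop G) - (S \<inter> X)" x] x by (auto simp: X_eq)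
    then obtain i where "V = U i"
      using range_U by blast
    then show "\<exists>i. x \<in> U i \<and> U i \<inter> S = {}"
      using V by (intro exI[of _ i]) (auto simp: X_eq)
  qed
qed

end

text \<open>Greedy recoloring along a countable proper coloring \<open>p\<close>.\<close>

function greedy :: "('v \<times> 'v) set \<Rightarrow> ('v \<Rightarrow> nat) \<Rightarrow> 'v \<Rightarrow> nat" where
  "greedy F p x = (LEAST a. 1 \<le> a \<and> a \<notin> greedy F p ` {y. (x, y) \<in> F \<and> p y < p x})"
  by auto
termination
  by (relation "inv_image less_than (\<lambda>(F, p, x). p x)") auto

declare greedy.simps [simp del]

text \<open>Pigeonhole: at most \<open>D\<close> colors are blocked, so one of
  \<open>1..Suc D\<close> is free, and the least free color is no larger. Color 0 is avoided because
  \<open>colorings\<close> starts at 1.\<close>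

lemma greedy_props:
  assumes "finite (F `` {x})" "card (F `` {x}) \<le> D"
  shows "1 \<le> greedy F p x" "greedy F p x \<le> Suc D"
    "greedy F p x \<notin> greedy F p ` {y. (x, y) \<in> F \<and> p y < p x}"
proof -
  let ?S = "greedy F p ` {y. (x, y) \<in> F \<and> p y < p x}"
  have sub: "{y. (x, y) \<in> F \<and> p y < p x} \<subseteq> F `` {x}"
    by auto
  have "card ?S \<le> D"
    using card_image_le[OF finite_subset[OF sub assms(1)], of "greedy F p"]
      card_mono[OF assms(1) sub] assms(2) by linarith
  have "\<not> {1..Suc D} \<subseteq> ?S"
  proof
    assume "{1..Suc D} \<subseteq> ?S"
    then have "card {1..Suc D} \<le> card ?S"
      using finite_subset[OF sub assms(1)] by (intro card_mono) auto
    then show False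
      using \<open>card ?S \<le> D\<close> by simp
  qed
  then obtain a where a: "1 \<le> a" "a \<le> Suc D" "a \<notin> ?S"
    by (meson atLeastAtMost_iff subsetI)
  then have "1 \<le> greedy F p x \<and> greedy F p x \<notin> ?S"
    unfolding greedy.simps[of F p x]
    by (intro LeastI[of "\<lambda>a. 1 \<le> a \<and> a \<notin> ?S" a]) auto
  moreover have "greedy F p x \<le> a"
    unfolding greedy.simps[of F p x] using a by (intro Least_le) auto
  ultimately show "1 \<le> greedy F p x" "greedy F p x \<le> Suc D" "greedy F p x \<notin> ?S"
    using a by auto
qed

context bounded_graphing
begin

text \<open>Induction on the value \<open>i\<close> of \<open>p\<close>: at such a point the greedy
  color depends only on which colors occur among neighbors of smaller value. Those color classes are
  measurable by induction, and \<open>pre\<close> makes having a neighbor in them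
  measurable.\<close>

lemma greedy_level_sets:
  assumes F: "F \<subseteq> X \<times> X" "\<And>x. finite (F `` {x})" "\<And>x. card (F `` {x}) \<le> D"
    and pre: "\<And>B. B \<in> sets M \<Longrightarrow> {x \<in> X. F `` {x} \<inter> B \<noteq> {}} \<in> sets M"
    and p: "p \<in> measurable M (count_space UNIV)"
  shows "{x \<in> X. p x = i \<and> greedy F p x = a} \<in> sets M"
proof (induction i arbitrary: a rule: less_induct)
  case (less i)
  let ?L = "\<lambda>b. {y \<in> X. p y < i \<and> greedy F p y = b}"
  have "?L b = (\<Union>j\<in>{..<i}. {y \<in> X. p y = j \<and> greedy F p y = b})" for b
    by auto
  then have "?L b \<in> sets M" for b
    using less by auto
  then have N: "{x \<in> X. F `` {x} \<inter> ?L b \<noteq> {}} \<in> sets M" for b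
    by (rule pre)
  have used: "b \<in> greedy F p ` {y. (x, y) \<in> F \<and> p y < p x} \<longleftrightarrow> F `` {x} \<inter> ?L b \<noteq> {}"
    if "p x = i" for b x
    using that F(1) by auto
  \<comment> \<open>Minimality is spelled out with a bounded quantifier, so that the level set
    becomes a finite Boolean combination of measurable sets.\<close>
  have least: "greedy F p x = a \<longleftrightarrow> 1 \<le> a \<and> a \<notin> greedy F p ` {y. (x, y) \<in> F \<and> p y < p x} \<and>
      (\<forall>b\<in>{1..<a}. b \<in> greedy F p ` {y. (x, y) \<in> F \<and> p y < p x})" (is "_ \<longleftrightarrow> 1 \<le> a \<and> a \<notin> ?S \<and> _") for x
  proof
    assume eq: "greedy F p x = a"
    show "1 \<le> a \<and> a \<notin> ?S \<and> (\<forall>b\<in>{1..<a}. b \<in> ?S)"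
    proof (intro conjI ballI)
      fix b
      assume "b \<in> {1..<a}"
      then show "b \<in> ?S"
        using not_less_Least[of b "\<lambda>a. 1 \<le> a \<and> a \<notin> ?S"] eq greedy.simps[of F p x] by auto
    qed (use greedy_props[OF F(2,3), of p x] eq in auto)
  next
    assume a: "1 \<le> a \<and> a \<notin> ?S \<and> (\<forall>b\<in>{1..<a}. b \<in> ?S)"
    have "a \<le> b" if "1 \<le> b \<and> b \<notin> ?S" for b
      using a that by (meson atLeastLessThan_iff not_le)
    then show "greedy F p x = a"
      unfolding greedy.simps[of F p x] using a by (intro Least_equality) auto
  qed
  have "{x \<in> X. p x = i \<and> greedy F p x = a} =
    {x \<in> X. p x = i \<and> (1 \<le> a \<and> x \<notin> {x \<in> X. F `` {x} \<inter> ?L a \<noteq> {}} \<and>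
      (\<forall>b\<in>{1..<a}. x \<in> {x \<in> X. F `` {x} \<inter> ?L b \<noteq> {}}))}"
  proof (intro Collect_cong conj_cong refl)
    fix x
    assume x: "x \<in> X" "p x = i"
    show "greedy F p x = a \<longleftrightarrow> 1 \<le> a \<and> x \<notin> {x \<in> X. F `` {x} \<inter> ?L a \<noteq> {}} \<and>
      (\<forall>b\<in>{1..<a}. x \<in> {x \<in> X. F `` {x} \<inter> ?L b \<noteq> {}})"
      using x(1) unfolding least[of x] used[OF x(2)] by blast
  qed
  also have "\<dots> \<in> sets M"
    using N p by measurable
  finally show ?case .
qed

text \<open>The argument of Kechris, Solecki and Todorcevic. The sets \<open>I i\<close> are
  independent, and they cover \<open>X\<close> because some \<open>U i\<close> separates a point
  from its finitely many neighbors. The first index of a set containing the point is a countable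
  proper coloring \<open>p\<close>, and greedy recoloring along \<open>p\<close> reduces it to
  \<open>D + 1\<close> colors.\<close>

lemma ex_proper_coloring:
  assumes F: "F \<subseteq> X \<times> X" "sym F" "irrefl F" "\<And>x. finite (F `` {x})" "\<And>x. card (F `` {x}) \<le> D"
    and pre: "\<And>B. B \<in> sets M \<Longrightarrow> {x \<in> X. F `` {x} \<inter> B \<noteq> {}} \<in> sets M"
  obtains c where "c \<in> colorings (Suc D) G" "\<And>x y. (x, y) \<in> F \<Longrightarrow> c x \<noteq> c y"
proof -
  obtain U :: "nat \<Rightarrow> 'a set" where U: "\<And>i. U i \<in> sets M"
    "\<And>x S. x \<in> X \<Longrightarrow> finite S \<Longrightarrow> x \<notin> S \<Longrightarrow> \<exists>i. x \<in> U i \<and> U i \<inter> S = {}"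
    by (rule ex_separating_family) blast
  define I where "I i = {x \<in> U i. F `` {x} \<inter> U i = {}}" for i
  have I_sets: "I i \<in> sets M" for i
  proof -
    have "I i = U i - {x \<in> X. F `` {x} \<inter> U i \<noteq> {}}"
      using sets.sets_into_space[OF U(1)[of i]] by (auto simp: I_def)
    then show ?thesis
      using U(1) pre by auto
  qed
  have cover: "\<exists>i. x \<in> I i" if "x \<in> X" for x
    using U(2)[OF that F(4), of x] F(3) unfolding I_def irrefl_def by blast
  define p where "p x = (LEAST i. x \<in> I i)" for x
  have pI: "x \<in> I (p x)" if "x \<in> X" for x
    unfolding p_def using cover[OF that] by (rule LeastI_ex)
  have p_eq: "p x = i \<longleftrightarrow> x \<in> I i \<and> (\<forall>j\<in>{..<i}. x \<notin> I j)" if "x \<in> X" for x i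
  proof
    assume "p x = i"
    moreover have "x \<notin> I j" if "j < p x" for j
      using that unfolding p_def by (rule not_less_Least)
    ultimately show "x \<in> I i \<and> (\<forall>j\<in>{..<i}. x \<notin> I j)"
      using pI[OF that] by blast
  next
    assume "x \<in> I i \<and> (\<forall>j\<in>{..<i}. x \<notin> I j)"
    then show "p x = i"
      unfolding p_def by (intro Least_equality) (auto intro: leI)
  qed
  have p: "p \<in> measurable M (count_space UNIV)"
  proof (rule measurable_nat_valuedI)
    fix i
    have "{x \<in> X. p x = i} = {x \<in> X. x \<in> I i \<and> (\<forall>j\<in>{..<i}. x \<notin> I j)}"
      using p_eq by auto
    also have "\<dots> \<in> sets M"
      using I_sets by measurable
    finally show "{x \<in> X. p x = i} \<in> sets M" .
  qed
  have p_proper: "p x \<noteq> p y" if "(x, y) \<in> F" for x y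
  proof
    assume "p x = p y"
    then have "x \<in> I (p x)" "y \<in> I (p x)"
      using pI[of x] pI[of y] that F(1) by auto
    then show False
      using that unfolding I_def by blast
  qed
  show ?thesis
  proof (rule that[of "greedy F p"])
    have "greedy F p \<in> measurable M (count_space UNIV)"
    proof (rule measurable_nat_valuedI)
      fix a
      have "{x \<in> X. greedy F p x = a} = (\<Union>i. {x \<in> X. p x = i \<and> greedy F p x = a})"
        by auto
      then show "{x \<in> X. greedy F p x = a} \<in> sets M"
        using greedy_level_sets[OF F(1,4,5) pre p] by simp
    qed
    then show "greedy F p \<in> colorings (Suc D) G"
      using greedy_props(1,2)[OF F(4,5)] by (auto simp: colorings_iff)
    have *: "greedy F p x \<noteq> greedy F p y" if "(x, y) \<in> F" "p y < p x" for x y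
      using greedy_props(3)[OF F(4,5), of p x] that by blast
    show "greedy F p x \<noteq> greedy F p y" if "(x, y) \<in> F" for x y
      using *[of x y] *[of y x] p_proper[OF that] that F(2) by (metis linorder_neqE_nat symD)
  qed
qed

text \<open>Properly color the graph \<open>F\<close> that joins distinct points at distance at most
  \<open>r\<close>; its degrees are bounded by the size of a ball.\<close>

lemma ex_distance_coloring:
  obtains c where "c \<in> colorings (Suc ((1 + d) ^ r)) G"
    "\<And>x y. x \<in> X \<Longrightarrow> y \<in> rel_ball E r x \<Longrightarrow> c x = c y \<Longrightarrow> x = y"
proof -
  obtain U :: "nat \<Rightarrow> 'a set" where U: "\<And>i. U i \<in> sets M"
    "\<And>x S. x \<in> X \<Longrightarrow> finite S \<Longrightarrow> x \<notin> S \<Longrightarrow> \<exists>i. x \<in> U i \<and> U i \<inter> S = {}"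
    by (rule ex_separating_family) blast
  define F where "F = {(x, y). x \<in> X \<and> y \<in> rel_ball E r x \<and> x \<noteq> y}"
  have F_nbrs: "F `` {x} \<subseteq> rel_ball E r x" "x \<notin> X \<Longrightarrow> F `` {x} = {}" for x
    by (auto simp: F_def)
  have fin: "finite (F `` {x})" for x
    using finite_subset[OF F_nbrs(1) finite_ball] F_nbrs(2)[of x] by (cases "x \<in> X") auto
  have card: "card (F `` {x}) \<le> (1 + d) ^ r" for x
    using card_mono[OF finite_ball F_nbrs(1)] card_ball_le[of x r] F_nbrs(2)[of x]
    by (cases "x \<in> X") (auto intro: order_trans)
  have pre: "{x \<in> X. F `` {x} \<inter> B \<noteq> {}} \<in> sets M" if B: "B \<in> sets M" for B
  proof -
    \<comment> \<open>Reaching \<open>B\<close> is known to be measurable, but here the point itself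
      must not count. The condition \<open>y \<noteq> x\<close> is expressed countably: some
      \<open>U i\<close> contains \<open>x\<close> and misses \<open>y\<close>.\<close>
    have "{x \<in> X. F `` {x} \<inter> B \<noteq> {}} =
      (\<Union>i. U i \<inter> {x \<in> X. rel_ball E r x \<inter> (B - U i) \<noteq> {}})" (is "?l = ?r")
    proof
      show "?l \<subseteq> ?r"
      proof
        fix x
        assume "x \<in> ?l"
        then obtain y where y: "x \<in> X" "y \<in> rel_ball E r x" "y \<noteq> x" "y \<in> B"
          by (auto simp: F_def)
        then obtain i where "x \<in> U i" "U i \<inter> {y} = {}"
          using U(2)[of x "{y}"] by auto
        then show "x \<in> ?r"
          using y by blast
      qed
      show "?r \<subseteq> ?l"
        by (auto simp: F_def)
    qed
    moreover have "U i \<inter> {x \<in> X. rel_ball E r x \<inter> (B - U i) \<noteq> {}} \<in> sets M" for i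
      using U(1)[of i] reach_sets_measure[of "B - U i" r] B by blast
    ultimately show ?thesis
      by auto
  qed
  have "F \<subseteq> X \<times> X"
    using ball_subset by (auto simp: F_def)
  moreover have "sym F"
    using rel_ball_sym[OF edge_sym] ball_subset unfolding F_def sym_def by blast
  moreover have "irrefl F"
    by (auto simp: F_def irrefl_def)
  ultimately obtain c where "c \<in> colorings (Suc ((1 + d) ^ r)) G" "\<And>x y. (x, y) \<in> F \<Longrightarrow> c x \<noteq> c y"
    using ex_proper_coloring[OF _ _ _ fin card pre] by metis
  then show ?thesis
    by (intro that[of c]) (auto simp: F_def)
qed

end

section \<open>Transfer of statistics between graphings\<close>

definition law :: "'a measure \<Rightarrow> ('a \<Rightarrow> 'b) \<Rightarrow> 'b \<Rightarrow> real" where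
  "law M h \<alpha> = measure M {x \<in> space M. h x = \<alpha>}"

lemma law_cong: "(\<And>x. x \<in> space M \<Longrightarrow> g x = h x) \<Longrightarrow> law M g = law M h"
  unfolding law_def by (intro ext arg_cong[where f = "measure M"]) auto

lemma (in prob_space) expectation_finite_valued:
  fixes w :: "'b \<Rightarrow> real"
  assumes h: "h \<in> measurable M (count_space UNIV)" and S: "finite S" "\<And>x. x \<in> space M \<Longrightarrow> h x \<in> S"
  shows "integrable M (\<lambda>x. w (h x))"
    and "(LINT x|M. w (h x)) = (\<Sum>a\<in>S. w a * law M h a)"
proof -
  have sets: "{x \<in> space M. h x = a} \<in> sets M" for a
    using measurable_sets[OF h, of "{a}"] by (simp add: vimage_def Int_def conj_commute)
  have eq: "w (h x) = (\<Sum>a\<in>S. w a * indicator {x \<in> space M. h x = a} x)" if "x \<in> space M" for x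
  proof -
    have "(\<Sum>a\<in>S. w a * indicator {x \<in> space M. h x = a} x) = (\<Sum>a\<in>S. if h x = a then w a else 0)"
      using that by (intro sum.cong) (auto simp: indicator_def)
    also have "\<dots> = w (h x)"
      using S(1) S(2)[OF that] by simp
    finally show ?thesis by simp
  qed
  have int: "integrable M (indicat_real {x \<in> space M. h x = a})" for a
    using sets by (intro integrable_real_indicator) (auto simp: emeasure_eq_measure)
  have "integrable M (\<lambda>x. \<Sum>a\<in>S. w a * indicator {x \<in> space M. h x = a} x)"
    using int by (intro Bochner_Integration.integrable_sum integrable_mult_right) auto
  then show "integrable M (\<lambda>x. w (h x))"
    by (rule Bochner_Integration.integrable_cong[THEN iffD1, OF refl, rotated]) (simp add: eq)
  have "(LINT x|M. w (h x)) = (LINT x|M. (\<Sum>a\<in>S. w a * indicator {x \<in> space M. h x = a} x))"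
    by (rule Bochner_Integration.integral_cong) (simp_all add: eq)
  also have "\<dots> = (\<Sum>a\<in>S. LINT x|M. w a * indicator {x \<in> space M. h x = a} x)"
    using int by (intro Bochner_Integration.integral_sum integrable_mult_right) auto
  also have "\<dots> = (\<Sum>a\<in>S. w a * law M h a)"
    using sets by (intro sum.cong) (simp_all add: law_def)
  finally show "(LINT x|M. w (h x)) = (\<Sum>a\<in>S. w a * law M h a)" .
qed

lemma (in prob_space) law_in_prob_simplex:
  assumes h: "h \<in> measurable M (count_space UNIV)" and S: "finite S" "\<And>x. x \<in> space M \<Longrightarrow> h x \<in> S"
  shows "law M h \<in> prob_simplex S"
proof -
  have "law M h a = 0" if "a \<notin> S" for a
  proof -
    have "{x \<in> space M. h x = a} = {}"
      using S(2) that by auto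
    then show ?thesis
      by (simp only: law_def measure_empty)
  qed
  moreover have "(\<Sum>a\<in>S. law M h a) = 1"
    using expectation_finite_valued(2)[OF h S, of "\<lambda>_. 1"] prob_space by simp
  ultimately show ?thesis
    by (auto simp: prob_simplex_def law_def)
qed

lemma sets_neq_nat:
  fixes f g :: "'a \<Rightarrow> nat"
  assumes "f \<in> measurable N (count_space UNIV)" "g \<in> measurable N (count_space UNIV)"
  shows "{x \<in> space N. f x \<noteq> g x} \<in> sets N"
proof -
  have [measurable]: "(\<lambda>x. real (f x)) \<in> borel_measurable N" "(\<lambda>x. real (g x)) \<in> borel_measurable N"
    using assms by (auto intro: measurable_compose)
  have "{x \<in> space N. real (f x) \<noteq> real (g x)} \<in> sets N"
    by measurable
  then show ?thesis
    by simp
qed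

lemma law_event:
  assumes "prob_space M" "h \<in> measurable M (count_space UNIV)" "finite S" "\<And>x. x \<in> space M \<Longrightarrow> h x \<in> S"
  shows "measure M {x \<in> space M. P (h x)} = (\<Sum>a\<in>S. (if P a then 1 else 0) * law M h a)"
proof -
  interpret prob_space M by fact
  have sets: "{x \<in> space M. P (h x)} \<in> sets M"
    using measurable_sets[OF assms(2), of "{a. P a}"] by (simp add: vimage_def Int_def conj_commute)
  have "measure M {x \<in> space M. P (h x)} = (LINT x|M. indicator {x \<in> space M. P (h x)} x)"
    using sets by simp
  also have "\<dots> = (LINT x|M. (if P (h x) then 1 else 0))"
    by (rule Bochner_Integration.integral_cong) (auto simp: indicator_def)
  also have "\<dots> = (\<Sum>a\<in>S. (if P a then 1 else 0) * law M h a)"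
    by (rule expectation_finite_valued(2)[OF assms(2-4)])
  finally show ?thesis .
qed

lemma sum_weighted_diff_le:
  fixes w p q :: "'b \<Rightarrow> real"
  assumes "finite S" "\<And>a. a \<in> S \<Longrightarrow> \<bar>w a\<bar> \<le> b" "\<And>a. a \<in> S \<Longrightarrow> \<bar>p a - q a\<bar> \<le> \<eta>" "0 \<le> b"
  shows "\<bar>(\<Sum>a\<in>S. w a * p a) - (\<Sum>a\<in>S. w a * q a)\<bar> \<le> real (card S) * (b * \<eta>)"
proof -
  have "\<bar>(\<Sum>a\<in>S. w a * p a) - (\<Sum>a\<in>S. w a * q a)\<bar> = \<bar>\<Sum>a\<in>S. w a * (p a - q a)\<bar>"
    by (simp add: sum_subtractf algebra_simps)
  also have "\<dots> \<le> (\<Sum>a\<in>S. \<bar>w a * (p a - q a)\<bar>)"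
    by (rule sum_abs)
  also have "\<dots> \<le> real (card S) * (b * \<eta>)"
    using assms by (intro sum_bounded_above) (auto simp: abs_mult intro!: mult_mono)
  finally show ?thesis .
qed

text \<open>A size statistic that can only grow under the passage from \<open>M\<close> to \<open>N\<close> has to be preserved
  almost everywhere, up to the difference of its expectations.\<close>

lemma size_rigidity:
  fixes D :: "'c \<Rightarrow> nat" and s :: "'a \<Rightarrow> nat" and s' :: "'b \<Rightarrow> nat"
  assumes M: "prob_space M" and N: "prob_space N" and S: "finite S"
    and g: "g \<in> measurable M (count_space UNIV)" "\<And>x. x \<in> space M \<Longrightarrow> g x \<in> S"
    and g': "g' \<in> measurable N (count_space UNIV)" "\<And>x. x \<in> space N \<Longrightarrow> g' x \<in> S"
    and laws: "\<And>a. a \<in> S \<Longrightarrow> \<bar>law M g a - law N g' a\<bar> \<le> \<eta>"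
    and D: "\<And>a. D a \<le> b" and s: "\<And>x. x \<in> space M \<Longrightarrow> s x = D (g x)"
    and s': "s' \<in> measurable N (count_space UNIV)" "\<And>x. x \<in> space N \<Longrightarrow> s' x \<le> b"
    and B: "B \<in> sets N" "measure N B \<le> \<eta>"
    and le: "\<And>x. x \<in> space N - B \<Longrightarrow> D (g' x) \<le> s' x"
  shows "measure N {x \<in> space N. D (g' x) \<noteq> s' x}
    \<le> (LINT x|N. real (s' x)) - (LINT x|M. real (s x)) + (real (card S) * real b + real b + 1) * \<eta>"
proof -
  interpret M: prob_space M by fact
  interpret N: prob_space N by fact
  let ?A = "{x \<in> space N. D (g' x) \<noteq> s' x}"
  have int_s': "integrable N (\<lambda>x. real (s' x))"
    by (rule N.expectation_finite_valued(1)[OF s'(1), of "{..b}" real]) (use s'(2) in auto)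
  have int_D: "integrable N (\<lambda>x. real (D (g' x)))"
    by (rule N.expectation_finite_valued(1)[OF g'(1) S g'(2), of "\<lambda>a. real (D a)"])
  have A: "?A \<in> sets N"
    by (rule sets_neq_nat[OF measurable_compose[OF g'(1)] s'(1)]) simp
  have int_B: "integrable N (indicat_real B)" "integrable N (indicat_real ?A)"
    using A B(1) by (auto intro!: integrable_real_indicator simp: N.emeasure_eq_measure)
  have "measure N ?A = (LINT x|N. indicator ?A x)"
    using A by simp
  \<comment> \<open>Off \<open>B\<close> the difference is a nonnegative integer, hence at least 1
    where the sizes disagree. On \<open>B\<close> it may drop to \<open>-b\<close>, which
    \<open>b + 1\<close> compensates.\<close>
  also have "\<dots> \<le> (LINT x|N. real (s' x) - real (D (g' x)) + (real b + 1) * indicator B x)"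
  proof (rule integral_mono)
    show "integrable N (\<lambda>x. real (s' x) - real (D (g' x)) + (real b + 1) * indicat_real B x)"
      by (intro Bochner_Integration.integrable_add Bochner_Integration.integrable_diff
          integrable_mult_right int_s' int_D int_B)
    fix x
    assume x: "x \<in> space N"
    show "indicat_real ?A x \<le> real (s' x) - real (D (g' x)) + (real b + 1) * indicat_real B x"
    proof (cases "x \<in> B")
      case True
      have "indicat_real ?A x \<le> 1"
        by (simp add: indicator_def)
      also have "1 \<le> real (s' x) - real (D (g' x)) + (real b + 1)"
        using D[of "g' x"] by simp
      finally show ?thesis
        using True by simp
    next
      case False
      then have "D (g' x) \<le> s' x"
        using le x by blast
      then show ?thesis
        using False x by (auto simp: indicator_def)
    qed
  qed (rule int_B)
  also have "\<dots> = (LINT x|N. real (s' x)) - (LINT x|N. real (D (g' x))) + (real b + 1) * measure N B"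
    using int_s' int_D int_B B(1)
    by (subst Bochner_Integration.integral_add) (auto simp: Bochner_Integration.integral_diff)
  also have "(LINT x|N. real (D (g' x))) = (\<Sum>a\<in>S. real (D a) * law N g' a)"
    by (rule N.expectation_finite_valued(2)[OF g'(1) S g'(2), of "\<lambda>a. real (D a)"])
  finally have 1: "measure N ?A \<le> (LINT x|N. real (s' x)) - (\<Sum>a\<in>S. real (D a) * law N g' a)
    + (real b + 1) * measure N B" .
  have "(LINT x|M. real (s x)) = (LINT x|M. real (D (g x)))"
    by (rule Bochner_Integration.integral_cong) (use s in auto)
  also have "\<dots> = (\<Sum>a\<in>S. real (D a) * law M g a)"
    by (rule M.expectation_finite_valued(2)[OF g(1) S g(2), of "\<lambda>a. real (D a)"])
  finally have 2: "(LINT x|M. real (s x)) = (\<Sum>a\<in>S. real (D a) * law M g a)" .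
  have 3: "\<bar>(\<Sum>a\<in>S. real (D a) * law M g a) - (\<Sum>a\<in>S. real (D a) * law N g' a)\<bar>
    \<le> real (card S) * (real b * \<eta>)"
    using D by (intro sum_weighted_diff_le S laws) auto
  have 4: "(real b + 1) * measure N B \<le> (real b + 1) * \<eta>"
    using B(2) by (intro mult_left_mono) auto
  show ?thesis
    using 1 2 3 4 by (simp add: algebra_simps)
qed

text \<open>The composite of \<open>T\<close> and \<open>g'\<close> mediates: its law is close to
  that of \<open>t\<close> because the laws of \<open>g\<close> and \<open>g'\<close> are close, and
  it differs from \<open>t'\<close> only on \<open>A\<close>.\<close>

lemma law_transfer:
  assumes M: "prob_space M" and N: "prob_space N" and S: "finite S"
    and g: "g \<in> measurable M (count_space UNIV)" "\<And>x. x \<in> space M \<Longrightarrow> g x \<in> S"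
    and g': "g' \<in> measurable N (count_space UNIV)" "\<And>x. x \<in> space N \<Longrightarrow> g' x \<in> S"
    and laws: "\<And>a. a \<in> S \<Longrightarrow> \<bar>law M g a - law N g' a\<bar> \<le> \<eta>"
    and t: "\<And>x. x \<in> space M \<Longrightarrow> t x = T (g x)"
    and t': "t' \<in> measurable N (count_space UNIV)"
    and A: "A \<in> sets N" "\<And>x. x \<in> space N - A \<Longrightarrow> T (g' x) = t' x"
  shows "\<bar>law M t \<alpha> - law N t' \<alpha>\<bar> \<le> real (card S) * \<eta> + measure N A"
proof -
  interpret N: prob_space N by fact
  have 1: "law M t \<alpha> = (\<Sum>a\<in>S. (if T a = \<alpha> then 1 else 0) * law M g a)"
    using law_event[OF M g(1) S g(2), of "\<lambda>a. T a = \<alpha>"] law_cong[of M t "\<lambda>x. T (g x)"] t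
    by (simp add: law_def)
  have 2: "law N (\<lambda>x. T (g' x)) \<alpha> = (\<Sum>a\<in>S. (if T a = \<alpha> then 1 else 0) * law N g' a)"
    using law_event[OF N g'(1) S g'(2), of "\<lambda>a. T a = \<alpha>"] by (simp add: law_def)
  have 3: "\<bar>(\<Sum>a\<in>S. (if T a = \<alpha> then 1 else 0) * law M g a)
    - (\<Sum>a\<in>S. (if T a = \<alpha> then 1 else 0) * law N g' a)\<bar> \<le> real (card S) * (1 * \<eta>)"
    by (intro sum_weighted_diff_le S laws) auto
  let ?U = "{x \<in> space N. T (g' x) = \<alpha>}" and ?V = "{x \<in> space N. t' x = \<alpha>}"
  have U: "?U \<in> sets N"
    using measurable_sets[OF g'(1), of "{a. T a = \<alpha>}"] by (simp add: vimage_def Int_def conj_commute)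
  have V: "?V \<in> sets N"
    using measurable_sets[OF t', of "{\<alpha>}"] by (simp add: vimage_def Int_def conj_commute)
  have "measure N ?U \<le> measure N (?V \<union> A)" "measure N ?V \<le> measure N (?U \<union> A)"
    using U V A by (auto intro!: N.finite_measure_mono)
  then have 4: "\<bar>law N (\<lambda>x. T (g' x)) \<alpha> - law N t' \<alpha>\<bar> \<le> measure N A"
    using measure_Un_le[OF U A(1)] measure_Un_le[OF V A(1)] by (simp add: law_def)
  show ?thesis
    using 1 2 3 4 by simp
qed

text \<open>The functions \<open>D\<close> and \<open>T\<close> decode the weight and the type of a vertex of \<open>G\<close> from its color under
  \<open>g\<close>. For a coloring \<open>g'\<close> of \<open>H\<close> with similar statistics the decoded data are only a guess: off the
  exceptional set \<open>B\<close> the weight is underestimated, and the type is right where the weight is.\<close>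

definition simulates ::
  "('a graphing \<Rightarrow> ('a \<Rightarrow> nat) \<Rightarrow> 's \<Rightarrow> real) \<Rightarrow> 's set \<Rightarrow> ('a graphing \<Rightarrow> 'a \<Rightarrow> nat) \<Rightarrow>
    ('a graphing \<Rightarrow> ('a \<Rightarrow> nat) \<Rightarrow> 'a \<Rightarrow> 't) \<Rightarrow> nat \<Rightarrow> nat \<Rightarrow> nat \<Rightarrow> real \<Rightarrow> 'a graphing \<Rightarrow> 'a graphing \<Rightarrow> bool"
where
  "simulates src \<Omega> wt typ b k K C G H \<longleftrightarrow>
    (\<forall>f\<in>colorings k G. \<exists>g\<in>colorings K G. \<exists>(D :: nat \<Rightarrow> nat) T.
      (\<forall>a. D a \<le> b) \<and>
      (\<forall>x\<in>space (vmeas G). wt G x = D (g x) \<and> typ G f x = T (g x)) \<and>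
      (\<forall>g'\<in>colorings K H. \<exists>f'\<in>colorings k H. \<exists>B\<in>sets (vmeas H).
        measure (vmeas H) B \<le> C * tv_dist \<Omega> (src G g) (src H g') \<and>
        (\<forall>a\<in>{1..K}. \<bar>law (vmeas G) g a - law (vmeas H) g' a\<bar> \<le> C * tv_dist \<Omega> (src G g) (src H g')) \<and>
        (\<forall>x\<in>space (vmeas H) - B. D (g' x) \<le> wt H x \<and>
          (D (g' x) = wt H x \<longrightarrow> T (g' x) = typ H f' x))))"

text \<open>Weight and type factor through the measurable coloring \<open>g\<close>, so a simulation
  proves their measurability as a by-product.\<close>

lemma simulates_measurable:
  assumes G: "is_graphing d G" and sim: "simulates src \<Omega> wt typ b k K C G H" and f: "f \<in> colorings k G"
  shows "wt G \<in> measurable (vmeas G) (count_space UNIV)"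
    "typ G f \<in> measurable (vmeas G) (count_space UNIV)"
    "\<And>x. x \<in> space (vmeas G) \<Longrightarrow> wt G x \<le> b"
proof -
  interpret bounded_graphing d G
    by unfold_locales (rule G)
  obtain g and D :: "nat \<Rightarrow> nat" and T where g: "g \<in> colorings K G" and D: "\<forall>a. D a \<le> b"
    and eq: "\<forall>x\<in>space (vmeas G). wt G x = D (g x) \<and> typ G f x = T (g x)"
    using sim f unfolding simulates_def by meson
  have "(\<lambda>x. D (g x)) \<in> measurable (vmeas G) (count_space UNIV)"
    "(\<lambda>x. T (g x)) \<in> measurable (vmeas G) (count_space UNIV)"
    by (rule measurable_compose[OF coloring_measurable[OF g]]; simp)+
  then show "wt G \<in> measurable (vmeas G) (count_space UNIV)"
    "typ G f \<in> measurable (vmeas G) (count_space UNIV)"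
    using eq by (auto cong: measurable_cong)
  show "\<And>x. x \<in> space (vmeas G) \<Longrightarrow> wt G x \<le> b"
    using eq D by auto
qed

text \<open>In the constant, \<open>K\<close> comes from comparing laws on \<open>{1..K}\<close>,
  the bracket occurs twice because the set where the decoded weight is wrong costs it once for the
  rigidity estimate and once for the drift of the expected weights, and the last 1 is the set
  \<open>B\<close>.\<close>

lemma simulates_transfer:
  assumes G: "is_graphing d G" and H: "is_graphing d H"
    and sim: "simulates src \<Omega> wt typ b k K C G H" "simulates src \<Omega> wt typ b k K C H G"
    and C: "C > 0"
    and GH: "\<And>g. g \<in> colorings K G \<Longrightarrow> \<exists>g'\<in>colorings K H. tv_dist \<Omega> (src G g) (src H g') < \<eta> / C"
    and HG: "\<And>g. g \<in> colorings K H \<Longrightarrow> \<exists>g'\<in>colorings K G. tv_dist \<Omega> (src H g) (src G g') < \<eta> / C"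
    and f: "f \<in> colorings k G"
  obtains f' where "f' \<in> colorings k H"
    "\<And>\<alpha>. \<bar>law (vmeas G) (typ G f) \<alpha> - law (vmeas H) (typ H f') \<alpha>\<bar>
      \<le> (real K + 2 * (real K * real b + real b + 1) + 1) * \<eta>"
proof -
  interpret G: bounded_graphing d G
    by unfold_locales (rule G)
  interpret H: bounded_graphing d H
    by unfold_locales (rule H)
  let ?c = "real K * real b + real b + 1"
  \<comment> \<open>Formulated for a generic pair, since it is applied from \<open>G\<close> to
    \<open>H\<close> and from \<open>H\<close> to \<open>G\<close>.\<close>
  have step: "\<exists>f'\<in>colorings k H2. \<exists>A\<in>sets (vmeas H2). \<exists>B\<in>sets (vmeas H2). \<exists>g\<in>colorings K G2.
      \<exists>g'\<in>colorings K H2. \<exists>T.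
      measure (vmeas H2) A \<le> (LINT x|vmeas H2. real (wt H2 x)) - (LINT x|vmeas G2. real (wt G2 x)) + ?c * \<eta> \<and>
      measure (vmeas H2) B \<le> \<eta> \<and> (\<forall>a\<in>{1..K}. \<bar>law (vmeas G2) g a - law (vmeas H2) g' a\<bar> \<le> \<eta>) \<and>
      (\<forall>x\<in>space (vmeas G2). typ G2 f x = T (g x)) \<and>
      (\<forall>x\<in>space (vmeas H2) - (A \<union> B). T (g' x) = typ H2 f' x)"
    if G2: "is_graphing d G2" and H2: "is_graphing d H2"
      and sim2: "simulates src \<Omega> wt typ b k K C G2 H2" "simulates src \<Omega> wt typ b k K C H2 G2"
      and GH2: "\<And>g. g \<in> colorings K G2 \<Longrightarrow> \<exists>g'\<in>colorings K H2. tv_dist \<Omega> (src G2 g) (src H2 g') < \<eta> / C"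
      and f: "f \<in> colorings k G2" for G2 H2 f
  proof -
    interpret G2: bounded_graphing d G2
      by unfold_locales (rule G2)
    interpret H2: bounded_graphing d H2
      by unfold_locales (rule H2)
    obtain g and D :: "nat \<Rightarrow> nat" and T where g: "g \<in> colorings K G2" and D: "\<forall>a. D a \<le> b"
      and eq: "\<forall>x\<in>space (vmeas G2). wt G2 x = D (g x) \<and> typ G2 f x = T (g x)"
      and ex: "\<forall>g'\<in>colorings K H2. \<exists>f'\<in>colorings k H2. \<exists>B\<in>sets (vmeas H2).
        measure (vmeas H2) B \<le> C * tv_dist \<Omega> (src G2 g) (src H2 g') \<and>
        (\<forall>a\<in>{1..K}. \<bar>law (vmeas G2) g a - law (vmeas H2) g' a\<bar> \<le> C * tv_dist \<Omega> (src G2 g) (src H2 g')) \<and>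
        (\<forall>x\<in>space (vmeas H2) - B. D (g' x) \<le> wt H2 x \<and>
          (D (g' x) = wt H2 x \<longrightarrow> T (g' x) = typ H2 f' x))"
      using bspec[OF sim2(1)[unfolded simulates_def] f] by (elim bexE exE conjE) (rule that; assumption)
    obtain g' where g': "g' \<in> colorings K H2" "tv_dist \<Omega> (src G2 g) (src H2 g') < \<eta> / C"
      using GH2[OF g] by blast
    have small: "C * tv_dist \<Omega> (src G2 g) (src H2 g') \<le> \<eta>"
      using g'(2) C by (simp add: field_simps)
    obtain f' B where f': "f' \<in> colorings k H2" and B: "B \<in> sets (vmeas H2)"
      "measure (vmeas H2) B \<le> C * tv_dist \<Omega> (src G2 g) (src H2 g')"
      and laws: "\<forall>a\<in>{1..K}. \<bar>law (vmeas G2) g a - law (vmeas H2) g' a\<bar> \<le> C * tv_dist \<Omega> (src G2 g) (src H2 g')"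
      and off: "\<forall>x\<in>space (vmeas H2) - B. D (g' x) \<le> wt H2 x \<and>
          (D (g' x) = wt H2 x \<longrightarrow> T (g' x) = typ H2 f' x)"
      using bspec[OF ex g'(1)] by (elim bexE conjE) (rule that; assumption)
    have B': "measure (vmeas H2) B \<le> \<eta>"
      using B(2) small by linarith
    have laws': "\<bar>law (vmeas G2) g a - law (vmeas H2) g' a\<bar> \<le> \<eta>" if "a \<in> {1..K}" for a
      using laws that small by force
    note meas = simulates_measurable[OF H2 sim2(2) f']
    let ?A = "{x \<in> space (vmeas H2). D (g' x) \<noteq> wt H2 x}"
    have "measure (vmeas H2) ?A \<le> (LINT x|vmeas H2. real (wt H2 x)) - (LINT x|vmeas G2. real (wt G2 x))
      + (real (card {1..K}) * real b + real b + 1) * \<eta>"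
    proof (rule size_rigidity[where D = D and g = g and g' = g' and B = B])
      show "prob_space (vmeas G2)" "prob_space (vmeas H2)"
        by (rule G2.prob_space_axioms, rule H2.prob_space_axioms)
      show "g \<in> measurable (vmeas G2) (count_space UNIV)" "\<And>x. x \<in> space (vmeas G2) \<Longrightarrow> g x \<in> {1..K}"
        using g G2.coloring_measurable G2.coloring_range by blast+
      show "g' \<in> measurable (vmeas H2) (count_space UNIV)" "\<And>x. x \<in> space (vmeas H2) \<Longrightarrow> g' x \<in> {1..K}"
        using g'(1) H2.coloring_measurable H2.coloring_range by blast+
      show "\<bar>law (vmeas G2) g a - law (vmeas H2) g' a\<bar> \<le> \<eta>" if "a \<in> {1..K}" for a
        using laws'[OF that] .
      show "D a \<le> b" for a
        using D by blast
      show "wt G2 x = D (g x)" if "x \<in> space (vmeas G2)" for x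
        using eq that by blast
      show "wt H2 \<in> measurable (vmeas H2) (count_space UNIV)"
        by (rule meas(1))
      show "wt H2 x \<le> b" if "x \<in> space (vmeas H2)" for x
        using meas(3)[OF that] .
      show "D (g' x) \<le> wt H2 x" if "x \<in> space (vmeas H2) - B" for x
        using off that by blast
    qed (rule finite_atLeastAtMost B(1) B')+
    then have A: "measure (vmeas H2) ?A \<le> (LINT x|vmeas H2. real (wt H2 x)) -
        (LINT x|vmeas G2. real (wt G2 x)) + ?c * \<eta>"
      by simp
    have A_sets: "?A \<in> sets (vmeas H2)"
      by (rule sets_neq_nat[OF measurable_compose[OF H2.coloring_measurable[OF g'(1)]] meas(1)]) simp
    have off_A: "\<forall>x\<in>space (vmeas H2) - (?A \<union> B). T (g' x) = typ H2 f' x"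
      using off by blast
    have eq_T: "\<forall>x\<in>space (vmeas G2). typ G2 f x = T (g x)"
      using eq by blast
    show ?thesis
      by (intro bexI[of _ f'] bexI[of _ ?A] bexI[of _ B] bexI[of _ g] bexI[of _ g'] exI[of _ T] conjI)
        (rule A B' off_A eq_T A_sets B(1) g g'(1) f' ballI laws'; assumption?)+
  qed
  obtain f' A B g g' T where 1: "f' \<in> colorings k H" "A \<in> sets (vmeas H)" "B \<in> sets (vmeas H)"
    "g \<in> colorings K G" "g' \<in> colorings K H"
    "measure (vmeas H) A \<le> (LINT x|vmeas H. real (wt H x)) - (LINT x|vmeas G. real (wt G x)) + ?c * \<eta>"
    "measure (vmeas H) B \<le> \<eta>" "\<forall>a\<in>{1..K}. \<bar>law (vmeas G) g a - law (vmeas H) g' a\<bar> \<le> \<eta>"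
    "\<forall>x\<in>space (vmeas G). typ G f x = T (g x)"
    "\<forall>x\<in>space (vmeas H) - (A \<union> B). T (g' x) = typ H f' x"
    using step[OF G H sim GH f] by blast
  \<comment> \<open>The reverse application bounds a nonnegative measure by the drift with opposite
    sign, so the drift itself is at most \<open>?c * \<eta>\<close>.\<close>
  obtain A0 where "measure (vmeas G) A0
      \<le> (LINT x|vmeas G. real (wt G x)) - (LINT x|vmeas H. real (wt H x)) + ?c * \<eta>"
    using step[OF H G sim(2,1) HG 1(1)] by blast
  then have drift: "(LINT x|vmeas H. real (wt H x)) - (LINT x|vmeas G. real (wt G x)) \<le> ?c * \<eta>"
    using measure_nonneg[of "vmeas G" A0] by linarith
  have "\<bar>law (vmeas G) (typ G f) \<alpha> - law (vmeas H) (typ H f') \<alpha>\<bar>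
    \<le> real (card {1..K}) * \<eta> + measure (vmeas H) (A \<union> B)" for \<alpha>
  proof (rule law_transfer[where T = T and g = g and g' = g'])
    show "prob_space (vmeas G)" "prob_space (vmeas H)"
      by (rule G.prob_space_axioms, rule H.prob_space_axioms)
    show "g \<in> measurable (vmeas G) (count_space UNIV)" "\<And>x. x \<in> space (vmeas G) \<Longrightarrow> g x \<in> {1..K}"
      using 1(4) G.coloring_measurable G.coloring_range by blast+
    show "g' \<in> measurable (vmeas H) (count_space UNIV)" "\<And>x. x \<in> space (vmeas H) \<Longrightarrow> g' x \<in> {1..K}"
      using 1(5) H.coloring_measurable H.coloring_range by blast+
    show "typ H f' \<in> measurable (vmeas H) (count_space UNIV)"
      by (rule simulates_measurable(2)[OF H sim(2) 1(1)])
  qed (use 1 in auto)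
  moreover have "measure (vmeas H) (A \<union> B) \<le> 2 * (?c * \<eta>) + \<eta>"
    using measure_Un_le[OF 1(2,3)] 1(6,7) drift by linarith
  ultimately have "\<bar>law (vmeas G) (typ G f) \<alpha> - law (vmeas H) (typ H f') \<alpha>\<bar>
    \<le> real K * \<eta> + (2 * (?c * \<eta>) + \<eta>)" for \<alpha>
    by (smt (verit) card_atLeastAtMost diff_Suc_1)
  then show ?thesis
    using that[OF 1(1)] by (simp add: algebra_simps)
qed

text \<open>The data \<open>b\<close>, \<open>K\<close> and \<open>C\<close> are common to all pairs
  of graphings, so a single tolerance works for all large indices.\<close>

theorem tv_cauchy_transfer:
  fixes G :: "nat \<Rightarrow> 'a graphing"
  assumes G: "\<And>n. n \<ge> 1 \<Longrightarrow> is_graphing d (G n)" and fin: "finite \<Omega>'" and C: "C > 0"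
    and sim: "\<And>H L :: 'a graphing. is_graphing d H \<Longrightarrow> is_graphing d L \<Longrightarrow> simulates src \<Omega> wt typ b k K C H L"
    and cauchy: "tv_cauchy \<Omega> (\<lambda>n. src (G n) ` colorings K (G n))"
  shows "tv_cauchy \<Omega>' (\<lambda>n. (\<lambda>f. law (vmeas (G n)) (typ (G n) f)) ` colorings k (G n))"
  unfolding tv_cauchy_def
proof (intro allI impI)
  fix e :: real
  assume e: "e > 0"
  let ?c = "real K + 2 * (real K * real b + real b + 1) + 1"
  \<comment> \<open>The added 1 makes the final inequality strict and covers an empty
    \<open>\<Omega>'\<close>.\<close>
  define \<eta> where "\<eta> = e / ((real (card \<Omega>') + 1) * ?c)"
  have c: "?c > 0"
    by (simp add: add_pos_nonneg)
  then have \<eta>: "\<eta> > 0" "(real (card \<Omega>') + 1) * (?c * \<eta>) = e"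
    using e by (auto simp: \<eta>_def)
  then have "\<eta> / C > 0"
    using C by simp
  then obtain N where N: "\<forall>m\<ge>N. \<forall>n\<ge>N. \<forall>p\<in>src (G m) ` colorings K (G m).
    \<exists>q\<in>src (G n) ` colorings K (G n). tv_dist \<Omega> p q < \<eta> / C" "N \<ge> 1"
    by (rule tv_cauchyD[OF cauchy])
  show "\<exists>N. \<forall>m\<ge>N. \<forall>n\<ge>N. \<forall>p\<in>(\<lambda>f. law (vmeas (G m)) (typ (G m) f)) ` colorings k (G m).
    \<exists>q\<in>(\<lambda>f. law (vmeas (G n)) (typ (G n) f)) ` colorings k (G n). tv_dist \<Omega>' p q < e"
  proof (intro exI[of _ N] allI impI ballI)
    fix m n p
    assume mn: "m \<ge> N" "n \<ge> N" and "p \<in> (\<lambda>f. law (vmeas (G m)) (typ (G m) f)) ` colorings k (G m)"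
    then obtain f where f: "f \<in> colorings k (G m)" "p = law (vmeas (G m)) (typ (G m) f)"
      by blast
    have Gm: "is_graphing d (G m)" and Gn: "is_graphing d (G n)"
      using G mn N(2) by auto
    have near: "\<exists>g'\<in>colorings K (G j). tv_dist \<Omega> (src (G i) g) (src (G j) g') < \<eta> / C"
      if "i \<ge> N" "j \<ge> N" "g \<in> colorings K (G i)" for i j g
      using N(1) that by blast
    obtain f' where f': "f' \<in> colorings k (G n)"
      "\<And>\<alpha>. \<bar>law (vmeas (G m)) (typ (G m) f) \<alpha> - law (vmeas (G n)) (typ (G n) f') \<alpha>\<bar> \<le> ?c * \<eta>"
      by (rule simulates_transfer[OF Gm Gn sim[OF Gm Gn] sim[OF Gn Gm] C near[OF mn] near[OF mn(2,1)] f(1)])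
        (assumption, assumption, rule that)
    have "tv_dist \<Omega>' p (law (vmeas (G n)) (typ (G n) f')) \<le> real (card \<Omega>') * (?c * \<eta>)"
      unfolding f(2) by (rule tv_dist_le[OF fin f'(2)])
    also have "\<dots> < (real (card \<Omega>') + 1) * (?c * \<eta>)"
      using c \<eta>(1) by (intro mult_strict_right_mono) auto
    finally show "\<exists>q\<in>(\<lambda>f. law (vmeas (G n)) (typ (G n) f)) ` colorings k (G n). tv_dist \<Omega>' p q < e"
      using f'(1) \<eta>(2) by auto
  qed
qed

section \<open>Encoding balls by iterated stars\<close>

text \<open>The successor keeps codes positive, as colors must lie in \<open>{1..k}\<close>.\<close>

definition pair_code :: "nat \<Rightarrow> nat \<Rightarrow> nat" where
  "pair_code a b = Suc (prod_encode (a, b))"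

definition code_fst :: "nat \<Rightarrow> nat" where
  "code_fst x = fst (prod_decode (x - 1))"

definition code_snd :: "nat \<Rightarrow> nat" where
  "code_snd x = snd (prod_decode (x - 1))"

definition code_set :: "nat \<Rightarrow> nat set" where
  "code_set x = set_decode (code_snd x)"

lemma code_simps [simp]:
  "code_fst (pair_code a b) = a" "code_snd (pair_code a b) = b"
  "finite S \<Longrightarrow> code_set (pair_code a (set_encode S)) = S"
  by (simp_all add: pair_code_def code_fst_def code_snd_def code_set_def)

text \<open>Color refinement that records the set of neighboring colors, without multiplicities. In
  its uses \<open>h\<close> separates the neighbors of a vertex, so the set already determines their
  number.\<close>

fun tower :: "'a graphing \<Rightarrow> ('a \<Rightarrow> nat) \<Rightarrow> nat \<Rightarrow> 'a \<Rightarrow> nat" where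
  "tower G h 0 x = h x"
| "tower G h (Suc j) x = pair_code (tower G h j x) (set_encode (tower G h j ` nbrs G x))"

text \<open>A crude bound, but one that depends on numbers alone, so that all graphings share the
  same number of colors.\<close>

definition pair_bound :: "nat \<Rightarrow> nat \<Rightarrow> nat" where
  "pair_bound k q = Max ((\<lambda>(a, b). pair_code a b) ` ({..k} \<times> {..q}))"

fun tower_bound :: "nat \<Rightarrow> nat \<Rightarrow> nat" where
  "tower_bound k 0 = k"
| "tower_bound k (Suc j) = pair_bound (tower_bound k j) (Max (set_encode ` Pow {..tower_bound k j}))"

lemma pair_code_le_pair_bound: "a \<le> k \<Longrightarrow> b \<le> q \<Longrightarrow> pair_code a b \<le> pair_bound k q"
  unfolding pair_bound_def by (rule Max_ge) auto

lemma pair_code_ge_1: "1 \<le> pair_code a b"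
  by (simp add: pair_code_def)

context bounded_graphing
begin

lemma pair_coloring:
  assumes f: "f \<in> colorings k G" and c: "c \<in> colorings q G"
  shows "(\<lambda>x. pair_code (f x) (c x)) \<in> colorings (pair_bound k q) G"
  unfolding colorings_iff
proof (intro conjI ballI)
  fix x
  assume "x \<in> X"
  then have "f x \<le> k" "c x \<le> q"
    using coloring_range[OF f] coloring_range[OF c] by auto
  then show "pair_code (f x) (c x) \<in> {1..pair_bound k q}"
    using pair_code_le_pair_bound pair_code_ge_1 by simp
next
  have [measurable]: "f \<in> measurable M (count_space UNIV)" "c \<in> measurable M (count_space UNIV)"
    using f c by (auto dest: coloring_measurable)
  show "(\<lambda>x. pair_code (f x) (c x)) \<in> measurable M (count_space UNIV)"
    by measurable
qed

text \<open>Equality with a given code is tested color by color: having a neighbor of color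
  \<open>b\<close> is a measurable condition, and there are countably many \<open>b\<close>.\<close>

lemma nbr_colors_measurable:
  assumes t: "t \<in> colorings K G"
  shows "(\<lambda>x. set_encode (t ` nbrs G x)) \<in> measurable M (count_space UNIV)"
proof (rule measurable_nat_valuedI)
  fix n
  have N: "{x \<in> X. nbrs G x \<inter> {y \<in> X. t y = b} \<noteq> {}} \<in> sets M" for b
    by (intro preimage_nbrs_sets level_set_sets coloring_measurable[OF t])
  have eq: "set_encode (t ` nbrs G x) = n \<longleftrightarrow>
    (\<forall>b. x \<in> {x \<in> X. nbrs G x \<inter> {y \<in> X. t y = b} \<noteq> {}} \<longleftrightarrow> b \<in> set_decode n)" if "x \<in> X" for x
  proof -
    have "set_encode (t ` nbrs G x) = n \<longleftrightarrow> t ` nbrs G x = set_decode n"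
      using finite_nbrs[of x] by (metis finite_imageI set_decode_inverse set_encode_inverse)
    also have "\<dots> \<longleftrightarrow> (\<forall>b. b \<in> t ` nbrs G x \<longleftrightarrow> b \<in> set_decode n)"
      by auto
    also have "\<dots> \<longleftrightarrow> (\<forall>b. x \<in> {x \<in> X. nbrs G x \<inter> {y \<in> X. t y = b} \<noteq> {}} \<longleftrightarrow> b \<in> set_decode n)"
    proof (rule iff_allI)
      fix b
      have "b \<in> t ` nbrs G x \<longleftrightarrow> x \<in> {x \<in> X. nbrs G x \<inter> {y \<in> X. t y = b} \<noteq> {}}"
        using that nbrs_subset[of x] by blast
      then show "(b \<in> t ` nbrs G x \<longleftrightarrow> b \<in> set_decode n) \<longleftrightarrow>
        (x \<in> {x \<in> X. nbrs G x \<inter> {y \<in> X. t y = b} \<noteq> {}} \<longleftrightarrow> b \<in> set_decode n)"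
        by blast
    qed
    finally show ?thesis .
  qed
  have "{x \<in> X. set_encode (t ` nbrs G x) = n} =
    {x \<in> X. \<forall>b. x \<in> {x \<in> X. nbrs G x \<inter> {y \<in> X. t y = b} \<noteq> {}} \<longleftrightarrow> b \<in> set_decode n}"
    using eq by blast
  also have "\<dots> \<in> sets M"
    using N by measurable
  finally show "{x \<in> X. set_encode (t ` nbrs G x) = n} \<in> sets M" .
qed

lemma tower_coloring:
  assumes h: "h \<in> colorings K G"
  shows "tower G h j \<in> colorings (tower_bound K j) G"
proof (induction j)
  case 0
  then show ?case
    using h by (simp add: colorings_iff)
next
  case (Suc j)
  let ?t = "tower G h j" and ?k = "tower_bound K j"
  let ?q = "Max (set_encode ` Pow {..?k})"
  show ?case
    unfolding colorings_iff
  proof (intro conjI ballI)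
    fix x
    assume "x \<in> X"
    moreover have "?t y \<le> ?k" if "y \<in> X" for y
      using coloring_range[OF Suc that] by simp
    ultimately have "?t x \<le> ?k" "?t ` nbrs G x \<in> Pow {..?k}"
      using nbrs_subset[of x] by auto
    moreover from this(2) have "set_encode (?t ` nbrs G x) \<le> ?q"
      by (intro Max_ge) auto
    ultimately show "tower G h (Suc j) x \<in> {1..tower_bound K (Suc j)}"
      using pair_code_le_pair_bound pair_code_ge_1 by simp
  next
    have [measurable]: "?t \<in> measurable M (count_space UNIV)"
      "(\<lambda>x. set_encode (?t ` nbrs G x)) \<in> measurable M (count_space UNIV)"
      by (rule coloring_measurable[OF Suc], rule nbr_colors_measurable[OF Suc])
    have "(\<lambda>x. pair_code (?t x) (set_encode (?t ` nbrs G x))) \<in> measurable M (count_space UNIV)"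
      by measurable
    moreover have "tower G h (Suc j) = (\<lambda>x. pair_code (?t x) (set_encode (?t ` nbrs G x)))"
      by (rule ext) simp
    ultimately show "tower G h (Suc j) \<in> measurable M (count_space UNIV)"
      by simp
  qed
qed

lemma code_fst_tower_Suc: "code_fst (tower G h (Suc j) x) = tower G h j x"
  by simp

lemma code_set_tower_Suc: "code_set (tower G h (Suc j) x) = tower G h j ` nbrs G x"
  by (simp add: finite_nbrs)

lemma code_fst_power_tower: "(code_fst ^^ i) (tower G h (j + i) x) = tower G h j x"
  by (induction i) (auto simp: funpow_swap1)

end

text \<open>The local identities of a tower, demanded only on \<open>A\<close>. They still make
  sense for levels \<open>e\<close> decoded from an arbitrary coloring, which imitates a tower on
  most balls but not everywhere.\<close>

definition consistent_on :: "'a graphing \<Rightarrow> (nat \<Rightarrow> 'a \<Rightarrow> nat) \<Rightarrow> nat \<Rightarrow> 'a set \<Rightarrow> bool" where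
  "consistent_on G e R A \<longleftrightarrow>
    (\<forall>j<R. \<forall>u\<in>A. code_fst (e (Suc j) u) = e j u \<and> code_set (e (Suc j) u) = e j ` nbrs G u)"

lemma consistent_onD:
  assumes "consistent_on G e R A" "j < R" "u \<in> A"
  shows "code_fst (e (Suc j) u) = e j u" "code_set (e (Suc j) u) = e j ` nbrs G u"
  using assms by (auto simp: consistent_on_def)

text \<open>A path from \<open>x\<close> is lifted edge by edge. Level \<open>Suc j\<close> of a
  vertex lists the level \<open>j\<close> colors of its neighbors, so each edge spends one level;
  hence the condition \<open>i + j \<le> R\<close>.\<close>

lemma consistent_match:
  assumes G: "consistent_on G e R (rel_ball (edge G) R x)"
    and H: "consistent_on H e' R (rel_ball (edge H) R y)"
    and xy: "e R x = e' R y"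
    and "i + j \<le> R" "u \<in> rel_ball (edge G) i x"
  shows "\<exists>v\<in>rel_ball (edge H) i y. e j u = e' j v"
  using assms(4,5)
proof (induction i arbitrary: j u)
  case 0
  \<comment> \<open>Downward induction from \<open>R\<close>: every level contains the one below as
    its first component.\<close>
  have "e j x = e' j y" if "j \<le> R" for j
    using that
  proof (induction rule: inc_induct)
    case (step n)
    then show ?case
      using consistent_onD(1)[OF G step(2) rel_ball_self] consistent_onD(1)[OF H step(2) rel_ball_self]
      by simp
  qed (rule xy)
  then show ?case
    using 0 by simp
next
  case (Suc i)
  show ?case
  proof (cases "u \<in> rel_ball (edge G) i x")
    case True
    then show ?thesis
      using Suc.IH[of j u] Suc.prems(1) rel_ball_Suc[of "edge H" i y] by auto
  next
    case False
    then obtain w where w: "w \<in> rel_ball (edge G) i x" "u \<in> nbrs G w"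
      using Suc.prems(2) by (auto simp: rel_ball_Suc nbrs_def)
    then obtain w' where w': "w' \<in> rel_ball (edge H) i y" "e (Suc j) w = e' (Suc j) w'"
      using Suc.IH[of "Suc j" w] Suc.prems(1) by auto
    have "w \<in> rel_ball (edge G) R x" "w' \<in> rel_ball (edge H) R y"
      using w(1) w'(1) Suc.prems(1) rel_ball_mono[of i R "edge G" x] rel_ball_mono[of i R "edge H" y]
      by auto
    then have "e j ` nbrs G w = e' j ` nbrs H w'"
      using consistent_onD(2)[OF G, of j w] consistent_onD(2)[OF H, of j w'] Suc.prems(1) w'(2) by simp
    then obtain v where v: "v \<in> nbrs H w'" "e j u = e' j v"
      using w(2) by (metis imageE imageI)
    then have "v \<in> rel_ball (edge H) (Suc i) y"
      using w'(1) by (auto simp: rel_ball_Suc nbrs_def)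
    then show ?thesis
      using v(2) by blast
  qed
qed

lemma consistent_ball_colors:
  assumes G: "consistent_on G e R (rel_ball (edge G) R x)"
    and H: "consistent_on H e' R (rel_ball (edge H) R y)"
    and xy: "e R x = e' R y"
  shows "e 0 ` rel_ball (edge G) R x = e' 0 ` rel_ball (edge H) R y"
proof (intro equalityI subsetI)
  fix a
  assume "a \<in> e 0 ` rel_ball (edge G) R x"
  then show "a \<in> e' 0 ` rel_ball (edge H) R y"
    using consistent_match[OF G H xy, of R 0] by auto
next
  fix a
  assume "a \<in> e' 0 ` rel_ball (edge H) R y"
  then show "a \<in> e 0 ` rel_ball (edge G) R x"
    using consistent_match[OF H G xy[symmetric], of R 0] by auto
qed

text \<open>Matching points of consistent towers makes the ball in \<open>G\<close> look like a covering of the one in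
  \<open>H\<close>, provided that the colors of the latter are distinct.\<close>

lemma consistent_card_le:
  assumes G: "consistent_on G e R (rel_ball (edge G) R x)"
    and H: "consistent_on H e' R (rel_ball (edge H) R y)"
    and xy: "e R x = e' R y"
    and inj: "inj_on (\<lambda>v. code_snd (e' 0 v)) (rel_ball (edge H) R y)"
    and fin: "finite (rel_ball (edge G) R x)"
  shows "card (rel_ball (edge H) R y) \<le> card (rel_ball (edge G) R x)"
proof -
  have "inj_on (e' 0) (rel_ball (edge H) R y)"
    using inj by (auto simp: inj_on_def)
  then have "card (rel_ball (edge H) R y) = card (e' 0 ` rel_ball (edge H) R y)"
    by (simp add: card_image)
  also have "\<dots> = card (e 0 ` rel_ball (edge G) R x)"
    by (simp add: consistent_ball_colors[OF G H xy])
  also have "\<dots> \<le> card (rel_ball (edge G) R x)"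
    by (rule card_image_le[OF fin])
  finally show ?thesis .
qed

text \<open>Both balls carry the same base colors. Equality of sizes then makes these colors
  injective in \<open>G\<close> as well, and matching equal base colors is the isomorphism.
  Adjacency in the ball of radius \<open>r\<close> is read from the neighbor colors of its vertices,
  and the neighbors lie in the ball of radius \<open>Suc r\<close>; this is why injectivity and one
  more level are required there.\<close>

lemma consistent_iso:
  assumes G: "consistent_on G e (Suc r) (rel_ball (edge G) (Suc r) x)"
    and H: "consistent_on H e' (Suc r) (rel_ball (edge H) (Suc r) y)"
    and xy: "e (Suc r) x = e' (Suc r) y"
    and inj': "inj_on (\<lambda>v. code_snd (e' 0 v)) (rel_ball (edge H) (Suc r) y)"
    and fin: "finite (rel_ball (edge G) (Suc r) x)"
    and card: "card (rel_ball (edge G) (Suc r) x) = card (rel_ball (edge H) (Suc r) y)"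
    and f: "\<And>u. u \<in> rel_ball (edge G) r x \<Longrightarrow> f u = code_fst (e 0 u)"
    and f': "\<And>v. v \<in> rel_ball (edge H) r y \<Longrightarrow> f' v = code_fst (e' 0 v)"
  shows "rc_iso (colored_ball r G f x) (colored_ball r H f' y)"
proof -
  let ?BG = "\<lambda>i. rel_ball (edge G) i x" and ?BH = "\<lambda>i. rel_ball (edge H) i y"
  let ?c = "\<lambda>u. code_snd (e 0 u)" and ?c' = "\<lambda>v. code_snd (e' 0 v)"
  have "?c ` ?BG (Suc r) = ?c' ` ?BH (Suc r)"
    using consistent_ball_colors[OF G H xy] by (metis image_image)
  then have inj: "inj_on ?c (?BG (Suc r))"
    using card card_image[OF inj'] fin by (intro eq_card_imp_inj_on) auto
  define \<phi> where "\<phi> u = inv_into (?BH (Suc r)) ?c' (?c u)" for u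
  have \<phi>_eqI: "\<phi> u = v" if "v \<in> ?BH (Suc r)" "e 0 u = e' 0 v" for u v
    unfolding \<phi>_def using inv_into_f_f[OF inj' that(1)] that(2) by simp
  have sub: "?BG i \<subseteq> ?BG (Suc r)" "?BH i \<subseteq> ?BH (Suc r)" if "i \<le> Suc r" for i
    using that by (intro rel_ball_mono; simp)+
  \<comment> \<open>A partner matching \<open>u\<close> at level \<open>j\<close> also matches it at
    level 0, where partners are unique, so it is \<open>\<phi> u\<close>, whatever \<open>i\<close>
    and \<open>j\<close> were.\<close>
  have \<phi>: "\<phi> u \<in> ?BH i \<and> e j u = e' j (\<phi> u)" if ij: "i + j \<le> Suc r" and u: "u \<in> ?BG i" for i j u
  proof -
    obtain v where v: "v \<in> ?BH i" "e j u = e' j v"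
      using consistent_match[OF G H xy ij u] by blast
    have "e m u = e' m v" if "m \<le> j" for m
      using that
    proof (induction rule: inc_induct)
      case (step n)
      have "n < Suc r"
        using step(2) ij by simp
      moreover have "u \<in> ?BG (Suc r)" "v \<in> ?BH (Suc r)"
        using u v(1) sub[of i] ij by auto
      ultimately show ?case
        using consistent_onD(1)[OF G, of n u] consistent_onD(1)[OF H, of n v] step(3) by simp
    qed (rule v(2))
    then have "\<phi> u = v"
      using v(1) sub(2)[of i] ij by (intro \<phi>_eqI) auto
    then show ?thesis
      using v by simp
  qed
  have bij: "bij_betw \<phi> (?BG r) (?BH r)"
    unfolding bij_betw_def
  proof
    show "inj_on \<phi> (?BG r)"
    proof (rule inj_onI)
      fix u v
      assume uv: "u \<in> ?BG r" "v \<in> ?BG r" "\<phi> u = \<phi> v"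
      then have "?c u = ?c v"
        using \<phi>[of r 0 u] \<phi>[of r 0 v] by simp
      then show "u = v"
        using inj sub(1)[of r] uv(1,2) by (auto dest: inj_onD)
    qed
    show "\<phi> ` ?BG r = ?BH r"
    proof (intro equalityI subsetI)
      fix v
      assume v: "v \<in> ?BH r"
      then obtain u where "u \<in> ?BG r" "e' 0 v = e 0 u"
        using consistent_match[OF H G xy[symmetric], of r 0 v] by auto
      then show "v \<in> \<phi> ` ?BG r"
        using \<phi>_eqI[of v u] v sub(2)[of r] by auto
    qed (use \<phi>[of r 0] in auto)
  qed
  have edges: "(u, v) \<in> edge G \<longleftrightarrow> (\<phi> u, \<phi> v) \<in> edge H" if uv: "u \<in> ?BG r" "v \<in> ?BG r" for u v
  proof -
    have u: "\<phi> u \<in> ?BH r" "e 1 u = e' 1 (\<phi> u)" "u \<in> ?BG (Suc r)" "\<phi> u \<in> ?BH (Suc r)"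
      and v: "\<phi> v \<in> ?BH r" "e 0 v = e' 0 (\<phi> v)" "v \<in> ?BG (Suc r)" "\<phi> v \<in> ?BH (Suc r)"
      using \<phi>[of r 1 u] \<phi>[of r 0 v] uv sub[of r] by auto
    have nbrs: "e 0 ` nbrs G u = e' 0 ` nbrs H (\<phi> u)"
      using consistent_onD(2)[OF G, of 0 u] consistent_onD(2)[OF H, of 0 "\<phi> u"] u by simp
    show ?thesis
    proof
      assume "(u, v) \<in> edge G"
      then have "e 0 v \<in> e 0 ` nbrs G u"
        by (simp add: nbrs_def)
      then obtain w where w: "w \<in> nbrs H (\<phi> u)" "e 0 v = e' 0 w"
        unfolding nbrs by auto
      moreover have "w \<in> ?BH (Suc r)"
        using w(1) u(1) by (auto simp: rel_ball_Suc nbrs_def)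
      ultimately have "\<phi> v = w"
        by (intro \<phi>_eqI)
      then show "(\<phi> u, \<phi> v) \<in> edge H"
        using w(1) by (simp add: nbrs_def)
    next
      assume "(\<phi> u, \<phi> v) \<in> edge H"
      then have "e 0 v \<in> e' 0 ` nbrs H (\<phi> u)"
        using v(2) by (simp add: nbrs_def)
      then obtain w where w: "w \<in> nbrs G u" "e 0 v = e 0 w"
        unfolding nbrs[symmetric] by auto
      moreover have "w \<in> ?BG (Suc r)"
        using w(1) uv(1) by (auto simp: rel_ball_Suc nbrs_def)
      ultimately have "v = w"
        using inj_onD[OF inj _ v(3), of w] by simp
      then show "(u, v) \<in> edge G"
        using w(1) by (simp add: nbrs_def)
    qed
  qed
  have "\<phi> x = y"
    using \<phi>[of 0 0 x] by simp
  moreover have "f' (\<phi> u) = f u" if "u \<in> ?BG r" for u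
    using \<phi>[of r 0 u] f[of u] f'[of "\<phi> u"] that by simp
  moreover have "\<phi> u \<in> ?BH r" if "u \<in> ?BG r" for u
    using bij_betwE[OF bij] that by blast
  ultimately show ?thesis
    unfolding rc_iso_def using bij edges
    by (intro exI[of _ \<phi>]) (auto simp: colored_ball_def graphing_ball_eq)
qed

section \<open>Stars and cherries\<close>

lemma rel_ball_trans:
  assumes "y \<in> rel_ball E r x" "z \<in> rel_ball E s y"
  shows "z \<in> rel_ball E (r + s) x"
proof -
  obtain i j where "i \<le> r" "(x, y) \<in> E ^^ i" "j \<le> s" "(y, z) \<in> E ^^ j"
    using assms by (auto simp: rel_ball_def)
  then have "(x, z) \<in> E ^^ (i + j)" "i + j \<le> r + s"
    by (auto simp: relpow_add)
  then show ?thesis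
    unfolding rel_ball_def by blast
qed

lemma star_at_eqI:
  assumes "f x = f' y" "bij_betw \<phi> (nbrs G x) (nbrs H y)" "\<And>v. v \<in> nbrs G x \<Longrightarrow> f' (\<phi> v) = f v"
  shows "star_at k G f x = star_at k H f' y"
proof -
  have "card {v \<in> nbrs G x. f v = j} = card {w \<in> nbrs H y. f' w = j}" for j
  proof (rule bij_betw_same_card[of \<phi>])
    show "bij_betw \<phi> {v \<in> nbrs G x. f v = j} {w \<in> nbrs H y. f' w = j}"
    proof (rule bij_betw_subset[OF assms(2)])
      show "\<phi> ` {v \<in> nbrs G x. f v = j} = {w \<in> nbrs H y. f' w = j}"
        unfolding bij_betw_imp_surj_on[OF assms(2), symmetric] using assms(3) by auto
    qed auto
  qed
  then show ?thesis
    using assms(1) by (simp add: star_at_def)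
qed

text \<open>Equal stars have color classes of neighbors of equal size, and bijections between the
  classes are glued. The classes for \<open>{1..k}\<close> exhaust the neighbors because
  \<open>f\<close> and \<open>f'\<close> are \<open>k\<close>-colorings.\<close>

lemma star_at_eqD:
  assumes G: "is_graphing d G" and H: "is_graphing d H"
    and f: "f \<in> colorings k G" and f': "f' \<in> colorings k H"
    and eq: "star_at k G f x = star_at k H f' y"
  shows "\<exists>\<phi>. f x = f' y \<and> bij_betw \<phi> (nbrs G x) (nbrs H y) \<and> (\<forall>v\<in>nbrs G x. f' (\<phi> v) = f v)"
proof -
  interpret G: bounded_graphing d G
    by unfold_locales (rule G)
  interpret H: bounded_graphing d H
    by unfold_locales (rule H)
  let ?A = "\<lambda>j. {v \<in> nbrs G x. f v = j}" and ?B = "\<lambda>j. {w \<in> nbrs H y. f' w = j}"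
  have "card (?A j) = card (?B j)" if "j \<in> {1..k}" for j
    using eq that by (auto simp: star_at_def map_eq_conv simp del: upt_Suc)
  moreover have "finite (?A j)" "finite (?B j)" for j
    using G.finite_nbrs[of x] H.finite_nbrs[of y] by auto
  ultimately have "\<exists>\<phi>. bij_betw \<phi> (?A j) (?B j)" if "j \<in> {1..k}" for j
    using finite_same_card_bij[of "?A j" "?B j"] that by blast
  then obtain \<phi> where \<phi>: "\<And>j. j \<in> {1..k} \<Longrightarrow> bij_betw (\<phi> j) (?A j) (?B j)"
    by metis
  have rf: "f v \<in> {1..k}" if "v \<in> nbrs G x" for v
    using G.coloring_range[OF f] G.nbrs_subset[of x] that by blast
  have rf': "f' w \<in> {1..k}" if "w \<in> nbrs H y" for w
    using H.coloring_range[OF f'] H.nbrs_subset[of y] that by blast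
  let ?\<psi> = "\<lambda>v. \<phi> (f v) v"
  have img: "?\<psi> v \<in> ?B (f v)" if "v \<in> nbrs G x" for v
    using bij_betwE[OF \<phi>[OF rf[OF that]]] that by blast
  have "bij_betw ?\<psi> (nbrs G x) (nbrs H y)"
    unfolding bij_betw_def
  proof
    show "inj_on ?\<psi> (nbrs G x)"
    proof (rule inj_onI)
      fix u v
      assume uv: "u \<in> nbrs G x" "v \<in> nbrs G x" "?\<psi> u = ?\<psi> v"
      then have "f u = f v"
        using img[of u] img[of v] by simp
      then show "u = v"
        using uv bij_betw_imp_inj_on[OF \<phi>[OF rf[OF uv(1)]]] by (auto dest: inj_onD)
    qed
    show "?\<psi> ` nbrs G x = nbrs H y"
    proof (intro equalityI subsetI)
      fix w
      assume w: "w \<in> nbrs H y"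
      then obtain v where "v \<in> nbrs G x" "f v = f' w" "w = \<phi> (f' w) v"
        using bij_betw_imp_surj_on[OF \<phi>[OF rf'[OF w]]] by blast
      then show "w \<in> ?\<psi> ` nbrs G x"
        by (intro image_eqI[of _ _ v]) auto
    qed (use img in auto)
  qed
  moreover have "f x = f' y"
    using eq by (simp add: star_at_def)
  ultimately show ?thesis
    using img by (intro exI[of _ ?\<psi>]) auto
qed

lemma star_at_eq_nbr_colors:
  assumes "is_graphing d G" "is_graphing d H" "f \<in> colorings k G" "f' \<in> colorings k H"
    and "star_at k G f x = star_at k H f' y"
  shows "f x = f' y" "f ` nbrs G x = f' ` nbrs H y"
proof -
  obtain \<phi> where \<phi>: "f x = f' y" "bij_betw \<phi> (nbrs G x) (nbrs H y)"
    "\<And>v. v \<in> nbrs G x \<Longrightarrow> f' (\<phi> v) = f v"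
    using star_at_eqD[OF assms] by blast
  show "f x = f' y"
    by (rule \<phi>(1))
  have "f' ` nbrs H y = f' ` \<phi> ` nbrs G x"
    using \<phi>(2) by (simp add: bij_betw_def)
  also have "\<dots> = f ` nbrs G x"
    using \<phi>(3) by (simp add: image_image)
  finally show "f ` nbrs G x = f' ` nbrs H y" ..
qed

text \<open>The minimum merges the three cases of \<open>cherry_at\<close>: below degree 2 the whole
  neighborhood is the only leaf set.\<close>

definition leaf_sets :: "'a graphing \<Rightarrow> 'a \<Rightarrow> 'a set set" where
  "leaf_sets G x = {P. P \<subseteq> nbrs G x \<and> card P = min 2 (card (nbrs G x))}"

section \<open>Types of cherries, stars and balls at a vertex\<close>

context bounded_graphing
begin

lemma finite_leaf_sets: "finite (leaf_sets G x)" and leaf_sets_nonempty: "leaf_sets G x \<noteq> {}"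
proof -
  have "leaf_sets G x \<subseteq> Pow (nbrs G x)"
    by (auto simp: leaf_sets_def)
  then show "finite (leaf_sets G x)"
    using finite_nbrs by (meson finite_Pow_iff finite_subset)
  obtain P where "P \<subseteq> nbrs G x" "card P = min 2 (card (nbrs G x))"
    using obtain_subset_with_card_n[of "min 2 (card (nbrs G x))" "nbrs G x"] by auto
  then show "leaf_sets G x \<noteq> {}"
    by (auto simp: leaf_sets_def)
qed

lemma card_leaf_sets_le: "card (leaf_sets G x) \<le> 2 ^ d"
proof -
  have "card (leaf_sets G x) \<le> card (Pow (nbrs G x))"
    using finite_nbrs by (intro card_mono) (auto simp: leaf_sets_def)
  also have "\<dots> \<le> 2 ^ d"
    using card_nbrs_le by (simp add: card_Pow finite_nbrs power_increasing)
  finally show ?thesis .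
qed

lemma cherry_at_eq:
  "cherry_at G f x = map_pmf (\<lambda>P. iso_class (star_graph x P f)) (pmf_of_set (leaf_sets G x))"
proof -
  have eq: "P = nbrs G x" if "P \<subseteq> nbrs G x" "card P = card (nbrs G x)" for P
    using card_subset_eq[OF finite_nbrs that] .
  consider "card (nbrs G x) = 0" | "card (nbrs G x) = 1" | "card (nbrs G x) \<ge> 2"
    by linarith
  then show ?thesis
  proof cases
    case 1
    then have "leaf_sets G x = {{}}"
      using finite_nbrs[of x] by (auto simp: leaf_sets_def)
    then show ?thesis
      using 1 by (simp add: cherry_at_def pmf_of_set_singleton)
  next
    case 2
    then have "leaf_sets G x = {nbrs G x}"
      using eq by (auto simp: leaf_sets_def)
    then show ?thesis
      using 2 by (simp add: cherry_at_def pmf_of_set_singleton)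
  next
    case 3
    then have "leaf_sets G x = {P. P \<subseteq> nbrs G x \<and> card P = 2}"
      by (simp add: leaf_sets_def)
    then show ?thesis
      using 3 by (simp add: cherry_at_def)
  qed
qed

lemma set_cherry_at: "set_pmf (cherry_at G f x) = (\<lambda>P. iso_class (star_graph x P f)) ` leaf_sets G x"
  by (simp add: cherry_at_eq set_pmf_of_set finite_leaf_sets leaf_sets_nonempty)

text \<open>There are at most \<open>2 ^ d\<close> leaf sets, all equally likely. A cherry that can
  occur at a vertex is thus never negligible, so the statistics control the measure of the vertices
  where a wrong one is possible.\<close>

lemma pmf_cherry_at_ge:
  assumes "\<alpha> \<in> set_pmf (cherry_at G f x)"
  shows "1 / 2 ^ d \<le> pmf (cherry_at G f x) \<alpha>"
proof -
  obtain P where P: "P \<in> leaf_sets G x" "\<alpha> = iso_class (star_graph x P f)"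
    using assms by (auto simp: set_cherry_at)
  have "card (leaf_sets G x) > 0"
    using finite_leaf_sets leaf_sets_nonempty by (simp add: card_gt_0_iff)
  moreover have "real (card (leaf_sets G x)) \<le> real (2 ^ d)"
    by (rule of_nat_mono[OF card_leaf_sets_le])
  ultimately have "1 / 2 ^ d \<le> 1 / real (card (leaf_sets G x))"
    by (intro divide_left_mono) auto
  also have "\<dots> = pmf (pmf_of_set (leaf_sets G x)) P"
    using P(1) by (simp add: finite_leaf_sets leaf_sets_nonempty)
  also have "\<dots> \<le> measure (pmf_of_set (leaf_sets G x)) ((\<lambda>P. iso_class (star_graph x P f)) -` {\<alpha>})"
    unfolding pmf.rep_eq using P(2) by (intro measure_pmf.finite_measure_mono) auto
  also have "\<dots> = pmf (cherry_at G f x) \<alpha>"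
    by (simp add: cherry_at_eq pmf_map)
  finally show ?thesis .
qed

lemma cherry_at_in_types:
  assumes f: "f \<in> colorings k G" and x: "x \<in> X"
  shows "set_pmf (cherry_at G f x) \<subseteq> cherry_types k"
proof -
  have "iso_class (star_graph x P f) \<in> cherry_types k" if "P \<in> leaf_sets G x" for P
  proof (rule iso_class_star_graph_in_cherry_types)
    have P: "P \<subseteq> nbrs G x" "card P \<le> 2"
      using that by (auto simp: leaf_sets_def)
    show "finite P" "card P \<le> 2" "x \<notin> P"
      using P finite_nbrs not_in_nbrs by (auto dest: finite_subset)
    show "f v \<in> {1..k}" if "v \<in> insert x P" for v
      using that x P(1) nbrs_subset[of x] by (intro coloring_range[OF f]) auto
  qed
  then show ?thesis
    by (auto simp: set_cherry_at)
qed

lemma star_at_in_types: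
  assumes f: "f \<in> colorings k G" and x: "x \<in> X"
  shows "star_at k G f x \<in> star_types d k"
proof -
  have "sum_list (map (\<lambda>j. card {y \<in> nbrs G x. f y = j}) [1..<Suc k])
    = (\<Sum>j\<in>{1..k}. card {y \<in> nbrs G x. f y = j})"
    by (simp add: interv_sum_list_conv_sum_set_nat atLeastLessThanSuc_atLeastAtMost del: upt_Suc)
  also have "\<dots> = card (\<Union>j\<in>{1..k}. {y \<in> nbrs G x. f y = j})"
    using finite_nbrs[of x] by (subst card_UN_disjoint) auto
  also have "\<dots> \<le> card (nbrs G x)"
    using finite_nbrs[of x] by (intro card_mono) auto
  also have "\<dots> \<le> d"
    by (rule card_nbrs_le)
  finally show ?thesis
    using coloring_range[OF f x] by (simp add: star_types_def star_at_def del: upt_Suc)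
qed

lemma star_stat_eq_law: "star_stat k G f = law M (star_at k G f)"
  by (simp add: fun_eq_iff star_stat_def law_def)

lemma ball_stat_eq_law: "ball_stat r G f = law M (\<lambda>x. iso_class (colored_ball r G f x))"
  by (simp add: fun_eq_iff ball_stat_def law_def)

lemma is_rcgraph_colored_ball: "x \<in> X \<Longrightarrow> is_rcgraph (colored_ball r G f x)"
  using edge_sym edge_irrefl finite_ball[of x r] rel_ball_self[of x E r]
  by (auto simp: is_rcgraph_def colored_ball_def graphing_ball_eq sym_def irrefl_def)

lemma colored_ball_in_types:
  assumes f: "f \<in> colorings k G" and x: "x \<in> X"
  shows "iso_class (colored_ball r G f x) \<in> ball_types d k r"
proof -
  let ?H = "colored_ball r G f x"
  have V: "rverts ?H = rel_ball E r x" and Eh: "redges ?H = E \<inter> rel_ball E r x \<times> rel_ball E r x"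
    by (simp_all add: colored_ball_def graphing_ball_eq)
  obtain K :: "nat rcgraph" where K: "is_rcgraph K" "rc_iso ?H K"
    using ex_nat_copy[OF is_rcgraph_colored_ball[OF x]] by metis
  obtain \<phi> where \<phi>: "bij_betw \<phi> (rverts ?H) (rverts K)"
    "\<And>u v. u \<in> rverts ?H \<Longrightarrow> v \<in> rverts ?H \<Longrightarrow> (u, v) \<in> redges ?H \<longleftrightarrow> (\<phi> u, \<phi> v) \<in> redges K"
    "\<phi> (rroot ?H) = rroot K" "\<And>v. v \<in> rverts ?H \<Longrightarrow> rcol K (\<phi> v) = rcol ?H v"
    using K(2) unfolding rc_iso_def by blast
  have ex: "\<exists>u\<in>rverts ?H. v = \<phi> u" if "v \<in> rverts K" for v
    using bij_betw_imp_surj_on[OF \<phi>(1)] that by blast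
  have "rcol K v \<in> {1..k}" if v: "v \<in> rverts K" for v
  proof -
    obtain u where u: "u \<in> rverts ?H" "v = \<phi> u"
      using ex[OF v] by blast
    then have "rcol K v = f u"
      using \<phi>(4)[OF u(1)] by (simp add: colored_ball_def)
    then show ?thesis
      using u(1) ball_subset[OF x] coloring_range[OF f] V by auto
  qed
  moreover have "card {w. (v, w) \<in> redges K} \<le> d" if v: "v \<in> rverts K" for v
  proof -
    obtain u where u: "u \<in> rverts ?H" "v = \<phi> u"
      using ex[OF v] by blast
    have "{w. (v, w) \<in> redges K} \<subseteq> \<phi> ` nbrs G u"
    proof
      fix w
      assume w: "w \<in> {w. (v, w) \<in> redges K}"
      then have "w \<in> rverts K"
        using K(1) by (auto simp: is_rcgraph_def)
      then obtain u' where u': "u' \<in> rverts ?H" "w = \<phi> u'"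
        using ex by blast
      then have "(u, u') \<in> redges ?H"
        using \<phi>(2)[OF u(1) u'(1)] w u(2) by simp
      then show "w \<in> \<phi> ` nbrs G u"
        using u'(2) by (auto simp: Eh nbrs_def)
    qed
    then have "card {w. (v, w) \<in> redges K} \<le> card (nbrs G u)"
      by (rule surj_card_le[OF finite_nbrs])
    then show ?thesis
      using card_nbrs_le[of u] by simp
  qed
  moreover have "\<exists>i\<le>r. (rroot K, v) \<in> redges K ^^ i" if v: "v \<in> rverts K" for v
  proof -
    obtain u where u: "u \<in> rverts ?H" "v = \<phi> u"
      using ex[OF v] by blast
    then obtain i where i: "i \<le> r" "(x, u) \<in> E ^^ i"
      by (auto simp: V rel_ball_def)
    \<comment> \<open>Every initial segment of a path of length at most \<open>r\<close> stays in
      the ball, so the path survives in the induced subgraph and can be carried over by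
      \<open>\<phi>\<close>.\<close>
    have "(rroot K, \<phi> w) \<in> redges K ^^ j" if "j \<le> r" "(x, w) \<in> E ^^ j" for j w
      using that
    proof (induction j arbitrary: w)
      case 0
      then show ?case
        using \<phi>(3) by (simp add: colored_ball_def)
    next
      case (Suc j)
      then obtain z where z: "(x, z) \<in> E ^^ j" "(z, w) \<in> E"
        by auto
      have zw: "z \<in> rel_ball E r x" "w \<in> rel_ball E r x"
        using Suc.prems z(1) Suc_leD[OF Suc.prems(1)] unfolding rel_ball_def by blast+
      then have "(\<phi> z, \<phi> w) \<in> redges K"
        using \<phi>(2)[of z w] z(2) by (simp add: V Eh)
      then show ?case
        using Suc.IH[of z] z(1) Suc.prems(1) by auto
    qed
    then show ?thesis
      using i u(2) by blast
  qed
  ultimately have "iso_class K \<in> ball_types d k r"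
    unfolding ball_types_def using K(1) by blast
  then show ?thesis
    using iso_class_eqI[OF K(2)] is_rcgraph_colored_ball[OF x] by (simp add: is_rcgraph_def)
qed

end

section \<open>Each statistic as a function of a finer one\<close>

lemma cherry_at_eqI:
  assumes G: "is_graphing d G" and H: "is_graphing d H"
    and f: "f x = f' y" and \<phi>: "bij_betw \<phi> (nbrs G x) (nbrs H y)"
    and col: "\<And>v. v \<in> nbrs G x \<Longrightarrow> f' (\<phi> v) = f v"
  shows "cherry_at G f x = cherry_at H f' y"
proof -
  interpret G: bounded_graphing d G
    by unfold_locales (rule G)
  interpret H: bounded_graphing d H
    by unfold_locales (rule H)
  have sub: "bij_betw \<phi> P (\<phi> ` P)" if "P \<subseteq> nbrs G x" for P
    by (rule bij_betw_subset[OF \<phi> that refl])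
  have inj: "inj_on ((`) \<phi>) (leaf_sets G x)"
    using bij_betw_imp_inj_on[OF \<phi>]
    by (intro inj_onI) (auto simp: leaf_sets_def inj_on_image_eq_iff)
  have "(`) \<phi> ` leaf_sets G x = leaf_sets H y"
  proof (intro equalityI subsetI)
    fix Q
    assume "Q \<in> (`) \<phi> ` leaf_sets G x"
    then obtain P where P: "P \<subseteq> nbrs G x" "card P = min 2 (card (nbrs G x))" "Q = \<phi> ` P"
      by (auto simp: leaf_sets_def)
    then show "Q \<in> leaf_sets H y"
      using bij_betw_same_card[OF sub[OF P(1)]] bij_betw_same_card[OF \<phi>] bij_betw_imp_surj_on[OF \<phi>]
      by (auto simp: leaf_sets_def)
  next
    fix Q
    assume Q: "Q \<in> leaf_sets H y"
    then have "Q \<subseteq> \<phi> ` nbrs G x"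
      using bij_betw_imp_surj_on[OF \<phi>] by (auto simp: leaf_sets_def)
    then obtain P where P: "P \<subseteq> nbrs G x" "Q = \<phi> ` P"
      by (meson subset_imageE)
    then have "P \<in> leaf_sets G x"
      using Q bij_betw_same_card[OF sub[OF P(1)]] bij_betw_same_card[OF \<phi>] by (auto simp: leaf_sets_def)
    then show "Q \<in> (`) \<phi> ` leaf_sets G x"
      using P(2) by blast
  qed
  \<comment> \<open>A bijection between the families of leaf sets carries one uniform distribution
    to the other.\<close>
  then have "pmf_of_set (leaf_sets H y) = map_pmf ((`) \<phi>) (pmf_of_set (leaf_sets G x))"
    using map_pmf_of_set_inj[OF inj G.leaf_sets_nonempty G.finite_leaf_sets] by simp
  then have "cherry_at H f' y =
    map_pmf (\<lambda>P. iso_class (star_graph y (\<phi> ` P) f')) (pmf_of_set (leaf_sets G x))"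
    by (simp add: H.cherry_at_eq map_pmf_comp)
  also have "\<dots> = map_pmf (\<lambda>P. iso_class (star_graph x P f)) (pmf_of_set (leaf_sets G x))"
  proof (rule map_pmf_cong[OF refl])
    fix P
    assume "P \<in> set_pmf (pmf_of_set (leaf_sets G x))"
    then have P: "P \<subseteq> nbrs G x"
      by (simp add: set_pmf_of_set G.finite_leaf_sets G.leaf_sets_nonempty) (simp add: leaf_sets_def)
    have "\<phi> ` P \<subseteq> nbrs H y"
      using P bij_betw_imp_surj_on[OF \<phi>] by blast
    then have "rc_iso (star_graph x P f) (star_graph y (\<phi> ` P) f')"
      using P f col G.not_in_nbrs H.not_in_nbrs by (intro rc_iso_star_graphI[OF sub[OF P]]) auto
    then show "iso_class (star_graph y (\<phi> ` P) f') = iso_class (star_graph x P f)"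
      by (intro iso_class_eqI[symmetric]) (simp_all add: star_graph_def)
  qed
  finally show ?thesis
    by (simp add: G.cherry_at_eq)
qed

text \<open>Applied to triples of a graphing, a coloring and a vertex, which yields one function
  \<kappa> valid for all graphings at once. Uniformity in the index of the sequence depends on
  this.\<close>

lemma ex_factor:
  assumes "\<And>p q. P p \<Longrightarrow> P q \<Longrightarrow> t p = t q \<Longrightarrow> w p = w q"
  shows "\<exists>\<kappa>. \<forall>p. P p \<longrightarrow> w p = \<kappa> (t p)"
proof (intro exI allI impI)
  fix p
  assume p: "P p"
  then have "P (SOME q. P q \<and> t q = t p) \<and> t (SOME q. P q \<and> t q = t p) = t p"
    by (intro someI[of "\<lambda>q. P q \<and> t q = t p" p]) simp
  then show "w p = (\<lambda>s. w (SOME q. P q \<and> t q = s)) (t p)"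
    using assms p by metis
qed

lemma cherry_at_factor:
  "\<exists>\<kappa>. \<forall>(G :: 'a graphing) f x. is_graphing d G \<longrightarrow> f \<in> colorings k G \<longrightarrow>
    cherry_at G f x = \<kappa> (star_at k G f x)"
proof -
  let ?P = "\<lambda>(G :: 'a graphing, f, x). is_graphing d G \<and> f \<in> colorings k G"
  have "(\<lambda>(G, f, x). cherry_at G f x) p = (\<lambda>(G, f, x). cherry_at G f x) q"
    if "?P p" "?P q" "(\<lambda>(G, f, x). star_at k G f x) p = (\<lambda>(G, f, x). star_at k G f x) q" for p q
  proof -
    obtain G f x H f' y where pq: "p = (G, f, x)" "q = (H, f', y)"
      by (metis prod_cases3)
    then have a: "is_graphing d G" "is_graphing d H" "f \<in> colorings k G" "f' \<in> colorings k H"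
      "star_at k G f x = star_at k H f' y"
      using that by auto
    obtain \<phi> where "f x = f' y" "bij_betw \<phi> (nbrs G x) (nbrs H y)"
      "\<And>v. v \<in> nbrs G x \<Longrightarrow> f' (\<phi> v) = f v"
      using star_at_eqD[OF a] by blast
    then show ?thesis
      using cherry_at_eqI[OF a(1,2)] pq by simp
  qed
  from ex_factor[of ?P "\<lambda>(G, f, x). star_at k G f x" "\<lambda>(G, f, x). cherry_at G f x", OF this]
  obtain \<kappa> where \<kappa>: "\<forall>p. ?P p \<longrightarrow> (\<lambda>(G, f, x). cherry_at G f x) p = \<kappa> ((\<lambda>(G, f, x). star_at k G f x) p)"
    by blast
  show ?thesis
    by (rule exI[of _ \<kappa>]) (use \<kappa> in fastforce)
qed

lemma star_at_factor:
  "\<exists>\<kappa>. \<forall>(G :: 'a graphing) f x. is_graphing d G \<longrightarrow> x \<in> space (vmeas G) \<longrightarrow>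
    star_at k G f x = \<kappa> (iso_class (colored_ball 1 G f x))"
proof -
  let ?P = "\<lambda>(G :: 'a graphing, f :: 'a \<Rightarrow> nat, x). is_graphing d G \<and> x \<in> space (vmeas G)"
  have "(\<lambda>(G, f, x). star_at k G f x) p = (\<lambda>(G, f, x). star_at k G f x) q"
    if "?P p" "?P q" "(\<lambda>(G, f, x). iso_class (colored_ball 1 G f x)) p
      = (\<lambda>(G, f, x). iso_class (colored_ball 1 G f x)) q" for p q
  proof -
    obtain G f x H f' y where pq: "p = (G, f, x)" "q = (H, f', y)"
      by (metis prod_cases3)
    then have a: "is_graphing d G" "is_graphing d H" "x \<in> space (vmeas G)" "y \<in> space (vmeas H)"
      "iso_class (colored_ball 1 G f x) = iso_class (colored_ball 1 H f' y)"
      using that by auto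
    interpret G: bounded_graphing d G
      by unfold_locales (rule a)
    interpret H: bounded_graphing d H
      by unfold_locales (rule a)
    have "rc_iso (colored_ball 1 G f x) (colored_ball 1 H f' y)"
      using a(5) iso_class_eq_iff[OF G.is_rcgraph_colored_ball[OF a(3)] H.is_rcgraph_colored_ball[OF a(4)]]
      by blast
    moreover have ball: "rel_ball (edge L) 1 z = insert z (nbrs L z)" for L :: "'a graphing" and z
      using rel_ball_Suc[of "edge L" 0 z] by (simp add: nbrs_eq)
    ultimately obtain \<phi> where \<phi>: "bij_betw \<phi> (insert x (nbrs G x)) (insert y (nbrs H y))" "\<phi> x = y"
      "\<And>v. v \<in> insert x (nbrs G x) \<Longrightarrow> f' (\<phi> v) = f v"
      unfolding rc_iso_def colored_ball_def graphing_ball_eq rcgraph.simps ball by blast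
    have "bij_betw \<phi> (nbrs G x) (nbrs H y)"
      using notIn_Un_bij_betw3[of x "nbrs G x" \<phi> "nbrs H y"] \<phi>(1,2) G.not_in_nbrs H.not_in_nbrs by simp
    then have "star_at k G f x = star_at k H f' y"
      using \<phi> by (intro star_at_eqI) auto
    then show ?thesis
      by (simp add: pq)
  qed
  from ex_factor[of ?P "\<lambda>(G, f, x). iso_class (colored_ball 1 G f x)" "\<lambda>(G, f, x). star_at k G f x", OF this]
  obtain \<kappa> where \<kappa>: "\<forall>p. ?P p \<longrightarrow> (\<lambda>(G, f, x). star_at k G f x) p
      = \<kappa> ((\<lambda>(G, f, x). iso_class (colored_ball 1 G f x)) p)"
    by blast
  show ?thesis
    by (rule exI[of _ \<kappa>]) (use \<kappa> in fastforce)
qed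

lemma weighted_diff_le_tv_dist:
  assumes "finite \<Omega>" "A \<subseteq> \<Omega>" "\<And>\<alpha>. \<bar>w \<alpha>\<bar> \<le> 1"
  shows "\<bar>(\<Sum>\<alpha>\<in>A. w \<alpha> * p \<alpha>) - (\<Sum>\<alpha>\<in>A. w \<alpha> * q \<alpha>)\<bar> \<le> 2 * tv_dist \<Omega> p q"
proof -
  have "\<bar>(\<Sum>\<alpha>\<in>A. w \<alpha> * p \<alpha>) - (\<Sum>\<alpha>\<in>A. w \<alpha> * q \<alpha>)\<bar> = \<bar>\<Sum>\<alpha>\<in>A. w \<alpha> * (p \<alpha> - q \<alpha>)\<bar>"
    by (simp add: sum_subtractf algebra_simps)
  also have "\<dots> \<le> (\<Sum>\<alpha>\<in>A. \<bar>w \<alpha> * (p \<alpha> - q \<alpha>)\<bar>)"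
    by (rule sum_abs)
  also have "\<dots> \<le> (\<Sum>\<alpha>\<in>A. \<bar>p \<alpha> - q \<alpha>\<bar>)"
    using assms(3) by (intro sum_mono) (simp add: abs_mult mult_left_le_one_le)
  also have "\<dots> \<le> 2 * tv_dist \<Omega> p q"
    by (rule sum_diff_le_tv_dist[OF assms(1,2)])
  finally show ?thesis .
qed

text \<open>The coefficients do not depend on \<open>n\<close> or \<open>f\<close>, so the passage
  from \<open>P\<close> to \<open>Q\<close> is one linear map, Lipschitz with a constant that
  depends only on \<open>\<Omega>'\<close>.\<close>

lemma tv_cauchy_contract:
  assumes fin: "finite \<Omega>" "finite \<Omega>'"
    and Q: "\<And>n f \<beta>. n \<ge> 1 \<Longrightarrow> f \<in> F n \<Longrightarrow> \<beta> \<in> \<Omega>' \<Longrightarrow> Q n f \<beta> = (\<Sum>\<alpha>\<in>\<Omega>. \<kappa> \<alpha> \<beta> * P n f \<alpha>)"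
    and \<kappa>: "\<And>\<alpha> \<beta>. \<bar>\<kappa> \<alpha> \<beta>\<bar> \<le> 1"
    and cauchy: "tv_cauchy \<Omega> (\<lambda>n. P n ` F n)"
  shows "tv_cauchy \<Omega>' (\<lambda>n. Q n ` F n)"
  unfolding tv_cauchy_def
proof (intro allI impI)
  fix e :: real
  assume e: "e > 0"
  define \<delta> where "\<delta> = e / (2 * (real (card \<Omega>') + 1))"
  have \<delta>: "\<delta> > 0" "(real (card \<Omega>') + 1) * (2 * \<delta>) = e"
    using e by (auto simp: \<delta>_def add_pos_nonneg field_simps)
  obtain N where N: "\<forall>m\<ge>N. \<forall>n\<ge>N. \<forall>p\<in>P m ` F m. \<exists>q\<in>P n ` F n. tv_dist \<Omega> p q < \<delta>" "N \<ge> 1"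
    using \<delta>(1) by (rule tv_cauchyD[OF cauchy])
  show "\<exists>N. \<forall>m\<ge>N. \<forall>n\<ge>N. \<forall>p\<in>Q m ` F m. \<exists>q\<in>Q n ` F n. tv_dist \<Omega>' p q < e"
  proof (intro exI[of _ N] allI impI ballI)
    fix m n p
    assume mn: "m \<ge> N" "n \<ge> N" and "p \<in> Q m ` F m"
    then obtain f where f: "f \<in> F m" "p = Q m f"
      by blast
    obtain f' where f': "f' \<in> F n" "tv_dist \<Omega> (P m f) (P n f') < \<delta>"
      using N(1) mn f(1) by blast
    have "\<bar>Q m f \<beta> - Q n f' \<beta>\<bar> \<le> 2 * \<delta>" if "\<beta> \<in> \<Omega>'" for \<beta>
      using weighted_diff_le_tv_dist[OF fin(1) subset_refl, of "\<lambda>\<alpha>. \<kappa> \<alpha> \<beta>" "P m f" "P n f'"] \<kappa> f'(2)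
        Q[of m f \<beta>] Q[of n f' \<beta>] mn N(2) f(1) f'(1) that by simp
    then have "tv_dist \<Omega>' p (Q n f') \<le> real (card \<Omega>') * (2 * \<delta>)"
      unfolding f(2) by (rule tv_dist_le[OF fin(2)])
    also have "\<dots> < (real (card \<Omega>') + 1) * (2 * \<delta>)"
      using \<delta>(1) by (intro mult_strict_right_mono) auto
    finally show "\<exists>q\<in>Q n ` F n. tv_dist \<Omega>' p q < e"
      using f'(1) \<delta>(2) by auto
  qed
qed

text \<open>Any representative will do, since isomorphisms preserve the color of the root. This lets
  the law of a coloring be read off from its cherry statistics.\<close>

definition root_color :: "nat rcgraph set \<Rightarrow> nat" where
  "root_color \<alpha> = (let K = SOME K. K \<in> \<alpha> in rcol K (rroot K))"

lemma root_color_iso_class: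
  assumes "is_rcgraph H"
  shows "root_color (iso_class H) = rcol H (rroot H)"
proof -
  obtain L :: "nat rcgraph" where "is_rcgraph L" "rc_iso H L"
    using ex_nat_copy[OF assms] by metis
  then have "(SOME K. K \<in> iso_class H) \<in> iso_class H"
    by (intro someI[of "\<lambda>K. K \<in> iso_class H" L]) (simp add: iso_class_def)
  then have "rc_iso H (SOME K. K \<in> iso_class H)" (is "rc_iso H ?K")
    unfolding iso_class_def by blast
  then obtain \<phi> where "\<phi> (rroot H) = rroot ?K" "\<forall>v\<in>rverts H. rcol ?K (\<phi> v) = rcol H v"
    unfolding rc_iso_def by blast
  then have "rcol ?K (rroot ?K) = rcol H (rroot H)"
    using assms unfolding is_rcgraph_def by metis
  then show ?thesis
    by (simp only: root_color_def Let_def)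
qed

section \<open>Cherry statistics as expectations, and the law of a coloring\<close>

context bounded_graphing
begin

lemma cherry_at_measurable:
  assumes f: "f \<in> colorings k G"
  shows "cherry_at G f \<in> measurable M (count_space UNIV)"
proof -
  obtain \<kappa> where \<kappa>: "\<forall>(H :: 'a graphing) f x. is_graphing d H \<longrightarrow> f \<in> colorings k H \<longrightarrow>
      cherry_at H f x = \<kappa> (star_at k H f x)"
    using cherry_at_factor[of d k] by (elim exE) (rule that)
  have "(\<lambda>x. \<kappa> (star_at k G f x)) \<in> measurable M (count_space UNIV)"
    by (rule measurable_compose[OF star_at_measurable[OF f]]) simp
  moreover have "cherry_at G f = (\<lambda>x. \<kappa> (star_at k G f x))"
    using \<kappa> is_graphing f by auto
  ultimately show ?thesis
    by simp
qed

lemma cherry_stat_kernel: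
  assumes f: "f \<in> colorings k G" and \<kappa>: "\<And>x. cherry_at G f x = \<kappa> (star_at k G f x)"
  shows "integrable M (\<lambda>x. pmf (cherry_at G f x) \<alpha>)"
    and "cherry_stat G f \<alpha> = (\<Sum>s\<in>star_types d k. pmf (\<kappa> s) \<alpha> * star_stat k G f s)"
  using expectation_finite_valued[OF star_at_measurable[OF f] finite_star_types star_at_in_types[OF f],
      of "\<lambda>s. pmf (\<kappa> s) \<alpha>"]
  by (simp_all add: \<kappa> cherry_stat_def star_stat_eq_law)

lemma integrable_pmf_cherry_at:
  assumes f: "f \<in> colorings k G"
  shows "integrable M (\<lambda>x. pmf (cherry_at G f x) \<alpha>)"
proof -
  obtain \<kappa> where \<kappa>: "\<forall>(H :: 'a graphing) f x. is_graphing d H \<longrightarrow> f \<in> colorings k H \<longrightarrow>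
      cherry_at H f x = \<kappa> (star_at k H f x)"
    using cherry_at_factor[of d k] by (elim exE) (rule that)
  show ?thesis
    by (rule cherry_stat_kernel(1)[OF f, of \<kappa>]) (use \<kappa> is_graphing f in auto)
qed

lemma sum_cherry_stat:
  assumes f: "f \<in> colorings k G"
  shows "(\<Sum>\<alpha>\<in>A. w \<alpha> * cherry_stat G f \<alpha>) = (LINT x|M. (\<Sum>\<alpha>\<in>A. w \<alpha> * pmf (cherry_at G f x) \<alpha>))"
  unfolding cherry_stat_def
  by (subst Bochner_Integration.integral_sum) (simp_all add: integrable_pmf_cherry_at[OF f])

lemma cherry_stat_in_prob_simplex:
  assumes f: "f \<in> colorings k G"
  shows "cherry_stat G f \<in> prob_simplex (cherry_types k)"
proof -
  have "cherry_stat G f \<alpha> = 0" if "\<alpha> \<notin> cherry_types k" for \<alpha>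
  proof -
    have "pmf (cherry_at G f x) \<alpha> = 0" if "x \<in> X" for x
      using cherry_at_in_types[OF f that] \<open>\<alpha> \<notin> cherry_types k\<close> by (auto simp: pmf_eq_0_set_pmf)
    then have "cherry_stat G f \<alpha> = (LINT x|M. 0)"
      unfolding cherry_stat_def by (intro Bochner_Integration.integral_cong) auto
    then show ?thesis
      by simp
  qed
  moreover have "(\<Sum>\<alpha>\<in>cherry_types k. cherry_stat G f \<alpha>) = 1"
  proof -
    have "(\<Sum>\<alpha>\<in>cherry_types k. cherry_stat G f \<alpha>)
      = (LINT x|M. (\<Sum>\<alpha>\<in>cherry_types k. pmf (cherry_at G f x) \<alpha>))"
      using sum_cherry_stat[OF f, of "\<lambda>_. 1" "cherry_types k"] by simp
    also have "\<dots> = (LINT x|M. 1)"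
      using cherry_at_in_types[OF f]
      by (intro Bochner_Integration.integral_cong) (auto simp: sum_pmf_eq_1 finite_cherry_types)
    finally show ?thesis
      by (simp add: prob_space)
  qed
  ultimately show ?thesis
    by (simp add: prob_simplex_def cherry_stat_def)
qed

lemma root_color_cherry_at:
  assumes "\<alpha> \<in> set_pmf (cherry_at G f x)"
  shows "root_color \<alpha> = f x"
proof -
  obtain P where P: "P \<in> leaf_sets G x" "\<alpha> = iso_class (star_graph x P f)"
    using assms by (auto simp: set_cherry_at)
  then have "finite P" "x \<notin> P"
    using finite_nbrs[of x] not_in_nbrs by (auto simp: leaf_sets_def dest: finite_subset)
  then show ?thesis
    unfolding P(2) by (subst root_color_iso_class) (auto simp: is_rcgraph_star_graph, simp add: star_graph_def)
qed

lemma color_law_cherry: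
  assumes f: "f \<in> colorings k G"
  shows "law M f a = (\<Sum>\<alpha>\<in>cherry_types k. (if root_color \<alpha> = a then 1 else 0) * cherry_stat G f \<alpha>)"
proof -
  have "(\<Sum>\<alpha>\<in>cherry_types k. (if root_color \<alpha> = a then 1 else 0) * pmf (cherry_at G f x) \<alpha>)
    = indicator {x \<in> X. f x = a} x" if x: "x \<in> X" for x
  proof -
    have "(\<Sum>\<alpha>\<in>cherry_types k. (if root_color \<alpha> = a then 1 else 0) * pmf (cherry_at G f x) \<alpha>)
      = (\<Sum>\<alpha>\<in>cherry_types k. indicator {x \<in> X. f x = a} x * pmf (cherry_at G f x) \<alpha>)"
    proof (rule sum.cong[OF refl])
      fix \<alpha>
      show "(if root_color \<alpha> = a then 1 else 0) * pmf (cherry_at G f x) \<alpha>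
        = indicator {x \<in> X. f x = a} x * pmf (cherry_at G f x) \<alpha>"
        using root_color_cherry_at[of \<alpha> f x] x
        by (cases "\<alpha> \<in> set_pmf (cherry_at G f x)") (auto simp: pmf_eq_0_set_pmf)
    qed
    also have "\<dots> = indicator {x \<in> X. f x = a} x"
      using cherry_at_in_types[OF f x]
      by (simp add: sum_distrib_left[symmetric] sum_pmf_eq_1 finite_cherry_types)
    finally show ?thesis .
  qed
  then have "(\<Sum>\<alpha>\<in>cherry_types k. (if root_color \<alpha> = a then 1 else 0) * cherry_stat G f \<alpha>)
    = (LINT x|M. indicator {x \<in> X. f x = a} x)"
    unfolding sum_cherry_stat[OF f] by (intro Bochner_Integration.integral_cong) auto
  also have "\<dots> = law M f a"
    using level_set_sets[OF coloring_measurable[OF f], of "\<lambda>b. b = a"] by (simp add: law_def)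
  finally show ?thesis ..
qed

lemma color_law_star:
  assumes f: "f \<in> colorings k G"
  shows "law M f a = (\<Sum>s\<in>star_types d k. (if fst s = a then 1 else 0) * star_stat k G f s)"
  using law_event[OF prob_space_axioms star_at_measurable[OF f] finite_star_types star_at_in_types[OF f],
      of "\<lambda>s. fst s = a"]
  by (simp add: law_def star_stat_eq_law star_at_def del: upt_Suc)

lemma colorings_nonempty: "f \<in> colorings k G \<Longrightarrow> k \<ge> 1"
  using coloring_range not_empty by fastforce

text \<open>Decoding an arbitrary coloring may give values outside \<open>{1..k}\<close>; the
  default 1 turns the result into a \<open>k\<close>-coloring. In the applications the default is
  not taken where decoding is known to be correct.\<close>

lemma clamped_coloring:
  assumes g: "g \<in> measurable M (count_space UNIV)" and k: "k \<ge> 1"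
  shows "(\<lambda>x. if \<psi> (g x) \<in> {1..k} then \<psi> (g x) else 1) \<in> colorings k G"
  unfolding colorings_iff
proof
  show "\<forall>x\<in>X. (if \<psi> (g x) \<in> {1..k} then \<psi> (g x) else 1) \<in> {1..k}"
    using k by auto
  show "(\<lambda>x. if \<psi> (g x) \<in> {1..k} then \<psi> (g x) else 1) \<in> measurable M (count_space UNIV)"
    by (rule measurable_compose[OF g]) simp
qed

lemma tower_consistent_on: "consistent_on G (tower G h) R A"
  unfolding consistent_on_def using code_fst_tower_Suc code_set_tower_Suc by blast

end

section \<open>The two simulations: balls from stars, stars from cherries\<close>

definition dist_colors :: "nat \<Rightarrow> nat \<Rightarrow> nat" where
  "dist_colors d r = Suc ((1 + d) ^ r)"

text \<open>Two points of a ball of radius \<open>R\<close> are at distance at most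
  \<open>2 * R\<close>, so a coloring that separates points at that distance is injective on such
  balls. The choice \<open>R = Suc r\<close> is what \<open>consistent_iso\<close> requires. In the
  constant, 2 undoes the half in \<open>tv_dist\<close>, and \<open>(1 + d) ^ R\<close> pays for
  spreading bad vertices over radius \<open>R\<close>.\<close>

lemma star_stat_simulates:
  fixes G H :: "'a graphing" and r k :: nat
  assumes G: "is_graphing d G" and H: "is_graphing d H"
  defines "R \<equiv> Suc r"
  defines "K \<equiv> tower_bound (pair_bound k (dist_colors d (2 * R))) R"
  shows "simulates (star_stat K) (star_types d K) (\<lambda>G x. card (rel_ball (edge G) R x))
    (\<lambda>G f x. iso_class (colored_ball r G f x)) ((1 + d) ^ R) k K (2 * (1 + real d) ^ R) G H"
  unfolding simulates_def
proof
  interpret G: bounded_graphing d G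
    by unfold_locales (rule G)
  interpret H: bounded_graphing d H
    by unfold_locales (rule H)
  fix f
  assume f: "f \<in> colorings k G"
  obtain c where c: "c \<in> colorings (dist_colors d (2 * R)) G"
    "\<And>x y. x \<in> G.X \<Longrightarrow> y \<in> rel_ball (edge G) (2 * R) x \<Longrightarrow> c x = c y \<Longrightarrow> x = y"
    unfolding dist_colors_def by (rule G.ex_distance_coloring[of "2 * R"]) blast
  define h where "h x = pair_code (f x) (c x)" for x
  let ?e = "tower G h"
  have h: "h \<in> colorings (pair_bound k (dist_colors d (2 * R))) G"
    unfolding h_def by (rule G.pair_coloring[OF f c(1)])
  have g: "?e R \<in> colorings K G"
    unfolding K_def by (rule G.tower_coloring[OF h])
  have inj: "inj_on (\<lambda>v. code_snd (?e 0 v)) (rel_ball (edge G) R x)" if x: "x \<in> G.X" for x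
  proof (rule inj_onI)
    fix u v
    assume uv: "u \<in> rel_ball (edge G) R x" "v \<in> rel_ball (edge G) R x"
      "code_snd (?e 0 u) = code_snd (?e 0 v)"
    have "v \<in> rel_ball (edge G) (R + R) u"
      by (rule rel_ball_trans[OF rel_ball_sym[OF G.edge_sym uv(1)] uv(2)])
    then show "u = v"
      using c(2)[of u v] uv(1,3) G.ball_subset[OF x] by (auto simp: h_def mult_2)
  qed
  \<comment> \<open>The graphing \<open>L\<close> is kept generic: with \<open>L = G\<close>, used
    in both directions, this shows that ball size and ball type depend on the color only; with
    \<open>L = H\<close> it is the inequality demanded of a simulation.\<close>
  have card_le: "card (rel_ball (edge G) R y) \<le> card (rel_ball (edge L) R x)"
    if "is_graphing d L" "x \<in> space (vmeas L)" "y \<in> G.X" "e R x = ?e R y"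
      "consistent_on L e R (rel_ball (edge L) R x)" for L x y and e :: "nat \<Rightarrow> 'a \<Rightarrow> nat"
    using consistent_card_le[OF that(5) G.tower_consistent_on that(4) inj[OF that(3)]]
      bounded_graphing.finite_ball[OF bounded_graphing.intro[OF that(1)] that(2)] by blast
  have iso: "iso_class (colored_ball r L f' x) = iso_class (colored_ball r G f y)"
    if "is_graphing d L" "x \<in> space (vmeas L)" "y \<in> G.X" "e R x = ?e R y"
      "consistent_on L e R (rel_ball (edge L) R x)"
      "card (rel_ball (edge L) R x) = card (rel_ball (edge G) R y)"
      "\<And>u. u \<in> rel_ball (edge L) r x \<Longrightarrow> f' u = code_fst (e 0 u)"
    for L x y and e :: "nat \<Rightarrow> 'a \<Rightarrow> nat" and f'
  proof (rule iso_class_eqI)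
    have L: "bounded_graphing d L"
      by (rule bounded_graphing.intro[OF that(1)])
    show "rroot (colored_ball r L f' x) \<in> rverts (colored_ball r L f' x)"
      by (simp add: colored_ball_def graphing_ball_eq rel_ball_self)
    show "rc_iso (colored_ball r L f' x) (colored_ball r G f y)"
    proof (rule consistent_iso)
      show "consistent_on L e (Suc r) (rel_ball (edge L) (Suc r) x)"
        using that(5) by (simp add: R_def)
      show "consistent_on G ?e (Suc r) (rel_ball (edge G) (Suc r) y)"
        by (rule G.tower_consistent_on)
      show "e (Suc r) x = ?e (Suc r) y"
        using that(4) by (simp only: R_def)
      show "inj_on (\<lambda>v. code_snd (?e 0 v)) (rel_ball (edge G) (Suc r) y)"
        using inj[OF that(3)] by (simp only: R_def)
      show "finite (rel_ball (edge L) (Suc r) x)"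
        by (rule bounded_graphing.finite_ball[OF L that(2)])
      show "card (rel_ball (edge L) (Suc r) x) = card (rel_ball (edge G) (Suc r) y)"
        using that(6) by (simp only: R_def)
      show "f' u = code_fst (e 0 u)" if "u \<in> rel_ball (edge L) r x" for u
        by (rule \<open>\<And>u. u \<in> rel_ball (edge L) r x \<Longrightarrow> f' u = code_fst (e 0 u)\<close>[OF that])
      show "f v = code_fst (?e 0 v)" for v
        by (simp add: h_def)
    qed
  qed
  have f_eq: "f u = code_fst (?e 0 u)" for u
    by (simp add: h_def)
  have same: "card (rel_ball (edge G) R x) = card (rel_ball (edge G) R y) \<and>
      iso_class (colored_ball r G f x) = iso_class (colored_ball r G f y)"
    if "x \<in> G.X" "y \<in> G.X" "?e R x = ?e R y" for x y
  proof -
    have card: "card (rel_ball (edge G) R x) = card (rel_ball (edge G) R y)"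
      using card_le[OF G that(1,2) _ G.tower_consistent_on] that(3)
        card_le[OF G that(2,1) _ G.tower_consistent_on] by (metis le_antisym)
    show ?thesis
      using iso[OF G that G.tower_consistent_on card f_eq] card by blast
  qed
  define y0 where "y0 a = (SOME y. y \<in> G.X \<and> ?e R y = a)" for a
  have y0: "y0 (?e R y) \<in> G.X" "?e R (y0 (?e R y)) = ?e R y" if "y \<in> G.X" for y
    using someI[of "\<lambda>z. z \<in> G.X \<and> ?e R z = ?e R y" y] that by (auto simp: y0_def)
  \<comment> \<open>The default 0 makes the bound on \<open>D\<close> hold also at colors that are
    not attained.\<close>
  define D where "D a = (if a \<in> ?e R ` G.X then card (rel_ball (edge G) R (y0 a)) else 0)" for a
  define T where "T a = iso_class (colored_ball r G f (y0 a))" for a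
  have DT: "D (?e R y) = card (rel_ball (edge G) R y)" "T (?e R y) = iso_class (colored_ball r G f y)"
    if "y \<in> G.X" for y
    using same[OF y0(1)[OF that] that y0(2)[OF that]] that by (auto simp: D_def T_def)
  have D_le: "D a \<le> (1 + d) ^ R" for a
    using G.card_ball_le DT by (cases "a \<in> ?e R ` G.X") (auto simp: D_def)
  have main: "\<exists>f'\<in>colorings k H. \<exists>B\<in>sets H.M.
      measure H.M B \<le> 2 * (1 + real d) ^ R * tv_dist (star_types d K) (star_stat K G (?e R)) (star_stat K H g') \<and>
      (\<forall>a\<in>{1..K}. \<bar>law G.M (?e R) a - law H.M g' a\<bar>
        \<le> 2 * (1 + real d) ^ R * tv_dist (star_types d K) (star_stat K G (?e R)) (star_stat K H g')) \<and>
      (\<forall>x\<in>H.X - B. D (g' x) \<le> card (rel_ball (edge H) R x) \<and>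
        (D (g' x) = card (rel_ball (edge H) R x) \<longrightarrow> T (g' x) = iso_class (colored_ball r H f' x)))"
    if g': "g' \<in> colorings K H" for g'
  proof -
    let ?tv = "tv_dist (star_types d K) (star_stat K G (?e R)) (star_stat K H g')"
    \<comment> \<open>Each \<open>code_fst\<close> strips one layer of the tower, so
      \<open>e' R\<close> is \<open>g'\<close> itself and \<open>e' 0\<close> imitates
      \<open>h\<close>. One further \<open>code_fst\<close>, hence \<open>Suc R\<close>, extracts
      the color under \<open>f\<close>.\<close>
    define e' where "e' j u = (code_fst ^^ (R - j)) (g' u)" for j u
    define f' where "f' u = (if (code_fst ^^ Suc R) (g' u) \<in> {1..k} then (code_fst ^^ Suc R) (g' u) else 1)" for u
    \<comment> \<open>All stars occurring at some vertex of \<open>G\<close>, even on a null set. A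
      star outside \<open>A\<close> has probability 0 in \<open>G\<close>, so those stars have total
      mass at most \<open>2 * ?tv\<close> in \<open>H\<close>.\<close>
    define A where "A = star_at K G (?e R) ` G.X"
    define B0 where "B0 = {x \<in> H.X. star_at K H g' x \<notin> A}"
    define B where "B = {x \<in> H.X. rel_ball (edge H) R x \<inter> B0 \<noteq> {}}"
    have f': "f' \<in> colorings k H"
      unfolding f'_def using H.coloring_measurable[OF g'] G.colorings_nonempty[OF f] by (rule H.clamped_coloring)
    have B0: "B0 \<in> sets H.M"
      unfolding B0_def by (rule H.level_set_sets[OF H.star_at_measurable[OF g']])
    have B: "B \<in> sets H.M" "measure H.M B \<le> (1 + real d) ^ R * measure H.M B0"
      using H.reach_sets_measure[OF B0] by (auto simp: B_def)
    have "star_stat K G (?e R) s = 0" if "s \<notin> A" for s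
    proof -
      have "{x \<in> G.X. star_at K G (?e R) x = s} = {}"
        using that by (auto simp: A_def)
      then show ?thesis
        by (simp only: star_stat_def measure_empty)
    qed
    then have "(\<Sum>s\<in>star_types d K. (if s \<notin> A then 1 else 0) * star_stat K G (?e R) s) = 0"
      by (intro sum.neutral) auto
    moreover have "measure H.M B0 = (\<Sum>s\<in>star_types d K. (if s \<notin> A then 1 else 0) * star_stat K H g' s)"
      using law_event[OF H.prob_space_axioms H.star_at_measurable[OF g'] finite_star_types
          H.star_at_in_types[OF g'], of "\<lambda>s. s \<notin> A"]
      by (simp add: B0_def H.star_stat_eq_law)
    moreover have "\<bar>(\<Sum>s\<in>star_types d K. (if s \<notin> A then 1 else 0) * star_stat K G (?e R) s)
        - (\<Sum>s\<in>star_types d K. (if s \<notin> A then 1 else 0) * star_stat K H g' s)\<bar> \<le> 2 * ?tv"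
      by (rule weighted_diff_le_tv_dist[OF finite_star_types subset_refl]) simp
    ultimately have "measure H.M B0 \<le> 2 * ?tv"
      by linarith
    then have "(1 + real d) ^ R * measure H.M B0 \<le> (1 + real d) ^ R * (2 * ?tv)"
      by (intro mult_left_mono) auto
    also have "\<dots> = 2 * (1 + real d) ^ R * ?tv"
      by simp
    finally have measure_B: "measure H.M B \<le> 2 * (1 + real d) ^ R * ?tv"
      by (rule order_trans[OF B(2)])
    have laws: "\<bar>law G.M (?e R) a - law H.M g' a\<bar> \<le> 2 * (1 + real d) ^ R * ?tv" for a
    proof -
      have "\<bar>law G.M (?e R) a - law H.M g' a\<bar> \<le> 2 * ?tv"
        unfolding G.color_law_star[OF g] H.color_law_star[OF g']
        by (rule weighted_diff_le_tv_dist[OF finite_star_types subset_refl]) simp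
      also have "\<dots> \<le> 2 * (1 + real d) ^ R * ?tv"
        using one_le_power[of "1 + real d" R] tv_dist_nonneg[of "star_types d K"]
        by (intro mult_right_mono) auto
      finally show ?thesis .
    qed
    \<comment> \<open>Each vertex \<open>u\<close> of the ball has its own twin \<open>u1\<close>,
      and twins of adjacent vertices need not be adjacent. This suffices because consistency is a
      condition on single vertices and their neighbor colors.\<close>
    have good: "\<exists>u1\<in>G.X. g' u = ?e R u1 \<and> g' ` nbrs H u = ?e R ` nbrs G u1"
      if "x \<in> H.X - B" "u \<in> rel_ball (edge H) R x" for x u
    proof -
      have "u \<in> H.X" "u \<notin> B0"
        using that H.ball_subset[of x R] by (auto simp: B_def)
      then obtain u1 where u1: "u1 \<in> G.X" "star_at K H g' u = star_at K G (?e R) u1"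
        by (auto simp: B0_def A_def)
      then show ?thesis
        using star_at_eq_nbr_colors[OF H G g' g u1(2)] by blast
    qed
    have pow: "(code_fst ^^ (R - j)) (?e R u) = ?e j u" if "j \<le> R" for j u
      using G.code_fst_power_tower[of "R - j" h j u] that by simp
    have cons: "consistent_on H e' R (rel_ball (edge H) R x)" if x: "x \<in> H.X - B" for x
      unfolding consistent_on_def
    proof (intro allI impI ballI)
      fix j u
      assume j: "j < R" and u: "u \<in> rel_ball (edge H) R x"
      obtain u1 where u1: "g' u = ?e R u1" "g' ` nbrs H u = ?e R ` nbrs G u1"
        using good[OF x u] by blast
      have "R - j = Suc (R - Suc j)"
        using j by simp
      then have "code_fst (e' (Suc j) u) = e' j u"
        by (simp add: e'_def)
      moreover have "code_set (e' (Suc j) u) = code_set (?e (Suc j) u1)"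
        using pow[of "Suc j" u1] j by (simp add: e'_def u1(1) del: tower.simps)
      moreover have "code_set (?e (Suc j) u1) = (\<lambda>v. (code_fst ^^ (R - j)) v) ` ?e R ` nbrs G u1"
        using pow[of j] j by (simp add: G.code_set_tower_Suc image_image del: tower.simps)
      ultimately show "code_fst (e' (Suc j) u) = e' j u \<and> code_set (e' (Suc j) u) = e' j ` nbrs H u"
        by (simp add: u1(2)[symmetric] image_image e'_def)
    qed
    have "D (g' x) \<le> card (rel_ball (edge H) R x) \<and>
        (D (g' x) = card (rel_ball (edge H) R x) \<longrightarrow> T (g' x) = iso_class (colored_ball r H f' x))"
      if x: "x \<in> H.X - B" for x
    proof -
      obtain x1 where x1: "x1 \<in> G.X" "g' x = ?e R x1"
        using good[OF x rel_ball_self] by blast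
      have xX: "x \<in> H.X" and e'R: "e' R x = ?e R x1"
        using x x1(2) by (auto simp: e'_def)
      have le: "D (g' x) \<le> card (rel_ball (edge H) R x)"
        using card_le[OF H xX x1(1) e'R cons[OF x]] DT(1)[OF x1(1)] x1(2) by simp
      \<comment> \<open>The decoded value is the color under \<open>f\<close> of a twin, hence in
        \<open>{1..k}\<close>, and the default in \<open>f'\<close> is not taken.\<close>
      have f'_eq: "f' u = code_fst (e' 0 u)" if u: "u \<in> rel_ball (edge H) r x" for u
      proof -
        have "u \<in> rel_ball (edge H) R x"
          using u rel_ball_mono[of r R "edge H" x] by (auto simp: R_def)
        then obtain u1 where u1: "u1 \<in> G.X" "g' u = ?e R u1"
          using good[OF x] by blast
        have eq: "(code_fst ^^ Suc R) (g' u) = f u1"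
          using pow[of 0 u1] by (simp add: u1(2) h_def)
        show ?thesis
          using G.coloring_range[OF f u1(1)] eq by (simp add: f'_def e'_def)
      qed
      have "T (g' x) = iso_class (colored_ball r H f' x)" if "D (g' x) = card (rel_ball (edge H) R x)"
        using iso[OF H xX x1(1) e'R cons[OF x] _ f'_eq] DT[OF x1(1)] x1(2) that by simp
      then show ?thesis
        using le by blast
    qed
    then show ?thesis
      using f' B(1) measure_B laws by (intro bexI[of _ f'] bexI[of _ B] conjI ballI) blast+
  qed
  show "\<exists>g\<in>colorings K G. \<exists>(D :: nat \<Rightarrow> nat) T. (\<forall>a. D a \<le> (1 + d) ^ R) \<and>
      (\<forall>x\<in>G.X. card (rel_ball (edge G) R x) = D (g x) \<and> iso_class (colored_ball r G f x) = T (g x)) \<and>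
      (\<forall>g'\<in>colorings K H. \<exists>f'\<in>colorings k H. \<exists>B\<in>sets H.M.
        measure H.M B \<le> 2 * (1 + real d) ^ R * tv_dist (star_types d K) (star_stat K G g) (star_stat K H g') \<and>
        (\<forall>a\<in>{1..K}. \<bar>law G.M g a - law H.M g' a\<bar>
          \<le> 2 * (1 + real d) ^ R * tv_dist (star_types d K) (star_stat K G g) (star_stat K H g')) \<and>
        (\<forall>x\<in>H.X - B. D (g' x) \<le> card (rel_ball (edge H) R x) \<and>
          (D (g' x) = card (rel_ball (edge H) R x) \<longrightarrow> T (g' x) = iso_class (colored_ball r H f' x))))"
    by (rule bexI[OF _ g], rule exI[of _ D], rule exI[of _ T], intro conjI allI ballI)
      (simp_all only: D_le DT main)
qed

text \<open>The true neighbors embed into the decoded ones, so the degree is overestimated;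
  subtracting from \<open>d\<close> gives a weight that is underestimated, as
  \<open>simulates\<close> requires. One tower level and a separation at distance 2 suffice, since
  two neighbors of a vertex are at distance at most 2. In the constant, 2 undoes the half in
  \<open>tv_dist\<close> and \<open>2 ^ d\<close> comes from
  \<open>pmf_cherry_at_ge\<close>.\<close>

lemma cherry_stat_simulates:
  fixes G H :: "'a graphing" and k :: nat
  assumes G: "is_graphing d G" and H: "is_graphing d H"
  defines "K \<equiv> tower_bound (pair_bound k (dist_colors d 2)) 1"
  shows "simulates cherry_stat (cherry_types K) (\<lambda>G x. d - card (nbrs G x))
    (star_at k) d k K (2 * 2 ^ d) G H"
  unfolding simulates_def
proof
  interpret G: bounded_graphing d G
    by unfold_locales (rule G)
  interpret H: bounded_graphing d H
    by unfold_locales (rule H)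
  fix f
  assume f: "f \<in> colorings k G"
  obtain c where c: "c \<in> colorings (dist_colors d 2) G"
    "\<And>x y. x \<in> G.X \<Longrightarrow> y \<in> rel_ball (edge G) 2 x \<Longrightarrow> c x = c y \<Longrightarrow> x = y"
    unfolding dist_colors_def by (rule G.ex_distance_coloring[of 2]) blast
  define h where "h x = pair_code (f x) (c x)" for x
  let ?g = "tower G h 1"
  have h: "h \<in> colorings (pair_bound k (dist_colors d 2)) G"
    unfolding h_def by (rule G.pair_coloring[OF f c(1)])
  have g: "?g \<in> colorings K G"
    unfolding K_def by (rule G.tower_coloring[OF h])
  have fst_g: "code_fst (?g x) = h x" and set_g: "code_set (?g x) = h ` nbrs G x" for x
    using G.finite_nbrs by auto
  have inj: "inj_on h (nbrs G x)" for x
  proof (rule inj_onI)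
    fix u v
    assume uv: "u \<in> nbrs G x" "v \<in> nbrs G x" "h u = h v"
    have "rel_ball (edge G) 1 u = insert u (nbrs G u)" "rel_ball (edge G) 1 x = insert x (nbrs G x)"
      using rel_ball_Suc[of "edge G" 0 u] rel_ball_Suc[of "edge G" 0 x] by (simp_all add: nbrs_eq)
    then have "x \<in> rel_ball (edge G) 1 u" "v \<in> rel_ball (edge G) 1 x"
      using uv(1,2) G.nbrs_sym by auto
    then have "v \<in> rel_ball (edge G) (1 + 1) u"
      by (rule rel_ball_trans)
    moreover have "c u = c v"
      using arg_cong[OF uv(3), of code_snd] by (simp add: h_def)
    moreover have "u \<in> G.X"
      using uv(1) G.nbrs_subset by blast
    ultimately show "u = v"
      using c(2)[of u v] by (simp add: numeral_2_eq_2)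
  qed
  define D where "D a = d - card (code_set a)" for a
  define T where "T a = (code_fst (code_fst a),
    map (\<lambda>j. card {b \<in> code_set a. code_fst b = j}) [1..<Suc k])" for a
  have D_le: "D a \<le> d" for a
    by (simp add: D_def)
  have D_g: "d - card (nbrs G x) = D (?g x)" for x
    unfolding D_def set_g using card_image[OF inj] by simp
  have T_g: "star_at k G f x = T (?g x)" for x
  proof -
    have "card {y \<in> nbrs G x. f y = j} = card {b \<in> h ` nbrs G x. code_fst b = j}" for j
    proof -
      have "{b \<in> h ` nbrs G x. code_fst b = j} = h ` {y \<in> nbrs G x. f y = j}"
        by (auto simp: h_def)
      then show ?thesis
        using card_image[OF inj_on_subset[OF inj, of "{y \<in> nbrs G x. f y = j}" x]] by simp
    qed
    then show ?thesis
      unfolding T_def set_g fst_g by (simp add: star_at_def h_def del: upt_Suc)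
  qed
  have main: "\<exists>f'\<in>colorings k H. \<exists>B\<in>sets H.M.
      measure H.M B \<le> 2 * 2 ^ d * tv_dist (cherry_types K) (cherry_stat G ?g) (cherry_stat H g') \<and>
      (\<forall>a\<in>{1..K}. \<bar>law G.M ?g a - law H.M g' a\<bar>
        \<le> 2 * 2 ^ d * tv_dist (cherry_types K) (cherry_stat G ?g) (cherry_stat H g')) \<and>
      (\<forall>x\<in>H.X - B. D (g' x) \<le> d - card (nbrs H x) \<and>
        (D (g' x) = d - card (nbrs H x) \<longrightarrow> T (g' x) = star_at k H f' x))"
    if g': "g' \<in> colorings K H" for g'
  proof -
    let ?tv = "tv_dist (cherry_types K) (cherry_stat G ?g) (cherry_stat H g')"
    define f' where "f' u = (if code_fst (code_fst (g' u)) \<in> {1..k} then code_fst (code_fst (g' u)) else 1)" for u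
    define A where "A = (\<Union>y\<in>G.X. set_pmf (cherry_at G ?g y))"
    define B where "B = {x \<in> H.X. \<not> set_pmf (cherry_at H g' x) \<subseteq> A}"
    let ?N = "cherry_types K - A"
    have f': "f' \<in> colorings k H"
      using H.clamped_coloring[OF H.coloring_measurable[OF g'] G.colorings_nonempty[OF f],
          of "\<lambda>a. code_fst (code_fst a)"]
      by (simp only: f'_def[abs_def])
    have B: "B \<in> sets H.M"
      unfolding B_def
      by (rule H.level_set_sets[OF H.cherry_at_measurable[OF g'], where P = "\<lambda>p. \<not> set_pmf p \<subseteq> A"])
    have zero: "cherry_stat G ?g \<alpha> = 0" if "\<alpha> \<in> ?N" for \<alpha>
    proof -
      have "pmf (cherry_at G ?g x) \<alpha> = 0" if "x \<in> G.X" for x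
        using that \<open>\<alpha> \<in> ?N\<close> unfolding A_def by (auto simp: pmf_eq_0_set_pmf)
      then have "cherry_stat G ?g \<alpha> = (LINT x|G.M. 0)"
        unfolding cherry_stat_def by (intro Bochner_Integration.integral_cong) auto
      then show ?thesis
        by simp
    qed
    have "\<bar>(\<Sum>\<alpha>\<in>?N. 1 * cherry_stat G ?g \<alpha>) - (\<Sum>\<alpha>\<in>?N. 1 * cherry_stat H g' \<alpha>)\<bar> \<le> 2 * ?tv"
      by (rule weighted_diff_le_tv_dist[OF finite_cherry_types Diff_subset]) simp
    moreover have "(\<Sum>\<alpha>\<in>?N. 1 * cherry_stat G ?g \<alpha>) = 0"
      using zero by simp
    ultimately have mass_N: "(\<Sum>\<alpha>\<in>?N. 1 * cherry_stat H g' \<alpha>) \<le> 2 * ?tv"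
      by linarith
    \<comment> \<open>A vertex of \<open>B\<close> shows a cherry outside \<open>A\<close> with
      probability at least \<open>1 / 2 ^ d\<close>, and the total mass of such cherries is already
      bounded.\<close>
    have "measure H.M B / 2 ^ d = (LINT x|H.M. (1 / 2 ^ d) * indicator B x)"
      using B by simp
    also have "\<dots> \<le> (LINT x|H.M. (\<Sum>\<alpha>\<in>?N. 1 * pmf (cherry_at H g' x) \<alpha>))"
    proof (rule integral_mono)
      show "integrable H.M (\<lambda>x. (1 / 2 ^ d) * indicat_real B x)"
        using B by (intro integrable_mult_right integrable_real_indicator) (auto simp: H.emeasure_eq_measure)
      show "integrable H.M (\<lambda>x. \<Sum>\<alpha>\<in>?N. 1 * pmf (cherry_at H g' x) \<alpha>)"
        by (intro Bochner_Integration.integrable_sum integrable_mult_right H.integrable_pmf_cherry_at[OF g'])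
      fix x
      assume x: "x \<in> H.X"
      show "(1 / 2 ^ d) * indicat_real B x \<le> (\<Sum>\<alpha>\<in>?N. 1 * pmf (cherry_at H g' x) \<alpha>)"
      proof (cases "x \<in> B")
        case True
        then obtain \<alpha> where \<alpha>: "\<alpha> \<in> set_pmf (cherry_at H g' x)" "\<alpha> \<notin> A"
          by (auto simp: B_def)
        have "\<alpha> \<in> ?N"
          using \<alpha> H.cherry_at_in_types[OF g' x] by blast
        then have "pmf (cherry_at H g' x) \<alpha> \<le> (\<Sum>\<alpha>\<in>?N. pmf (cherry_at H g' x) \<alpha>)"
          by (intro member_le_sum) (auto simp: finite_cherry_types)
        then show ?thesis
          using H.pmf_cherry_at_ge[OF \<alpha>(1)] True by simp
      qed (simp add: sum_nonneg)
    qed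
    also have "\<dots> = (\<Sum>\<alpha>\<in>?N. 1 * cherry_stat H g' \<alpha>)"
      by (rule H.sum_cherry_stat[OF g', symmetric])
    also have "\<dots> \<le> 2 * ?tv"
      by (rule mass_N)
    finally have measure_B: "measure H.M B \<le> 2 * 2 ^ d * ?tv"
      by (simp add: field_simps)
    have laws: "\<bar>law G.M ?g a - law H.M g' a\<bar> \<le> 2 * 2 ^ d * ?tv" for a
    proof -
      have "\<bar>law G.M ?g a - law H.M g' a\<bar> \<le> 2 * ?tv"
        unfolding G.color_law_cherry[OF g] H.color_law_cherry[OF g']
        by (rule weighted_diff_le_tv_dist[OF finite_cherry_types subset_refl]) simp
      also have "\<dots> \<le> 2 * 2 ^ d * ?tv"
        using one_le_power[of "2::real" d] tv_dist_nonneg[of "cherry_types K"]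
        by (intro mult_right_mono) auto
      finally show ?thesis .
    qed
    have good: "\<exists>y \<phi>. g' x = ?g y \<and> inj_on \<phi> P \<and> \<phi> ` P \<subseteq> nbrs G y \<and> (\<forall>v\<in>P. g' v = ?g (\<phi> v))
        \<and> y \<in> G.X \<and> \<phi> ` P \<subseteq> G.X"
      if x: "x \<in> H.X - B" and P: "P \<in> leaf_sets H x" for x P
    proof -
      have "iso_class (star_graph x P g') \<in> A"
        using x P by (auto simp: B_def H.set_cherry_at)
      then obtain y Q where y: "y \<in> G.X" "Q \<in> leaf_sets G y"
        and eq: "iso_class (star_graph x P g') = iso_class (star_graph y Q ?g)"
        unfolding A_def G.set_cherry_at by blast
      have PQ: "P \<subseteq> nbrs H x" "Q \<subseteq> nbrs G y"
        using P y(2) by (auto simp: leaf_sets_def)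
      then have xy: "finite P" "x \<notin> P" "finite Q" "y \<notin> Q"
        using H.finite_nbrs G.finite_nbrs H.not_in_nbrs G.not_in_nbrs by (auto dest: finite_subset)
      then have "rc_iso (star_graph x P g') (star_graph y Q ?g)"
        using eq iso_class_eq_iff is_rcgraph_star_graph by metis
      then obtain \<phi> where "bij_betw \<phi> P Q" "\<And>v. v \<in> P \<Longrightarrow> ?g (\<phi> v) = g' v" "?g y = g' x"
        by (rule rc_iso_star_graphE[OF _ xy(2,4)]) blast
      then show ?thesis
        using PQ(2) G.nbrs_subset[of y] y(1)
        by (intro exI[of _ y] exI[of _ \<phi>]) (auto simp: bij_betw_def)
    qed
    have "D (g' x) \<le> d - card (nbrs H x) \<and>
        (D (g' x) = d - card (nbrs H x) \<longrightarrow> T (g' x) = star_at k H f' x)"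
      if x: "x \<in> H.X - B" for x
    proof -
      let ?S = "code_set (g' x)" and ?h' = "\<lambda>v. code_fst (g' v)"
      obtain P0 where "P0 \<in> leaf_sets H x"
        using H.leaf_sets_nonempty by blast
      then obtain y where y: "g' x = ?g y" "y \<in> G.X"
        using good[OF x] by blast
      have S: "?S = h ` nbrs G y" "finite ?S" "card ?S = card (nbrs G y)"
        using set_g[of y] G.finite_nbrs[of y] card_image[OF inj[of y]] y(1) by simp_all
      \<comment> \<open>Any two neighbors, possibly equal, appear in a common cherry. Injectivity on
        the neighborhood is a statement about pairs, which is why cherries are enough to test
        it.\<close>
      have pair: "\<exists>P\<in>leaf_sets H x. v \<in> P \<and> w \<in> P" if vw: "v \<in> nbrs H x" "w \<in> nbrs H x" for v w
      proof -
        have "card {v, w} \<le> min 2 (card (nbrs H x))"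
          using vw H.finite_nbrs[of x] by (intro min.boundedI card_mono) (auto simp: card_insert_if)
        then obtain P where "{v, w} \<subseteq> P" "P \<subseteq> nbrs H x" "card P = min 2 (card (nbrs H x))"
          using exists_subset_between[of "{v, w}" "min 2 (card (nbrs H x))" "nbrs H x"] vw
            H.finite_nbrs[of x] by (meson empty_subsetI insert_subset min.cobounded2)
        then show ?thesis
          by (auto simp: leaf_sets_def)
      qed
      have hv: "\<exists>u\<in>G.X. g' v = ?g u \<and> ?h' v \<in> ?S" if v: "v \<in> nbrs H x" for v
      proof -
        obtain P where P: "P \<in> leaf_sets H x" "v \<in> P"
          using pair[OF v v] by blast
        obtain z \<phi> where z: "g' x = ?g z" "\<phi> ` P \<subseteq> nbrs G z" "\<forall>v\<in>P. g' v = ?g (\<phi> v)" "\<phi> ` P \<subseteq> G.X"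
          using good[OF x P(1)] by blast
        have "?h' v = h (\<phi> v)"
          using z(3) P(2) fst_g by simp
        moreover have "?S = h ` nbrs G z"
          using z(1) set_g by simp
        ultimately show ?thesis
          using z P(2) by (intro bexI[of _ "\<phi> v"]) auto
      qed
      \<comment> \<open>A cherry places \<open>v\<close> and \<open>w\<close> over neighbors of one
        vertex of \<open>G\<close>, and \<open>h\<close> separates those.\<close>
      have inj': "inj_on ?h' (nbrs H x)"
      proof (rule inj_onI)
        fix v w
        assume vw: "v \<in> nbrs H x" "w \<in> nbrs H x" "?h' v = ?h' w"
        obtain P where P: "P \<in> leaf_sets H x" "v \<in> P" "w \<in> P"
          using pair[OF vw(1,2)] by blast
        obtain z \<phi> where z: "inj_on \<phi> P" "\<phi> ` P \<subseteq> nbrs G z" "\<forall>v\<in>P. g' v = ?g (\<phi> v)"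
          using good[OF x P(1)] by blast
        have "h (\<phi> v) = h (\<phi> w)"
          using vw(3) z(3) P(2,3) fst_g by simp
        then have "\<phi> v = \<phi> w"
          using inj_onD[OF inj[of z]] z(2) P(2,3) by blast
        then show "v = w"
          using inj_onD[OF z(1)] P(2,3) by blast
      qed
      have sub: "?h' ` nbrs H x \<subseteq> ?S"
        using hv by blast
      have card_le: "card (nbrs H x) \<le> card ?S"
        using card_mono[OF S(2) sub] card_image[OF inj'] by simp
      have "T (g' x) = star_at k H f' x" if eq: "D (g' x) = d - card (nbrs H x)"
      proof -
        \<comment> \<open>Equal differences give equal cardinalities because neither exceeds
          \<open>d\<close>, so natural subtraction does not truncate.\<close>
        have "card (nbrs H x) = card ?S"
          using eq S(3) G.card_nbrs_le[of y] card_le by (simp add: D_def)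
        then have img: "?h' ` nbrs H x = ?S"
          using card_image[OF inj'] by (intro card_subset_eq[OF S(2) sub]) simp
        have f'_eq: "f' v = code_fst (?h' v)" if "g' v = ?g u" "u \<in> G.X" for v u
        proof -
          have "code_fst (?h' v) = f u"
            using that(1) fst_g[of u] by (simp add: h_def)
          then show ?thesis
            using G.coloring_range[OF f that(2)] by (simp add: f'_def)
        qed
        have "card {b \<in> ?S. code_fst b = j} = card {v \<in> nbrs H x. f' v = j}" for j
        proof -
          have f'_nbrs: "f' v = code_fst (?h' v)" if "v \<in> nbrs H x" for v
            using hv[OF that] f'_eq by blast
          have "{b \<in> ?S. code_fst b = j} = ?h' ` {v \<in> nbrs H x. f' v = j}"
            unfolding img[symmetric] using f'_nbrs by auto
          then show ?thesis
            using card_image[OF inj_on_subset[OF inj', of "{v \<in> nbrs H x. f' v = j}"]] by simp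
        qed
        then show ?thesis
          using f'_eq[OF y] by (simp add: T_def star_at_def del: upt_Suc)
      qed
      moreover have "D (g' x) \<le> d - card (nbrs H x)"
        using card_le by (simp add: D_def)
      ultimately show ?thesis
        by blast
    qed
    then show ?thesis
      using f' B measure_B laws by (intro bexI[of _ f'] bexI[of _ B] conjI ballI) blast+
  qed
  show "\<exists>g\<in>colorings K G. \<exists>(D :: nat \<Rightarrow> nat) T. (\<forall>a. D a \<le> d) \<and>
      (\<forall>x\<in>G.X. d - card (nbrs G x) = D (g x) \<and> star_at k G f x = T (g x)) \<and>
      (\<forall>g'\<in>colorings K H. \<exists>f'\<in>colorings k H. \<exists>B\<in>sets H.M.
        measure H.M B \<le> 2 * 2 ^ d * tv_dist (cherry_types K) (cherry_stat G g) (cherry_stat H g') \<and>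
        (\<forall>a\<in>{1..K}. \<bar>law G.M g a - law H.M g' a\<bar>
          \<le> 2 * 2 ^ d * tv_dist (cherry_types K) (cherry_stat G g) (cherry_stat H g')) \<and>
        (\<forall>x\<in>H.X - B. D (g' x) \<le> d - card (nbrs H x) \<and>
          (D (g' x) = d - card (nbrs H x) \<longrightarrow> T (g' x) = star_at k H f' x)))"
    by (rule bexI[OF _ g], rule exI[of _ D], rule exI[of _ T], intro conjI allI ballI)
      (rule D_le D_g T_g main; assumption?)+
qed

section \<open>The implications for a sequence of graphings\<close>

context
  fixes d :: nat and G :: "nat \<Rightarrow> 'a graphing"
  assumes graphings: "\<And>n. n \<ge> 1 \<Longrightarrow> is_graphing d (G n)"
begin

lemma bounded_graphing_n: "n \<ge> 1 \<Longrightarrow> bounded_graphing d (G n)"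
  by (rule bounded_graphing.intro[OF graphings])

lemma colorings_n_nonempty: "n \<ge> 1 \<Longrightarrow> k \<ge> 1 \<Longrightarrow> colorings k (G n) \<noteq> {}"
  using bounded_graphing.const_coloring[OF bounded_graphing_n] by blast

text \<open>The graphing simulates itself, so its ball type is a function of a measurable
  coloring.\<close>

lemma ball_type_measurable:
  assumes "n \<ge> 1" "f \<in> colorings k (G n)"
  shows "(\<lambda>x. iso_class (colored_ball r (G n) f x)) \<in> measurable (vmeas (G n)) (count_space UNIV)"
  by (rule simulates_measurable(2)[OF graphings[OF assms(1)]
        star_stat_simulates[OF graphings[OF assms(1)] graphings[OF assms(1)]] assms(2)])

lemma hausdorff_convergent_ball_stats_iff:
  assumes k: "k \<ge> 1"
  shows "hausdorff_convergent (ball_types d k r) (\<lambda>n. ball_stats d k r (G n)) \<longleftrightarrow>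
    tv_cauchy (ball_types d k r) (\<lambda>n. ball_stat r (G n) ` colorings k (G n))"
  unfolding ball_stats_def
proof (rule hausdorff_convergent_iff_tv_cauchy[OF finite_ball_types])
  fix n :: nat
  assume n: "n \<ge> 1"
  interpret bounded_graphing d "G n"
    by (rule bounded_graphing_n[OF n])
  show "ball_stat r (G n) ` colorings k (G n) \<subseteq> prob_simplex (ball_types d k r)"
    unfolding ball_stat_eq_law
    by (intro image_subsetI law_in_prob_simplex ball_type_measurable[OF n] finite_ball_types
        colored_ball_in_types)
  show "ball_stat r (G n) ` colorings k (G n) \<noteq> {}"
    using colorings_n_nonempty[OF n k] by blast
qed

lemma hausdorff_convergent_star_stats_iff:
  assumes k: "k \<ge> 1"
  shows "hausdorff_convergent (star_types d k) (\<lambda>n. star_stats d k (G n)) \<longleftrightarrow>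
    tv_cauchy (star_types d k) (\<lambda>n. star_stat k (G n) ` colorings k (G n))"
  unfolding star_stats_def
proof (rule hausdorff_convergent_iff_tv_cauchy[OF finite_star_types])
  fix n :: nat
  assume n: "n \<ge> 1"
  interpret bounded_graphing d "G n"
    by (rule bounded_graphing_n[OF n])
  show "star_stat k (G n) ` colorings k (G n) \<subseteq> prob_simplex (star_types d k)"
    unfolding star_stat_eq_law
    by (intro image_subsetI law_in_prob_simplex star_at_measurable finite_star_types star_at_in_types)
  show "star_stat k (G n) ` colorings k (G n) \<noteq> {}"
    using colorings_n_nonempty[OF n k] by blast
qed

lemma hausdorff_convergent_cherry_stats_iff:
  assumes k: "k \<ge> 1"
  shows "hausdorff_convergent (cherry_types k) (\<lambda>n. cherry_stats k (G n)) \<longleftrightarrow>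
    tv_cauchy (cherry_types k) (\<lambda>n. cherry_stat (G n) ` colorings k (G n))"
  unfolding cherry_stats_def
proof (rule hausdorff_convergent_iff_tv_cauchy[OF finite_cherry_types])
  fix n :: nat
  assume n: "n \<ge> 1"
  interpret bounded_graphing d "G n"
    by (rule bounded_graphing_n[OF n])
  show "cherry_stat (G n) ` colorings k (G n) \<subseteq> prob_simplex (cherry_types k)"
    by (intro image_subsetI cherry_stat_in_prob_simplex)
  show "cherry_stat (G n) ` colorings k (G n) \<noteq> {}"
    using colorings_n_nonempty[OF n k] by blast
qed

lemma star_cauchy_of_ball_cauchy:
  assumes "tv_cauchy (ball_types d k 1) (\<lambda>n. ball_stat 1 (G n) ` colorings k (G n))"
  shows "tv_cauchy (star_types d k) (\<lambda>n. star_stat k (G n) ` colorings k (G n))"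
proof -
  obtain \<kappa> where \<kappa>: "\<forall>(H :: 'a graphing) f x. is_graphing d H \<longrightarrow> x \<in> space (vmeas H) \<longrightarrow>
      star_at k H f x = \<kappa> (iso_class (colored_ball 1 H f x))"
    using star_at_factor[of d k] by (elim exE) (rule that)
  show ?thesis
  proof (rule tv_cauchy_contract[OF finite_ball_types finite_star_types _ _ assms])
    fix n :: nat and f \<beta>
    assume n: "n \<ge> 1" and f: "f \<in> colorings k (G n)"
    interpret bounded_graphing d "G n"
      by (rule bounded_graphing_n[OF n])
    have "star_stat k (G n) f \<beta> = measure M {x \<in> X. \<kappa> (iso_class (colored_ball 1 (G n) f x)) = \<beta>}"
      unfolding star_stat_def using \<kappa> is_graphing by (intro arg_cong[where f = "measure M"]) auto
    also have "\<dots> = (\<Sum>\<alpha>\<in>ball_types d k 1. (if \<kappa> \<alpha> = \<beta> then 1 else 0) * ball_stat 1 (G n) f \<alpha>)"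
      unfolding ball_stat_eq_law
      by (rule law_event[OF prob_space_axioms ball_type_measurable[OF n f] finite_ball_types
            colored_ball_in_types[OF f]])
    finally show "star_stat k (G n) f \<beta>
      = (\<Sum>\<alpha>\<in>ball_types d k 1. (if \<kappa> \<alpha> = \<beta> then 1 else 0) * ball_stat 1 (G n) f \<alpha>)" .
  qed simp
qed

lemma cherry_cauchy_of_star_cauchy:
  assumes "tv_cauchy (star_types d k) (\<lambda>n. star_stat k (G n) ` colorings k (G n))"
  shows "tv_cauchy (cherry_types k) (\<lambda>n. cherry_stat (G n) ` colorings k (G n))"
proof -
  obtain \<kappa> where \<kappa>: "\<forall>(H :: 'a graphing) f x. is_graphing d H \<longrightarrow> f \<in> colorings k H \<longrightarrow>
      cherry_at H f x = \<kappa> (star_at k H f x)"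
    using cherry_at_factor[of d k] by (elim exE) (rule that)
  show ?thesis
  proof (rule tv_cauchy_contract[OF finite_star_types finite_cherry_types _ _ assms])
    fix n :: nat and f \<beta>
    assume n: "n \<ge> 1" and f: "f \<in> colorings k (G n)"
    interpret bounded_graphing d "G n"
      by (rule bounded_graphing_n[OF n])
    show "cherry_stat (G n) f \<beta> = (\<Sum>s\<in>star_types d k. pmf (\<kappa> s) \<beta> * star_stat k (G n) f s)"
      by (rule cherry_stat_kernel(2)[OF f]) (use \<kappa> is_graphing f in auto)
  qed (simp add: pmf_le_1)
qed

text \<open>Balls with \<open>k\<close> colors are decoded from stars with the much larger number
  \<open>?K\<close> of colors, so the hypothesis has to cover all numbers of colors.\<close>

lemma ball_cauchy_of_star_cauchy:
  assumes "\<And>k. k \<ge> 1 \<Longrightarrow> tv_cauchy (star_types d k) (\<lambda>n. star_stat k (G n) ` colorings k (G n))"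
    and k: "k \<ge> 1"
  shows "tv_cauchy (ball_types d k r) (\<lambda>n. ball_stat r (G n) ` colorings k (G n))"
proof -
  let ?K = "tower_bound (pair_bound k (dist_colors d (2 * Suc r))) (Suc r)"
  have "?K \<ge> 1"
    using pair_code_ge_1[of 0 0] pair_code_le_pair_bound[of 0 _ 0] by (simp, meson le0 order_trans)
  have "tv_cauchy (ball_types d k r)
    (\<lambda>n. (\<lambda>f. law (vmeas (G n)) (\<lambda>x. iso_class (colored_ball r (G n) f x))) ` colorings k (G n))"
    by (rule tv_cauchy_transfer[OF graphings finite_ball_types _ star_stat_simulates
          assms(1)[OF \<open>?K \<ge> 1\<close>]]) (simp_all add: zero_less_power)
  moreover have "ball_stat r (G n) ` colorings k (G n)
    = (\<lambda>f. law (vmeas (G n)) (\<lambda>x. iso_class (colored_ball r (G n) f x))) ` colorings k (G n)" for n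
    by (simp add: ball_stat_def[abs_def] law_def[abs_def])
  ultimately show ?thesis
    by simp
qed

lemma star_cauchy_of_cherry_cauchy:
  assumes "\<And>k. k \<ge> 1 \<Longrightarrow> tv_cauchy (cherry_types k) (\<lambda>n. cherry_stat (G n) ` colorings k (G n))"
    and k: "k \<ge> 1"
  shows "tv_cauchy (star_types d k) (\<lambda>n. star_stat k (G n) ` colorings k (G n))"
proof -
  let ?K = "tower_bound (pair_bound k (dist_colors d 2)) 1"
  have "?K \<ge> 1"
    using pair_code_ge_1[of 0 0] pair_code_le_pair_bound[of 0 _ 0] by (simp, meson le0 order_trans)
  have "tv_cauchy (star_types d k)
    (\<lambda>n. (\<lambda>f. law (vmeas (G n)) (star_at k (G n) f)) ` colorings k (G n))"
    by (rule tv_cauchy_transfer[OF graphings finite_star_types _ cherry_stat_simulates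
          assms(1)[OF \<open>?K \<ge> 1\<close>]]) (simp_all add: zero_less_power)
  moreover have "star_stat k (G n) ` colorings k (G n)
    = (\<lambda>f. law (vmeas (G n)) (star_at k (G n) f)) ` colorings k (G n)" for n
    by (simp add: star_stat_def[abs_def] law_def[abs_def])
  ultimately show ?thesis
    by simp
qed

end

theorem theorem4p2:
  fixes d :: nat and G :: "nat \<Rightarrow> 'a graphing"
  assumes "d \<ge> 2"
    and "\<And>n. n \<ge> 1 \<Longrightarrow> is_graphing d (G n)"
  shows "(local_global_convergent d G \<longleftrightarrow>
            (\<forall>k\<ge>1. hausdorff_convergent (star_types d k) (\<lambda>n. star_stats d k (G n))))
       \<and> ((\<forall>k\<ge>1. hausdorff_convergent (star_types d k) (\<lambda>n. star_stats d k (G n))) \<longleftrightarrow>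
            (\<forall>k\<ge>1. hausdorff_convergent (cherry_types k) (\<lambda>n. cherry_stats k (G n))))"
proof -
  let ?ball = "\<forall>k\<ge>1. \<forall>r. tv_cauchy (ball_types d k r) (\<lambda>n. ball_stat r (G n) ` colorings k (G n))"
  let ?star = "\<forall>k\<ge>1. tv_cauchy (star_types d k) (\<lambda>n. star_stat k (G n) ` colorings k (G n))"
  let ?cherry = "\<forall>k\<ge>1. tv_cauchy (cherry_types k) (\<lambda>n. cherry_stat (G n) ` colorings k (G n))"
  have ball: "local_global_convergent d G \<longleftrightarrow> ?ball"
    unfolding local_global_convergent_def
    using hausdorff_convergent_ball_stats_iff[of d G, OF assms(2)] by simp
  have star: "(\<forall>k\<ge>1. hausdorff_convergent (star_types d k) (\<lambda>n. star_stats d k (G n))) \<longleftrightarrow> ?star"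
    using hausdorff_convergent_star_stats_iff[of d G, OF assms(2)] by simp
  have cherry: "(\<forall>k\<ge>1. hausdorff_convergent (cherry_types k) (\<lambda>n. cherry_stats k (G n))) \<longleftrightarrow> ?cherry"
    using hausdorff_convergent_cherry_stats_iff[of d G, OF assms(2)] by simp
  have "?star" if "?ball"
    by (intro allI impI star_cauchy_of_ball_cauchy[OF assms(2)]) (use that in simp_all)
  moreover have "?ball" if "?star"
    by (intro allI impI ball_cauchy_of_star_cauchy[OF assms(2)]) (use that in simp_all)
  moreover have "?cherry" if "?star"
    by (intro allI impI cherry_cauchy_of_star_cauchy[OF assms(2)]) (use that in simp_all)
  moreover have "?star" if "?cherry"
    by (intro allI impI star_cauchy_of_cherry_cauchy[OF assms(2)]) (use that in simp_all)
  ultimately show ?thesis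
    unfolding ball star cherry by (intro conjI iffI)
qed

end
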